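(* Let $(\bar\phi',a'):(N',c',\Sigma',\mathcal B')\to(Q,d,\Lambda,\mathcal C)$ and $(\bar\phi'',a''):(N'',c'',\Sigma'',\mathcal B'')\to(Q,d,\Lambda,\mathcal C)$ be morphisms in the category of decorated fans. If $a'$ and $a''$ are not both $0$, then their fiber product in the category of decorated fans is the object $(N,c,\Sigma,\mathcal B)$ with projections $(\bar\psi',a''):(N,c,\Sigma,\mathcal B)\to(N',c',\Sigma',\mathcal B')$ and $(\bar\psi'',a'):(N,c,\Sigma,\mathcal B)\to(N'',c'',\Sigma'',\mathcal B'')$, where $$N=N'\times_QN'',\quad c=c'\times_dc'',\quad\Sigma=\Sigma'\times_\Lambda\Sigma'',\quad\mathcal B=\mathcal B'\times_{\mathcal C}\mathcal B'',$$ and $\bar\psi':N\to N'$, $\bar\psi'':N\to N''$ are the natural maps.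
   Context: Category of decorated fans. For a lattice $N$, $M=N^*$, $N_{\mathbb R}=N\otimes\mathbb R$, $N_{\mathbb C}=N\otimes\mathbb C$; for a strongly convex rational polyhedral cone $\sigma\subset N_{\mathbb R}$, $S_\sigma=\check\sigma\cap M$, and $m'\le_\sigma m$ means $m-m'\in S_\sigma$. Objects are $(N,c,\Sigma,\mathcal B)$ with $N$ a lattice, $c\in N_{\mathbb C}$, $\Sigma$ a fan in $N_{\mathbb R}$, and $\mathcal B=\{\mathcal B_\sigma\}_{\sigma\in\Sigma}$ $c$-admissible decorations: nonempty finite sets $\mathcal B_\sigma\subset S_\sigma$ such that for all $\sigma,\sigma'\in\Sigma$: (i) for all $m\in S_\sigma$ with $\langle m,c\rangle\ne0$ there is $b\in\mathcal B_\sigma$ with $b\le_\sigma m$; (ii) for all $b\in\mathcal B_\sigma$ there is $b'\in\mathcal B_{\sigma'}$ with $b'\le_{\sigma\cap\sigma'}b$; (iii) if $a,b\in\mathcal B_\sigma$ and $a\le_\sigma b$ then $a=b$. Morphisms $(N,c,\Sigma,\mathcal B)\to(N',c',\Sigma',\mathcal B')$ are pairs $(\bar\phi,a)$, $\bar\phi:N\to N'$ a lattice map, $a\in\mathbb C$, with $\bar\phi_{\mathbb C}(c)=a^2c'$, such that for each $\sigma\in\Sigma$ there is $\sigma'\in\Sigma'$ with $\bar\phi_{\mathbb R}(\sigma)\subseteq\sigma'$, and either $a=0$ or: whenever $\bar\phi_{\mathbb R}(\sigma)\subseteq\sigma'$ and $b'\in\mathcal B'_{\sigma'}$ there is $b\in\mathcal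 B_\sigma$ with $b\le_\sigma\bar\phi^*(b')$. Composition: $(\bar\phi',a')\circ(\bar\phi,a)=(\bar\phi'\circ\bar\phi,aa')$. Constructions in the statement. $N'\times_QN''=\{(n',n'')\in N'\times N''\mid\bar\phi'(n')=\bar\phi''(n'')\}$. $\Sigma'\times_\Lambda\Sigma''$ is the set of pairs $\sigma=(\sigma',\sigma'')\in\Sigma'\times\Sigma''$ for which there is $\lambda\in\Lambda$ with $\bar\phi'_{\mathbb R}(\sigma'),\bar\phi''_{\mathbb R}(\sigma'')\subseteq\lambda$; the pair $(\sigma',\sigma'')$ stands for the cone $(\sigma'\times\sigma'')\cap N_{\mathbb R}$ in $N_{\mathbb R}$, and $(N,\Sigma)$ is the fiber product in the usual category of fans. $c'\times_dc''=((a'')^2c',(a')^2c'')\in N_{\mathbb C}$. Let $M=N^*$, $M'=(N')^*$, $M''=(N'')^*$ and let $\pi:M'\times M''\to M$ be the natural surjection, $\langle\pi(m',m''),(n',n'')\rangle=\langle m',n'\rangle+\langle m'',n''\rangle$; elements of $M'\times M''$ are regarded as elements of $M$ via $\pi$. For $\sigma=(\sigma',\sigma'')\in\Sigma$ let $J^\sigma_c=(x^m\in\mathbb C[S_\sigma]\mid\langle m,c\rangle\neq0)$ and define the ideal of $\mathbb C[S_\sigma]$ $$J^\sigma=\begin{cases}J^\sigma_c+\big((\mathcal B'_{\sigma'}\times\{0\})\cup(\{0\}\times\mathcal B''_{\sigma''})\big)&a',a''\neq0\\ J_c^\sigma+(\mathcal B'_{\sigma'}\times\{0\})&a'=0\\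 J_c^\sigma+(\{0\}\times\mathcal B''_{\sigma''})&a''=0\end{cases}$$ where a set of lattice points in parentheses denotes the ideal generated by the corresponding monomials. Then $\mathcal B_\sigma=\mathcal B'_{\sigma'}\times_{\mathcal C}\mathcal B''_{\sigma''}$ is the minimal generating set of $J^\sigma$ by monic monomials (unique up to multiplication by invertible monomials of $\mathbb C[S_\sigma]$), and $\mathcal B'\times_{\mathcal C}\mathcal B''=\{\mathcal B_\sigma\}_{\sigma\in\Sigma}$. *)

theory Defs
  imports
    Complex_Main
    "HOL-Library.Function_Algebras"
    "HOL-Library.Product_Plus"
    "HOL-Library.Poly_Mapping"
    "HOL-Algebra.Ideal"
begin

section \<open>Lattices and extension of scalars\<close>

text \<open>
  Groups are subsets of types of class \<open>ab_group_add\<close>.  A homomorphism is represented by the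
  function that is \<open>0\<close> outside its domain, so that equality of homomorphisms is equality of
  functions, composition is plain \<open>\<circ>\<close>, and groups of homomorphisms are again subgroups of a type
  of class \<open>ab_group_add\<close> (with pointwise operations).
\<close>

definition Homs :: "'a::ab_group_add set \<Rightarrow> 'b::ab_group_add set \<Rightarrow> ('a \<Rightarrow> 'b) set" where
  "Homs A B = {f. f ` A \<subseteq> B \<and> (\<forall>x\<in>A. \<forall>y\<in>A. f (x + y) = f x + f y) \<and> (\<forall>x. x \<notin> A \<longrightarrow> f x = 0)}"

text \<open>The free abelian group of rank \<open>n\<close>.\<close>

definition Zpow :: "nat \<Rightarrow> (nat \<Rightarrow> int) set" where
  "Zpow n = {z. \<forall>i\<ge>n. z i = 0}"

definition is_lattice :: "'a::ab_group_add set \<Rightarrow> bool" where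
  "is_lattice N \<longleftrightarrow> (\<exists>n. \<exists>f \<in> Homs (Zpow n) N. bij_betw f (Zpow n) N)"

definition dual :: "'a::ab_group_add set \<Rightarrow> ('a \<Rightarrow> int) set" where
  "dual N = Homs N UNIV"

text \<open>
  For a lattice \<open>N\<close> and a commutative ring \<open>K\<close>, the module \<open>N \<otimes> K\<close> is modelled by \<open>Hom(M, K)\<close>
  with \<open>M = N*\<close>; the pure tensor \<open>n \<otimes> k\<close> is the map \<open>m \<mapsto> k \<langle>m, n\<rangle>\<close>, and the pairing of \<open>M\<close>
  with \<open>N \<otimes> K\<close> is evaluation.  Lemma \<open>ext_universal\<close> below shows that this is a tensor product.
\<close>

definition ext :: "'a::ab_group_add set \<Rightarrow> (('a \<Rightarrow> int) \<Rightarrow> 'k::comm_ring_1) set" where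
  "ext N = Homs (dual N) UNIV"

definition tens :: "'a::ab_group_add set \<Rightarrow> 'a \<Rightarrow> 'k::comm_ring_1 \<Rightarrow> ('a \<Rightarrow> int) \<Rightarrow> 'k" where
  "tens N n k = (\<lambda>m. if m \<in> dual N then k * of_int (m n) else 0)"

definition scale :: "'k::comm_ring_1 \<Rightarrow> (('a \<Rightarrow> int) \<Rightarrow> 'k) \<Rightarrow> ('a \<Rightarrow> int) \<Rightarrow> 'k" where
  "scale k x = (\<lambda>m. k * x m)"

abbreviation (input) pairing :: "('a \<Rightarrow> int) \<Rightarrow> (('a \<Rightarrow> int) \<Rightarrow> 'k) \<Rightarrow> 'k" (\<open>\<langle>_,_\<rangle>\<close>) where
  "\<langle>m,x\<rangle> \<equiv> x m"

text \<open>
  For a homomorphism \<open>\<phi>\<close> into the lattice \<open>N'\<close>: the dual map on \<open>dual N'\<close>, and the map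
  \<open>\<phi> \<otimes> K\<close> into \<open>ext N'\<close> (see \<open>ext_map_tens\<close>).
\<close>

definition pullback :: "('a \<Rightarrow> 'b) \<Rightarrow> ('b \<Rightarrow> int) \<Rightarrow> 'a \<Rightarrow> int" where
  "pullback \<phi> m' = m' \<circ> \<phi>"

definition ext_map :: "'b::ab_group_add set \<Rightarrow> ('a \<Rightarrow> 'b) \<Rightarrow> (('a \<Rightarrow> int) \<Rightarrow> 'k::comm_ring_1) \<Rightarrow> ('b \<Rightarrow> int) \<Rightarrow> 'k" where
  "ext_map N' \<phi> x = (\<lambda>m'. if m' \<in> dual N' then x (pullback \<phi> m') else 0)"

lemma HomsD:
  assumes "f \<in> Homs A B"
  shows "\<And>x. x \<in> A \<Longrightarrow> f x \<in> B"
    and "\<And>x y. x \<in> A \<Longrightarrow> y \<in> A \<Longrightarrow> f (x + y) = f x + f y"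
    and "\<And>x. x \<notin> A \<Longrightarrow> f x = 0"
  using assms unfolding Homs_def by blast+

lemma ext_map_tens:
  assumes "\<phi> \<in> Homs N N'" "n \<in> N"
  shows "ext_map N' \<phi> (tens N n k) = tens N' (\<phi> n) k"
proof -
  have "pullback \<phi> m' \<in> dual N" if m': "m' \<in> dual N'" for m'
  proof -
    have "m' (0::'b) = 0"
    proof (cases "(0::'b) \<in> N'")
      case True
      from True True have "m' (0 + 0) = m' 0 + m' 0"
        by (intro HomsD(2)[OF m'[unfolded dual_def]])
      then show ?thesis by simp
    next
      case False
      then show ?thesis by (rule HomsD(3)[OF m'[unfolded dual_def]])
    qed
    then have 2: "(m' \<circ> \<phi>) x = 0" if "x \<notin> N" for x
      by (simp only: o_apply HomsD(3)[OF assms(1) that])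
    have 1: "(m' \<circ> \<phi>) (x + y) = (m' \<circ> \<phi>) x + (m' \<circ> \<phi>) y" if "x \<in> N" "y \<in> N" for x y
      using HomsD(2)[OF m'[unfolded dual_def] HomsD(1)[OF assms(1) that(1)] HomsD(1)[OF assms(1) that(2)]]
      by (simp only: o_apply HomsD(2)[OF assms(1) that])
    show ?thesis
      unfolding dual_def pullback_def Homs_def using 1 2 by blast
  qed
  then show ?thesis
    by (simp add: ext_map_def tens_def fun_eq_iff pullback_def)
qed

definition unitvec :: "nat \<Rightarrow> nat \<Rightarrow> int" where
  "unitvec i = (\<lambda>j. if j = i then 1 else 0)"

lemma Zpow_additive_zero:
  fixes D :: "(nat \<Rightarrow> int) \<Rightarrow> 'g::ab_group_add"
  assumes add: "\<And>y z. y \<in> Zpow n \<Longrightarrow> z \<in> Zpow n \<Longrightarrow> D (y + z) = D y + D z"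
    and e: "\<And>i. i < n \<Longrightarrow> D (unitvec i) = 0" and z: "z \<in> Zpow n"
  shows "D z = 0"
  using assms
proof (induction n arbitrary: z)
  case 0
  have "(0::nat \<Rightarrow> int) \<in> Zpow 0" by (simp add: Zpow_def)
  then have "D (0 + 0) = D 0 + D 0" using "0.prems"(1) by blast
  then have "D 0 = 0" by simp
  moreover have "z = 0" using "0.prems"(3) by (simp add: Zpow_def fun_eq_iff)
  ultimately show ?case by (simp only:)
next
  case (Suc n)
  have sub: "y \<in> Zpow (Suc n)" if "y \<in> Zpow n" for y using that by (auto simp: Zpow_def)
  have 0: "D y = 0" if "y \<in> Zpow n" for y
    by (rule Suc.IH[OF _ _ that]) (use Suc.prems(1,2) sub in auto)
  define v where "v = (\<lambda>k::int. (\<lambda>j. if j = n then k else 0))"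
  have vin: "v k \<in> Zpow (Suc n)" for k by (auto simp: v_def Zpow_def)
  have vadd: "v (k + l) = v k + v l" for k l by (auto simp: v_def fun_eq_iff)
  have Dadd: "D (v (k + l)) = D (v k) + D (v l)" for k l
    unfolding vadd by (rule Suc.prems(1)[OF vin vin])
  have v1: "D (v 1) = 0"
    using Suc.prems(2)[of n] by (simp add: v_def unitvec_def)
  have v0: "D (v 0) = 0" using Dadd[of 0 0] by simp
  have vm: "D (v (- 1)) = 0" using Dadd[of "-1" 1] v1 v0 by simp
  have vk: "D (v k) = 0" for k
  proof (induction k rule: int_induct[of _ 0])
    case base
    then show ?case by (rule v0)
  next
    case (step1 i)
    then show ?case using Dadd[of i 1] v1 by simp
  next
    case (step2 i)
    then show ?case using Dadd[of i "-1"] vm by simp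
  qed
  have yin: "z(n := 0) \<in> Zpow n" using Suc.prems(3) by (auto simp: Zpow_def)
  have "z = v (z n) + z(n := 0)" by (auto simp: v_def fun_eq_iff)
  then have "D z = D (v (z n)) + D (z(n := 0))"
    using Suc.prems(1)[OF vin sub[OF yin]] by metis
  then show ?case using vk 0[OF yin] by simp
qed

lemma sum_unitvec:
  fixes c :: "nat \<Rightarrow> 'k::comm_ring_1"
  assumes "i < r"
  shows "(\<Sum>j<r. c j * of_int (unitvec i j)) = c i"
proof -
  have "(\<Sum>j<r. c j * of_int (unitvec i j)) = (\<Sum>j<r. if j = i then c j else 0)"
    by (intro sum.cong) (auto simp: unitvec_def)
  then show ?thesis using assms by simp
qed

lemma ext_universal:
  fixes \<beta> :: "'a::ab_group_add \<Rightarrow> 'k::comm_ring_1 \<Rightarrow> 'g::ab_group_add"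
  assumes "is_lattice N"
    and badd1: "\<And>x y k. x \<in> N \<Longrightarrow> y \<in> N \<Longrightarrow> \<beta> (x + y) k = \<beta> x k + \<beta> y k"
    and badd2: "\<And>x k l. x \<in> N \<Longrightarrow> \<beta> x (k + l) = \<beta> x k + \<beta> x l"
  shows "\<exists>!h. h \<in> Homs (ext N) UNIV \<and> (\<forall>n\<in>N. \<forall>k. h (tens N n k) = \<beta> n k)"
proof -
  obtain r f where f: "f \<in> Homs (Zpow r) N" and bij: "bij_betw f (Zpow r) N"
    using assms(1) unfolding is_lattice_def by blast
  define g where "g = inv_into (Zpow r) f"
  have fN: "f z \<in> N" if "z \<in> Zpow r" for z using HomsD(1)[OF f that] .
  have fadd: "f (y + z) = f y + f z" if "y \<in> Zpow r" "z \<in> Zpow r" for y z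
    using HomsD(2)[OF f that] .
  have gZ: "g x \<in> Zpow r" and fg: "f (g x) = x" if "x \<in> N" for x
    using bij that unfolding g_def
    by (auto simp: bij_betw_def inv_into_into f_inv_into_f)
  have gf: "g (f z) = z" if "z \<in> Zpow r" for z
    using bij that unfolding g_def by (simp add: bij_betw_def inv_into_f_f)
  have Zadd: "y + z \<in> Zpow r" if "y \<in> Zpow r" "z \<in> Zpow r" for y z
    using that by (auto simp: Zpow_def)
  have Nadd: "x + y \<in> N" if "x \<in> N" "y \<in> N" for x y
    using fN[OF Zadd[OF gZ[OF that(1)] gZ[OF that(2)]]] fadd[OF gZ[OF that(1)] gZ[OF that(2)]]
      fg that by simp
  have gadd: "g (x + y) = g x + g y" if "x \<in> N" "y \<in> N" for x y
    using gf[OF Zadd[OF gZ[OF that(1)] gZ[OF that(2)]]] fadd[OF gZ[OF that(1)] gZ[OF that(2)]]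
      fg that by simp
  have uZ: "unitvec i \<in> Zpow r" if "i < r" for i using that by (auto simp: Zpow_def unitvec_def)
  define e where "e = (\<lambda>i. f (unitvec i))"
  have eN: "e i \<in> N" if "i < r" for i using that uZ fN by (simp add: e_def)
  define w where "w = (\<lambda>z::nat \<Rightarrow> int. \<lambda>y. if y \<in> N then \<Sum>i<r. z i * g y i else 0)"
  have wM: "w z \<in> dual N" for z
    unfolding dual_def Homs_def
    by (auto simp: w_def Nadd gadd distrib_left sum.distrib)
  have wadd: "w (y + z) = w y + w z" for y z
    by (auto simp: w_def fun_eq_iff distrib_right sum.distrib)
  define d where "d = (\<lambda>i. w (unitvec i))"
  have d: "d i y = g y i" if "i < r" "y \<in> N" for i y
  proof -
    have "(\<Sum>j<r. unitvec i j * g y j) = (\<Sum>j<r. if j = i then g y j else 0)"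
      by (intro sum.cong) (auto simp: unitvec_def)
    then show ?thesis using that by (simp add: d_def w_def)
  qed
  have dM: "d i \<in> dual N" for i by (simp add: d_def wM)
  have Mrep: "m = w (\<lambda>i. if i < r then m (e i) else 0)" if m: "m \<in> dual N" for m
  proof
    fix y
    show "m y = w (\<lambda>i. if i < r then m (e i) else 0) y"
    proof (cases "y \<in> N")
      case True
      have madd: "m (x + y) = m x + m y" if "x \<in> N" "y \<in> N" for x y
        using HomsD(2)[OF m[unfolded dual_def] that] .
      have "m (f z) - (\<Sum>i<r. m (e i) * z i) = 0" if "z \<in> Zpow r" for z
      proof (rule Zpow_additive_zero[OF _ _ that])
        fix y z assume "y \<in> Zpow r" "z \<in> Zpow r"
        then show "m (f (y + z)) - (\<Sum>i<r. m (e i) * (y + z) i) =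
            (m (f y) - (\<Sum>i<r. m (e i) * y i)) + (m (f z) - (\<Sum>i<r. m (e i) * z i))"
          by (simp add: fadd madd fN distrib_left sum.distrib)
      next
        fix i assume i: "i < r"
        then show "m (f (unitvec i)) - (\<Sum>j<r. m (e j) * unitvec i j) = 0"
          using sum_unitvec[OF i, of "\<lambda>j. m (e j)"] by (simp add: e_def)
      qed
      from this[OF gZ[OF True]] show ?thesis using True by (simp add: fg w_def)
    next
      case False
      then show ?thesis using m by (simp add: w_def dual_def Homs_def)
    qed
  qed
  have xadd: "x (m + m') = x m + x m'"
    if "x \<in> ext N" "m \<in> dual N" "m' \<in> dual N" for x :: "('a \<Rightarrow> int) \<Rightarrow> 'k" and m m'
    using HomsD(2)[OF that(1)[unfolded ext_def] that(2,3)] .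
  have tens_ext: "tens N n k \<in> ext N" if "n \<in> N" for n and k :: 'k
    unfolding ext_def Homs_def tens_def by (auto simp: dual_def Homs_def algebra_simps)
  have ext_add: "x + y \<in> ext N" if "x \<in> ext N" "y \<in> ext N" for x y :: "('a \<Rightarrow> int) \<Rightarrow> 'k"
    using that unfolding ext_def Homs_def by (auto simp: algebra_simps)
  have ext_0: "(0::('a \<Rightarrow> int) \<Rightarrow> 'k) \<in> ext N"
    unfolding ext_def Homs_def by auto
  have b0: "\<beta> x 0 = 0" if "x \<in> N" for x using badd2[OF that, of 0 0] by simp
  have Xrep: "x = (\<Sum>i<r. tens N (e i) (x (d i)))" if x: "x \<in> ext N" for x :: "('a \<Rightarrow> int) \<Rightarrow> 'k"
  proof
    fix m
    have sapp: "(\<Sum>i\<in>I. tens N (e i) (x (d i))) m = (\<Sum>i\<in>I. tens N (e i) (x (d i)) m)" for I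
      by (induction I rule: infinite_finite_induct) auto
    show "x m = (\<Sum>i<r. tens N (e i) (x (d i))) m"
    proof (cases "m \<in> dual N")
      case True
      have *: "x (w z) - (\<Sum>i<r. x (d i) * of_int (z i)) = 0" if "z \<in> Zpow r" for z
      proof (rule Zpow_additive_zero[OF _ _ that])
        fix y z
        show "x (w (y + z)) - (\<Sum>i<r. x (d i) * of_int ((y + z) i)) =
            (x (w y) - (\<Sum>i<r. x (d i) * of_int (y i))) +
            (x (w z) - (\<Sum>i<r. x (d i) * of_int (z i)))"
          by (simp add: wadd xadd[OF x wM wM] distrib_left sum.distrib)
      next
        fix i assume i: "i < r"
        show "x (w (unitvec i)) - (\<Sum>j<r. x (d j) * of_int (unitvec i j)) = 0"
          using sum_unitvec[OF i, of "\<lambda>j. x (d j)"] by (simp add: d_def)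
      qed
      have "x m = x (w (\<lambda>i. if i < r then m (e i) else 0))" using Mrep[OF True] by simp
      also have "\<dots> = (\<Sum>i<r. x (d i) * of_int (m (e i)))"
        using *[of "\<lambda>i. if i < r then m (e i) else 0"] by (simp add: Zpow_def)
      finally show ?thesis using True unfolding sapp by (simp add: tens_def)
    next
      case False
      then show ?thesis using x unfolding sapp by (simp add: tens_def ext_def Homs_def)
    qed
  qed
  define h where
    "h = (\<lambda>x::('a \<Rightarrow> int) \<Rightarrow> 'k. if x \<in> ext N then \<Sum>i<r. \<beta> (e i) (x (d i)) else 0)"
  have hHom: "h \<in> Homs (ext N) UNIV"
    unfolding Homs_def by (auto simp: h_def ext_add badd2 eN sum.distrib)
  have ht: "h (tens N n k) = \<beta> n k" if n: "n \<in> N" for n k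
  proof -
    have "(\<Sum>i<r. \<beta> (e i) (k * of_int (z i))) - \<beta> (f z) k = 0" if "z \<in> Zpow r" for z
    proof (rule Zpow_additive_zero[OF _ _ that])
      fix y z assume "y \<in> Zpow r" "z \<in> Zpow r"
      then show "(\<Sum>i<r. \<beta> (e i) (k * of_int ((y + z) i))) - \<beta> (f (y + z)) k =
          ((\<Sum>i<r. \<beta> (e i) (k * of_int (y i))) - \<beta> (f y) k) +
          ((\<Sum>i<r. \<beta> (e i) (k * of_int (z i))) - \<beta> (f z) k)"
        by (simp add: fadd badd1 fN distrib_left badd2 eN sum.distrib)
    next
      fix i assume i: "i < r"
      have "(\<Sum>j<r. \<beta> (e j) (k * of_int (unitvec i j))) = (\<Sum>j<r. if j = i then \<beta> (e j) k else 0)"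
        by (intro sum.cong) (auto simp: unitvec_def b0 eN)
      then show "(\<Sum>j<r. \<beta> (e j) (k * of_int (unitvec i j))) - \<beta> (f (unitvec i)) k = 0"
        using i by (simp add: e_def)
    qed
    from this[OF gZ[OF n]] have "(\<Sum>i<r. \<beta> (e i) (k * of_int (g n i))) = \<beta> n k"
      by (simp add: fg[OF n])
    moreover have "h (tens N n k) = (\<Sum>i<r. \<beta> (e i) (tens N n k (d i)))"
      by (simp add: h_def tens_ext[OF n])
    ultimately show ?thesis by (simp add: tens_def dM d[OF _ n])
  qed
  show ?thesis
  proof (rule ex1I[of _ h])
    show "h \<in> Homs (ext N) UNIV \<and> (\<forall>n\<in>N. \<forall>k. h (tens N n k) = \<beta> n k)"
      using hHom ht by blast
  next
    fix h' assume h': "h' \<in> Homs (ext N) UNIV \<and> (\<forall>n\<in>N. \<forall>k. h' (tens N n k) = \<beta> n k)"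
    have 0: "h' 0 = 0"
      using HomsD(2)[of h' "ext N" UNIV 0 0] h' ext_0 by simp
    have s: "(\<Sum>i\<in>I. tens N (e i) (k i)) \<in> ext N \<and>
        h' (\<Sum>i\<in>I. tens N (e i) (k i)) = (\<Sum>i\<in>I. \<beta> (e i) (k i))"
      if "I \<subseteq> {..<r}" for I k
      using finite_subset[OF that finite_lessThan] that
    proof (induction I rule: finite_induct)
      case empty
      then show ?case unfolding sum.empty using ext_0 0 by blast
    next
      case (insert i I)
      then have eiN: "e i \<in> N" and
        IH: "(\<Sum>i\<in>I. tens N (e i) (k i)) \<in> ext N"
          "h' (\<Sum>i\<in>I. tens N (e i) (k i)) = (\<Sum>i\<in>I. \<beta> (e i) (k i))"
        using eN by auto
      have "h' (tens N (e i) (k i) + (\<Sum>i\<in>I. tens N (e i) (k i))) =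
          \<beta> (e i) (k i) + (\<Sum>i\<in>I. \<beta> (e i) (k i))"
        using HomsD(2)[OF conjunct1[OF h'] tens_ext[OF eiN] IH(1)] h' eiN IH(2) by simp
      then show ?case
        unfolding sum.insert[OF insert.hyps] using ext_add[OF tens_ext[OF eiN] IH(1)] by blast
    qed
    show "h' = h"
    proof
      fix x :: "('a \<Rightarrow> int) \<Rightarrow> 'k"
      show "h' x = h x"
      proof (cases "x \<in> ext N")
        case True
        then show ?thesis
          using Xrep[OF True] s[of "{..<r}" "\<lambda>i. x (d i)"] by (simp add: h_def)
      next
        case False
        then show ?thesis using h' by (simp add: h_def Homs_def)
      qed
    qed
  qed
qed


section \<open>Cones and fans\<close>

type_synonym 'a rcone = "(('a \<Rightarrow> int) \<Rightarrow> real) set"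

definition sc_rational_cone :: "'a::ab_group_add set \<Rightarrow> 'a rcone \<Rightarrow> bool" where
  "sc_rational_cone N \<sigma> \<longleftrightarrow>
     (\<exists>A. finite A \<and> A \<subseteq> N \<and> \<sigma> = {\<Sum>n\<in>A. tens N n (r n) | r. \<forall>n\<in>A. 0 \<le> r n}) \<and>
     (\<forall>x\<in>\<sigma>. - x \<in> \<sigma> \<longrightarrow> x = 0)"

definition linear_form :: "'a::ab_group_add set \<Rightarrow> ((('a \<Rightarrow> int) \<Rightarrow> real) \<Rightarrow> real) \<Rightarrow> bool" where
  "linear_form N u \<longleftrightarrow>
     (\<forall>x\<in>ext N. \<forall>y\<in>ext N. u (x + y) = u x + u y) \<and> (\<forall>k. \<forall>x\<in>ext N. u (scale k x) = k * u x)"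

definition face_of_cone :: "'a::ab_group_add set \<Rightarrow> 'a rcone \<Rightarrow> 'a rcone \<Rightarrow> bool" where
  "face_of_cone N \<tau> \<sigma> \<longleftrightarrow>
     (\<exists>u. linear_form N u \<and> (\<forall>x\<in>\<sigma>. 0 \<le> u x) \<and> \<tau> = {x\<in>\<sigma>. u x = 0})"

definition is_fan :: "'a::ab_group_add set \<Rightarrow> 'a rcone set \<Rightarrow> bool" where
  "is_fan N \<Sigma> \<longleftrightarrow>
     finite \<Sigma> \<and>
     (\<forall>\<sigma>\<in>\<Sigma>. sc_rational_cone N \<sigma>) \<and>
     (\<forall>\<sigma>\<in>\<Sigma>. \<forall>\<tau>. face_of_cone N \<tau> \<sigma> \<longrightarrow> \<tau> \<in> \<Sigma>) \<and>
     (\<forall>\<sigma>\<in>\<Sigma>. \<forall>\<tau>\<in>\<Sigma>. face_of_cone N (\<sigma> \<inter> \<tau>) \<sigma> \<and> face_of_cone N (\<sigma> \<inter> \<tau>) \<tau>)"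

definition dual_monoid :: "'a::ab_group_add set \<Rightarrow> 'a rcone \<Rightarrow> ('a \<Rightarrow> int) set" where
  "dual_monoid N \<sigma> = {m \<in> dual N. \<forall>x\<in>\<sigma>. 0 \<le> \<langle>m,x\<rangle>}"

definition cone_le :: "'a::ab_group_add set \<Rightarrow> 'a rcone \<Rightarrow> ('a \<Rightarrow> int) \<Rightarrow> ('a \<Rightarrow> int) \<Rightarrow> bool" where
  "cone_le N \<sigma> m' m \<longleftrightarrow> m - m' \<in> dual_monoid N \<sigma>"


section \<open>The category of decorated fans\<close>

record 'a dfan =
  lat :: "'a set"
  pt :: "('a \<Rightarrow> int) \<Rightarrow> complex"
  fan :: "'a rcone set"
  dec :: "'a rcone \<Rightarrow> ('a \<Rightarrow> int) set"

definition admissible :: "'a::ab_group_add set \<Rightarrow> (('a \<Rightarrow> int) \<Rightarrow> complex) \<Rightarrow> 'a rcone set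
    \<Rightarrow> ('a rcone \<Rightarrow> ('a \<Rightarrow> int) set) \<Rightarrow> bool" where
  "admissible N c \<Sigma> \<B> \<longleftrightarrow>
     (\<forall>\<sigma>\<in>\<Sigma>. finite (\<B> \<sigma>) \<and> \<B> \<sigma> \<noteq> {} \<and> \<B> \<sigma> \<subseteq> dual_monoid N \<sigma>) \<and>
     (\<forall>\<sigma>\<in>\<Sigma>. \<forall>m\<in>dual_monoid N \<sigma>. \<langle>m,c\<rangle> \<noteq> 0 \<longrightarrow> (\<exists>b\<in>\<B> \<sigma>. cone_le N \<sigma> b m)) \<and>
     (\<forall>\<sigma>\<in>\<Sigma>. \<forall>\<sigma>'\<in>\<Sigma>. \<forall>b\<in>\<B> \<sigma>. \<exists>b'\<in>\<B> \<sigma>'. cone_le N (\<sigma> \<inter> \<sigma>') b' b) \<and>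
     (\<forall>\<sigma>\<in>\<Sigma>. \<forall>a\<in>\<B> \<sigma>. \<forall>b\<in>\<B> \<sigma>. cone_le N \<sigma> a b \<longrightarrow> a = b)"

definition decorated_fan :: "'a::ab_group_add dfan \<Rightarrow> bool" where
  "decorated_fan X \<longleftrightarrow>
     is_lattice (lat X) \<and> pt X \<in> ext (lat X) \<and> is_fan (lat X) (fan X) \<and>
     admissible (lat X) (pt X) (fan X) (dec X)"

definition dfan_morphism ::
    "'a::ab_group_add dfan \<Rightarrow> 'b::ab_group_add dfan \<Rightarrow> ('a \<Rightarrow> 'b) \<times> complex \<Rightarrow> bool" where
  "dfan_morphism X Y = (\<lambda>(\<phi>, a).
     decorated_fan X \<and> decorated_fan Y \<and>
     \<phi> \<in> Homs (lat X) (lat Y) \<and>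
     ext_map (lat Y) \<phi> (pt X) = scale (a\<^sup>2) (pt Y) \<and>
     (\<forall>\<sigma>\<in>fan X. \<exists>\<sigma>'\<in>fan Y. ext_map (lat Y) \<phi> ` \<sigma> \<subseteq> \<sigma>') \<and>
     (a = 0 \<or>
      (\<forall>\<sigma>\<in>fan X. \<forall>\<sigma>'\<in>fan Y. ext_map (lat Y) \<phi> ` \<sigma> \<subseteq> \<sigma>' \<longrightarrow>
         (\<forall>b'\<in>dec Y \<sigma>'. \<exists>b\<in>dec X \<sigma>. cone_le (lat X) \<sigma> b (pullback \<phi> b')))))"

definition dfan_comp :: "('b \<Rightarrow> 'c) \<times> complex \<Rightarrow> ('a \<Rightarrow> 'b) \<times> complex \<Rightarrow> ('a \<Rightarrow> 'c) \<times> complex" where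
  "dfan_comp = (\<lambda>(\<phi>', a') (\<phi>, a). (\<phi>' \<circ> \<phi>, a * a'))"

text \<open>
  The type argument is the type carrying the lattices of the test objects.  It is meant to be
  arbitrary: statements using this predicate should leave it a type variable.
\<close>

definition is_fiber_product :: "'t::ab_group_add itself
    \<Rightarrow> 'a::ab_group_add dfan \<Rightarrow> 'b::ab_group_add dfan \<Rightarrow> 'q::ab_group_add dfan
    \<Rightarrow> ('a \<Rightarrow> 'q) \<times> complex \<Rightarrow> ('b \<Rightarrow> 'q) \<times> complex
    \<Rightarrow> 'p::ab_group_add dfan \<Rightarrow> ('p \<Rightarrow> 'a) \<times> complex \<Rightarrow> ('p \<Rightarrow> 'b) \<times> complex \<Rightarrow> bool" where
  "is_fiber_product TYPE('t) X' X'' Y f' f'' P p' p'' \<longleftrightarrow>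
     dfan_morphism X' Y f' \<and> dfan_morphism X'' Y f'' \<and>
     dfan_morphism P X' p' \<and> dfan_morphism P X'' p'' \<and>
     dfan_comp f' p' = dfan_comp f'' p'' \<and>
     (\<forall>(T :: 't dfan) g' g''.
        dfan_morphism T X' g' \<and> dfan_morphism T X'' g'' \<and> dfan_comp f' g' = dfan_comp f'' g'' \<longrightarrow>
        (\<exists>!h. dfan_morphism T P h \<and> dfan_comp p' h = g' \<and> dfan_comp p'' h = g''))"


section \<open>Ingredients of the fiber product\<close>

definition fp_lat :: "'a set \<Rightarrow> 'b set \<Rightarrow> ('a \<Rightarrow> 'q) \<Rightarrow> ('b \<Rightarrow> 'q) \<Rightarrow> ('a \<times> 'b) set" where
  "fp_lat N' N'' \<phi>' \<phi>'' = {(n', n''). n' \<in> N' \<and> n'' \<in> N'' \<and> \<phi>' n' = \<phi>'' n''}"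

definition proj1 :: "('a \<times> 'b) set \<Rightarrow> 'a \<times> 'b \<Rightarrow> 'a::zero" where
  "proj1 N = (\<lambda>n. if n \<in> N then fst n else 0)"

definition proj2 :: "('a \<times> 'b) set \<Rightarrow> 'a \<times> 'b \<Rightarrow> 'b::zero" where
  "proj2 N = (\<lambda>n. if n \<in> N then snd n else 0)"

text \<open>
  For \<open>N\<close> a fiber product of \<open>N'\<close> and \<open>N''\<close>, the module \<open>N \<otimes> K\<close> is regarded as a submodule of
  \<open>(N' \<otimes> K) \<times> (N'' \<otimes> K)\<close> through the two projections.
\<close>

definition fp_pt :: "'a::ab_group_add set \<Rightarrow> 'b::ab_group_add set \<Rightarrow> ('a \<times> 'b) set
    \<Rightarrow> (('a \<Rightarrow> int) \<Rightarrow> complex) \<Rightarrow> (('b \<Rightarrow> int) \<Rightarrow> complex) \<Rightarrow> complex \<Rightarrow> complex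
    \<Rightarrow> ('a \<times> 'b \<Rightarrow> int) \<Rightarrow> complex" where
  "fp_pt N' N'' N c' c'' a' a'' =
     (THE c. c \<in> ext N \<and> ext_map N' (proj1 N) c = scale (a''\<^sup>2) c' \<and>
             ext_map N'' (proj2 N) c = scale (a'\<^sup>2) c'')"

definition fp_cone :: "'a::ab_group_add set \<Rightarrow> 'b::ab_group_add set \<Rightarrow> ('a \<times> 'b) set
    \<Rightarrow> 'a rcone \<Rightarrow> 'b rcone \<Rightarrow> ('a \<times> 'b) rcone" where
  "fp_cone N' N'' N \<sigma>' \<sigma>'' =
     {x \<in> ext N. ext_map N' (proj1 N) x \<in> \<sigma>' \<and> ext_map N'' (proj2 N) x \<in> \<sigma>''}"

definition fp_pairs :: "'q::ab_group_add set \<Rightarrow> 'a rcone set \<Rightarrow> 'b rcone set \<Rightarrow> 'q rcone set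
    \<Rightarrow> ('a \<Rightarrow> 'q) \<Rightarrow> ('b \<Rightarrow> 'q) \<Rightarrow> ('a rcone \<times> 'b rcone) set" where
  "fp_pairs Q \<Sigma>' \<Sigma>'' \<Lambda> \<phi>' \<phi>'' =
     {(\<sigma>', \<sigma>''). \<sigma>' \<in> \<Sigma>' \<and> \<sigma>'' \<in> \<Sigma>'' \<and>
        (\<exists>\<kappa>\<in>\<Lambda>. ext_map Q \<phi>' ` \<sigma>' \<subseteq> \<kappa> \<and> ext_map Q \<phi>'' ` \<sigma>'' \<subseteq> \<kappa>)}"

text \<open>The surjection \<open>\<pi>\<close> from \<open>M' \<times> M''\<close> to \<open>M\<close>.\<close>

definition fp_pi :: "('a \<times> 'b) set \<Rightarrow> ('a \<Rightarrow> int) \<Rightarrow> ('b \<Rightarrow> int) \<Rightarrow> 'a \<times> 'b \<Rightarrow> int" where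
  "fp_pi N m' m'' = (\<lambda>(n', n''). if (n', n'') \<in> N then m' n' + m'' n'' else 0)"

definition monoid_algebra :: "'m::comm_monoid_add set \<Rightarrow> ('m \<Rightarrow>\<^sub>0 complex) ring" where
  "monoid_algebra S =
     \<lparr>carrier = {p. Poly_Mapping.keys p \<subseteq> S}, monoid.mult = (*), one = 1, zero = 0, add = (+)\<rparr>"

lemma monoid_algebra_cring:
  assumes "0 \<in> S" and add: "\<And>x y. x \<in> S \<Longrightarrow> y \<in> S \<Longrightarrow> x + y \<in> S"
  shows "cring (monoid_algebra S)"
proof (rule cringI)
  show "abelian_group (monoid_algebra S)"
  proof (rule abelian_groupI)
    fix p assume p: "p \<in> carrier (monoid_algebra S)"
    show "\<exists>q\<in>carrier (monoid_algebra S). q \<oplus>\<^bsub>monoid_algebra S\<^esub> p = \<zero>\<^bsub>monoid_algebra S\<^esub>"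
      by (rule bexI[of _ "- p"]) (use p in \<open>simp_all add: monoid_algebra_def\<close>)
  next
    fix p q assume "p \<in> carrier (monoid_algebra S)" "q \<in> carrier (monoid_algebra S)"
    then show "p \<oplus>\<^bsub>monoid_algebra S\<^esub> q \<in> carrier (monoid_algebra S)"
      using Poly_Mapping.keys_add[of p q] by (auto simp: monoid_algebra_def)
  qed (simp_all add: monoid_algebra_def ac_simps)
next
  show "Group.comm_monoid (monoid_algebra S)"
  proof (rule comm_monoidI)
    fix p q assume "p \<in> carrier (monoid_algebra S)" "q \<in> carrier (monoid_algebra S)"
    then show "p \<otimes>\<^bsub>monoid_algebra S\<^esub> q \<in> carrier (monoid_algebra S)"
      using Poly_Mapping.keys_mult[of p q] add by (fastforce simp: monoid_algebra_def)
  qed (simp_all add: monoid_algebra_def ac_simps assms(1))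
qed (simp add: monoid_algebra_def distrib_right)

definition monom :: "'m::zero \<Rightarrow> 'm \<Rightarrow>\<^sub>0 complex" where
  "monom m = Poly_Mapping.single m 1"

definition monomial_ideal :: "'m::comm_monoid_add set \<Rightarrow> 'm set \<Rightarrow> ('m \<Rightarrow>\<^sub>0 complex) set" where
  "monomial_ideal S B = Idl\<^bsub>monoid_algebra S\<^esub> (monom ` B)"

definition is_minimal_monomial_generators ::
    "'m::comm_monoid_add set \<Rightarrow> ('m \<Rightarrow>\<^sub>0 complex) set \<Rightarrow> 'm set \<Rightarrow> bool" where
  "is_minimal_monomial_generators S J B \<longleftrightarrow>
     B \<subseteq> S \<and> monomial_ideal S B = J \<and> (\<forall>B'. B' \<subset> B \<longrightarrow> monomial_ideal S B' \<noteq> J)"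

text \<open>
  The ideal \<open>J\<^sup>\<sigma>\<close> for \<open>S = S\<^sub>\<sigma>\<close>, \<open>B' = \<B>'\<^sub>\<sigma>\<^sub>'\<close> and \<open>B'' = \<B>''\<^sub>\<sigma>\<^sub>'\<^sub>'\<close>; it is only used when \<open>a'\<close> and
  \<open>a''\<close> are not both \<open>0\<close>.
\<close>

definition fp_ideal :: "('a \<times> 'b) set \<Rightarrow> (('a \<times> 'b \<Rightarrow> int) \<Rightarrow> complex) \<Rightarrow> complex \<Rightarrow> complex
    \<Rightarrow> ('a \<times> 'b \<Rightarrow> int) set \<Rightarrow> ('a \<Rightarrow> int) set \<Rightarrow> ('b \<Rightarrow> int) set
    \<Rightarrow> (('a \<times> 'b \<Rightarrow> int) \<Rightarrow>\<^sub>0 complex) set" where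
  "fp_ideal N c a' a'' S B' B'' =
     monomial_ideal S {m \<in> S. \<langle>m,c\<rangle> \<noteq> 0} <+>\<^bsub>monoid_algebra S\<^esub>
     monomial_ideal S
       (if a' \<noteq> 0 \<and> a'' \<noteq> 0 then {fp_pi N b' 0 | b'. b' \<in> B'} \<union> {fp_pi N 0 b'' | b''. b'' \<in> B''}
        else if a' = 0 then {fp_pi N b' 0 | b'. b' \<in> B'}
        else {fp_pi N 0 b'' | b''. b'' \<in> B''})"

text \<open>
  \<open>fp_object X' X'' Y (\<phi>', a') (\<phi>'', a'') \<B>\<close> is \<open>(N, c, \<Sigma>, \<B>)\<close> with the fiber product lattice,
  point and fan.  The family \<open>\<B>\<close> is a parameter, because minimal monomial generating sets are only
  unique up to invertible monomials; \<open>fp_decoration\<close> describes the permitted choices.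

  Different pairs \<open>(\<sigma>', \<sigma>'')\<close> may define the same cone of \<open>\<Sigma>\<close>.  As \<open>\<B>\<close> is indexed by cones,
  \<open>fp_decoration\<close> requires \<open>\<B> \<sigma>\<close> to generate the ideals of all pairs defining \<open>\<sigma>\<close>.
\<close>

definition fp_object :: "'a::ab_group_add dfan \<Rightarrow> 'b::ab_group_add dfan \<Rightarrow> 'q::ab_group_add dfan
    \<Rightarrow> ('a \<Rightarrow> 'q) \<times> complex \<Rightarrow> ('b \<Rightarrow> 'q) \<times> complex
    \<Rightarrow> (('a \<times> 'b) rcone \<Rightarrow> ('a \<times> 'b \<Rightarrow> int) set) \<Rightarrow> ('a \<times> 'b) dfan" where
  "fp_object X' X'' Y = (\<lambda>(\<phi>', a') (\<phi>'', a'') \<B>.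
     let N = fp_lat (lat X') (lat X'') \<phi>' \<phi>'' in
     \<lparr>lat = N,
      pt = fp_pt (lat X') (lat X'') N (pt X') (pt X'') a' a'',
      fan = (\<lambda>(\<sigma>', \<sigma>''). fp_cone (lat X') (lat X'') N \<sigma>' \<sigma>'') `
              fp_pairs (lat Y) (fan X') (fan X'') (fan Y) \<phi>' \<phi>'',
      dec = \<B>\<rparr>)"

definition fp_decoration :: "'a::ab_group_add dfan \<Rightarrow> 'b::ab_group_add dfan \<Rightarrow> 'q::ab_group_add dfan
    \<Rightarrow> ('a \<Rightarrow> 'q) \<times> complex \<Rightarrow> ('b \<Rightarrow> 'q) \<times> complex
    \<Rightarrow> (('a \<times> 'b) rcone \<Rightarrow> ('a \<times> 'b \<Rightarrow> int) set) \<Rightarrow> bool" where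
  "fp_decoration X' X'' Y = (\<lambda>(\<phi>', a') (\<phi>'', a'') \<B>.
     let N = fp_lat (lat X') (lat X'') \<phi>' \<phi>'';
         c = fp_pt (lat X') (lat X'') N (pt X') (pt X'') a' a'' in
     \<forall>(\<sigma>', \<sigma>'') \<in> fp_pairs (lat Y) (fan X') (fan X'') (fan Y) \<phi>' \<phi>''.
       let \<sigma> = fp_cone (lat X') (lat X'') N \<sigma>' \<sigma>'';
           S = dual_monoid N \<sigma> in
       is_minimal_monomial_generators S
         (fp_ideal N c a' a'' S (dec X' \<sigma>') (dec X'' \<sigma>'')) (\<B> \<sigma>))"

end

theory Submission
  imports Defs
begin

text \<open>
  Over \<open>\<real>\<close> and \<open>\<complex>\<close> only \<open>M' \<times> M'' \<rightarrow> M\<close> up to finite index matters, so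
  \<open>N \<otimes> K\<close> is the fiber product of \<open>N' \<otimes> K\<close> and \<open>N'' \<otimes> K\<close>; this gives the point \<open>c\<close>.
  By the theorem of Minkowski and Weyl a rational cone is given by finitely many integral
  inequalities, and the inequalities of the cone of \<open>(\<sigma>', \<sigma>'')\<close> are those of \<open>\<sigma>'\<close> and \<open>\<sigma>''\<close>.
  By Farkas' lemma a face is obtained by turning some of them into equalities, so the faces of the
  cone of \<open>(\<sigma>', \<sigma>'')\<close> are the cones of pairs of faces.

  Membership of \<open>x\<^sup>m\<close> in \<open>J\<^sup>\<sigma>\<close> means that \<open>m\<close> dominates a generator: a form pulled back
  from \<open>\<B>'\<close> or \<open>\<B>''\<close>, or one with \<open>\<langle>m,c\<rangle> \<noteq> 0\<close>.  Admissibility and all conditions on morphisms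
  then follow from those for \<open>\<B>'\<close> and \<open>\<B>''\<close> for the former and from (i) for the latter.  Only
  condition (ii) for \<open>\<langle>m,c\<rangle> \<noteq> 0\<close> needs an argument: on the common face \<open>m\<close> may be replaced by
  \<open>m + k m\<^sub>0\<close> for a form \<open>m\<^sub>0\<close> cutting out that face, where \<open>k\<close> is large and avoids the at most
  one value with \<open>\<langle>m + k m\<^sub>0,c\<rangle> = 0\<close>.
\<close>

section \<open>Lattices\<close>

text \<open>The projection to \<open>X'\<close> carries the scalar \<open>a''\<close>, and a
  morphism constrains decorations only if its scalar is nonzero. So the forms pulled back from
  \<open>\<B>'\<close> are put into \<open>J\<^sup>\<sigma>\<close> exactly when
  \<open>a'' \<noteq> 0\<close>, and those from \<open>\<B>''\<close> exactly when
  \<open>a' \<noteq> 0\<close>; this crosswise rule is the case distinction in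
  \<open>J\<^sup>\<sigma>\<close>. That \<open>a'\<close> and \<open>a''\<close> are not both 0
  keeps the decoration nonempty and lets the scalar \<open>b\<close> of the mediating morphism be
  recovered from \<open>b a''\<close> and \<open>b a'\<close>. A cone may come from several pairs,
  while \<open>\<B>\<close> is indexed by cones: condition (ii) of both factors shows that all these
  pairs give the same ideal, so that a decoration exists. Finiteness is not part of being a minimal
  generating set; it comes from Dickson's lemma, since divisibility in a dual monoid compares values
  at the finitely many generators of the cone.\<close>

definition subgrp :: "'a::ab_group_add set \<Rightarrow> bool" where
  "subgrp H \<longleftrightarrow> 0 \<in> H \<and> (\<forall>x\<in>H. \<forall>y\<in>H. x - y \<in> H)"

lemma subgrp_zero: "subgrp H \<Longrightarrow> 0 \<in> H"
  and subgrp_diff: "subgrp H \<Longrightarrow> x \<in> H \<Longrightarrow> y \<in> H \<Longrightarrow> x - y \<in> H"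
  by (auto simp: subgrp_def)

lemma subgrp_uminus: "subgrp H \<Longrightarrow> x \<in> H \<Longrightarrow> - x \<in> H"
  using subgrp_diff[of H 0 x] by (simp add: subgrp_zero)

lemma subgrp_add: "subgrp H \<Longrightarrow> x \<in> H \<Longrightarrow> y \<in> H \<Longrightarrow> x + y \<in> H"
  using subgrp_diff[of H x "- y"] by (simp add: subgrp_uminus)

lemma Homs_add: "f \<in> Homs A B \<Longrightarrow> x \<in> A \<Longrightarrow> y \<in> A \<Longrightarrow> f (x + y) = f x + f y"
  by (simp add: Homs_def)

lemma Homs_in: "f \<in> Homs A B \<Longrightarrow> x \<in> A \<Longrightarrow> f x \<in> B"
  by (auto simp: Homs_def)

lemma Homs_outside: "f \<in> Homs A B \<Longrightarrow> x \<notin> A \<Longrightarrow> f x = 0"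
  by (simp add: Homs_def)

lemma Homs_zero:
  assumes "f \<in> Homs A B"
  shows "f 0 = 0"
proof (cases "0 \<in> A")
  case True
  then show ?thesis using Homs_add[OF assms, of 0 0] by simp
qed (simp add: Homs_outside[OF assms])

lemma Homs_diff:
  assumes "f \<in> Homs A B" "subgrp A" "x \<in> A" "y \<in> A"
  shows "f (x - y) = f x - f y"
  using Homs_add[OF assms(1), of "x - y" y] assms by (simp add: subgrp_diff)

lemma Homs_uminus:
  assumes "f \<in> Homs A B" "subgrp A" "x \<in> A"
  shows "f (- x) = - f x"
  using Homs_diff[OF assms(1,2) _ assms(3), of 0] assms by (simp add: subgrp_zero Homs_zero)

lemma Homs_comp:
  assumes "f \<in> Homs A B" "g \<in> Homs B C"
  shows "g \<circ> f \<in> Homs A C"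
  using assms Homs_zero[OF assms(2)] by (auto simp: Homs_def image_subset_iff)

lemma subgrp_Zpow: "subgrp (Zpow n)"
  by (auto simp: subgrp_def Zpow_def)

lemma subgrp_Homs:
  assumes "subgrp B"
  shows "subgrp (Homs A B)"
  using assms by (auto simp: subgrp_def Homs_def algebra_simps image_subset_iff subgrp_add subgrp_diff)

lemma subgrp_UNIV: "subgrp UNIV"
  by (simp add: subgrp_def)

lemma subgrp_dual: "subgrp (dual N)" and subgrp_ext: "subgrp (ext N)"
  unfolding dual_def ext_def by (intro subgrp_Homs subgrp_UNIV)+

lemma is_lattice_subgrp:
  assumes "is_lattice N"
  shows "subgrp N"
proof -
  obtain n f where f: "f \<in> Homs (Zpow n) N" "bij_betw f (Zpow n) N"
    using assms by (auto simp: is_lattice_def)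
  have N: "N = f ` Zpow n" using f(2) by (simp add: bij_betw_def)
  show ?thesis
    unfolding subgrp_def N
  proof (intro conjI ballI)
    show "0 \<in> f ` Zpow n"
      using Homs_zero[OF f(1)] subgrp_zero[OF subgrp_Zpow, of n] by (metis imageI)
  next
    fix x y assume "x \<in> f ` Zpow n" "y \<in> f ` Zpow n"
    then obtain u v where "u \<in> Zpow n" "v \<in> Zpow n" "x = f u" "y = f v" by auto
    then have "x - y = f (u - v)" "u - v \<in> Zpow n"
      using Homs_diff[OF f(1) subgrp_Zpow] subgrp_diff[OF subgrp_Zpow] by auto
    then show "x - y \<in> f ` Zpow n" by blast
  qed
qed

text \<open>Stated for groups of integer-valued functions, which covers \<open>Zpow n\<close> as
  well as \<open>dual N\<close>.\<close>

lemma subgrp_int_mult: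
  fixes H :: "('i \<Rightarrow> int) set"
  assumes "subgrp H" "x \<in> H"
  shows "(\<lambda>i. k * x i) \<in> H"
proof (induction k rule: int_induct[of _ 0])
  case base
  then show ?case using subgrp_zero[OF assms(1)] by (simp add: zero_fun_def)
next
  case (step1 k)
  have "(\<lambda>i. (k + 1) * x i) = (\<lambda>i. k * x i) + x" by (auto simp: algebra_simps)
  then show ?case using subgrp_add[OF assms(1) step1(2) assms(2)] by simp
next
  case (step2 k)
  have "(\<lambda>i. (k - 1) * x i) = (\<lambda>i. k * x i) - x" by (auto simp: algebra_simps)
  then show ?case using subgrp_diff[OF assms(1) step2(2) assms(2)] by simp
qed

lemma additive_int_mult:
  fixes H :: "('i \<Rightarrow> int) set" and h :: "('i \<Rightarrow> int) \<Rightarrow> 'k::comm_ring_1"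
  assumes H: "subgrp H" and x: "x \<in> H"
    and h: "\<And>x y. x \<in> H \<Longrightarrow> y \<in> H \<Longrightarrow> h (x + y) = h x + h y"
  shows "h (\<lambda>i. k * x i) = of_int k * h x"
proof (induction k rule: int_induct[of _ 0])
  case base
  have "h 0 = 0" using h[of 0 0] subgrp_zero[OF H] by simp
  then show ?case by (simp add: zero_fun_def)
next
  case (step1 k)
  have "(\<lambda>i. (k + 1) * x i) = (\<lambda>i. k * x i) + x" by (auto simp: algebra_simps)
  then show ?case using h[OF subgrp_int_mult[OF H x, of k] x] step1(2) by (simp add: algebra_simps)
next
  case (step2 k)
  have "(\<lambda>i. k * x i) = (\<lambda>i. (k - 1) * x i) + x" by (auto simp: algebra_simps)
  then show ?case using h[OF subgrp_int_mult[OF H x, of "k - 1"] x] step2(2) by (simp add: algebra_simps)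
qed

lemma Zpow_Suc_zero: "x \<in> Zpow (Suc n) \<Longrightarrow> x n = 0 \<Longrightarrow> x \<in> Zpow n"
proof -
  assume x: "x \<in> Zpow (Suc n)" "x n = 0"
  have "x i = 0" if "n \<le> i" for i
    using that x by (cases "i = n") (simp_all add: Zpow_def)
  then show "x \<in> Zpow n" by (simp add: Zpow_def)
qed

text \<open>The last coordinates of \<open>H\<close> form a subgroup of the integers, hence consist
  of the multiples of the least positive one; \<open>e\<close> is a vector of \<open>H\<close>
  attaining it. Both inductions on \<open>n\<close> below split along these cases.\<close>

lemma Zpow_Suc_subgrp_cases:
  assumes H: "subgrp H" "H \<subseteq> Zpow (Suc n)"
  obtains "H \<subseteq> Zpow n"
  | e where "e \<in> H" "e n > 0" "\<And>x. x \<in> H \<Longrightarrow> e n dvd x n"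
proof (cases "\<forall>x\<in>H. x n = 0")
  case True
  have "H \<subseteq> Zpow n"
  proof
    fix x assume "x \<in> H"
    then show "x \<in> Zpow n" using True H(2) Zpow_Suc_zero by blast
  qed
  then show thesis by (rule that(1))
next
  case False
  then obtain x where x: "x \<in> H" "x n \<noteq> 0" by auto
  define P where "P = (\<lambda>k. k > 0 \<and> (\<exists>e\<in>H. e n = int k))"
  have "\<exists>k. P k"
  proof (cases "x n > 0")
    case True
    then show ?thesis unfolding P_def using x by (intro exI[of _ "nat (x n)"]) auto
  next
    case False
    then show ?thesis unfolding P_def using x subgrp_uminus[OF H(1) x(1)]
      by (intro exI[of _ "nat (- x n)"]) (auto intro!: bexI[of _ "- x"])
  qed
  then have PL: "P (LEAST k. P k)" by (rule LeastI_ex)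
  then obtain e where e: "e \<in> H" "e n = int (LEAST k. P k)" "e n > 0" by (auto simp: P_def)
  have "e n dvd y n" if y: "y \<in> H" for y
  proof (rule ccontr)
    assume nd: "\<not> e n dvd y n"
    \<comment> \<open>Division with remainder: the last coordinate of \<open>z\<close> is
      \<open>y n mod e n\<close>, which would be a smaller positive value.\<close>
    define z where "z = y - (\<lambda>i. (y n div e n) * e i)"
    have z: "z \<in> H" unfolding z_def by (intro subgrp_diff subgrp_int_mult H e y)
    have zn: "z n = y n mod e n" by (simp add: z_def minus_div_mult_eq_mod)
    then have "z n \<noteq> 0" "z n \<ge> 0" "z n < e n" using nd e(3) by (auto simp: dvd_eq_mod_eq_0)
    then have "P (nat (z n))" unfolding P_def using z by auto
    then have "(LEAST k. P k) \<le> nat (z n)" by (rule Least_le)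
    then show False using \<open>z n < e n\<close> e \<open>z n \<ge> 0\<close> by linarith
  qed
  then show thesis using that(2) e by blast
qed

text \<open>Unless it is trivial, the last coordinate maps \<open>H\<close> onto an infinite cyclic
  group, so \<open>H\<close> is the direct sum of its kernel \<open>H0\<close>, free by induction,
  and the multiples of \<open>e\<close>.\<close>

lemma is_lattice_subgrp_Zpow:
  assumes "subgrp H" "H \<subseteq> Zpow n"
  shows "is_lattice H"
  using assms
proof (induction n arbitrary: H)
  case 0
  have Z: "Zpow 0 = {0}" by (auto simp: Zpow_def)
  then have "H = {0}" using 0 subgrp_zero by blast
  moreover have "(\<lambda>_. 0) \<in> Homs (Zpow 0) {0 :: nat \<Rightarrow> int}" "bij_betw (\<lambda>_. 0) (Zpow 0) {0 :: nat \<Rightarrow> int}"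
    by (auto simp: Homs_def Z bij_betw_def)
  ultimately show ?case unfolding is_lattice_def by metis
next
  case (Suc n)
  from Suc.prems show ?case
  proof (cases rule: Zpow_Suc_subgrp_cases)
    case 1
    then show ?thesis using Suc.IH Suc.prems by blast
  next
    case (2 e)
    define H0 where "H0 = H \<inter> {x. x n = 0}"
    have sub0: "subgrp H0" using Suc.prems(1) by (auto simp: H0_def subgrp_def)
    have "H0 \<subseteq> Zpow n"
      using Suc.prems(2) Zpow_Suc_zero unfolding H0_def by blast
    from Suc.IH[OF sub0 this] obtain r f where f: "f \<in> Homs (Zpow r) H0" "bij_betw f (Zpow r) H0"
      by (auto simp: is_lattice_def)
    have fadd: "f (x + y) = f x + f y" if "x \<in> Zpow r" "y \<in> Zpow r" for x y
      using Homs_add[OF f(1)] that .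
    have cut: "x(r := 0) \<in> Zpow r" if "x \<in> Zpow (Suc r)" for x
      using that by (auto simp: Zpow_def)
    \<comment> \<open>Coordinate \<open>r\<close> of the argument is the coefficient of
      \<open>e\<close>; the coordinates below \<open>r\<close> describe the part in
      \<open>H0\<close>.\<close>
    define F where "F = (\<lambda>z. if z \<in> Zpow (Suc r) then f (z(r := 0)) + (\<lambda>i. z r * e i) else 0)"
    have fH: "f x \<in> H" "f x n = 0" if "x \<in> Zpow r" for x
      using Homs_in[OF f(1) that] by (auto simp: H0_def)
    have F: "F \<in> Homs (Zpow (Suc r)) H"
      unfolding Homs_def
    proof (intro CollectI conjI ballI allI impI)
      show "F ` Zpow (Suc r) \<subseteq> H"
        by (auto simp: F_def intro!: subgrp_add subgrp_int_mult Suc.prems 2 fH cut)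
    next
      fix x y assume xy: "x \<in> Zpow (Suc r)" "y \<in> Zpow (Suc r)"
      have "(x + y)(r := 0) = x(r := 0) + y(r := 0)" by auto
      then have 1: "f ((x + y)(r := 0)) = f (x(r := 0)) + f (y(r := 0))"
        by (simp only: fadd[OF cut[OF xy(1)] cut[OF xy(2)]])
      have 2: "(\<lambda>i. (x + y) r * e i) = (\<lambda>i. x r * e i) + (\<lambda>i. y r * e i)"
        by (auto simp: distrib_right)
      show "F (x + y) = F x + F y"
        unfolding F_def if_P[OF xy(1)] if_P[OF xy(2)] if_P[OF subgrp_add[OF subgrp_Zpow xy]] 1 2
        by (simp only: ac_simps)
    qed (simp add: F_def)
    have "inj_on F (Zpow (Suc r))"
    proof (rule inj_onI)
      fix x y assume xy: "x \<in> Zpow (Suc r)" "y \<in> Zpow (Suc r)" and eq: "F x = F y"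
      have "F x n = x r * e n" "F y n = y r * e n" using xy fH cut by (simp_all add: F_def)
      then have r: "x r = y r" using eq 2(2) by simp
      then have "f (x(r := 0)) = f (y(r := 0))" using eq xy by (simp add: F_def)
      then have "x(r := 0) = y(r := 0)"
        using f(2) cut[OF xy(1)] cut[OF xy(2)] by (auto simp: bij_betw_def inj_on_def)
      then show "x = y" using r by (metis fun_upd_triv fun_upd_upd)
    qed
    moreover have "H \<subseteq> F ` Zpow (Suc r)"
    proof
      fix x assume x: "x \<in> H"
      then obtain k where k: "x n = e n * k" using 2(3) by (auto simp: dvd_def)
      have "x - (\<lambda>i. k * e i) \<in> H0"
        unfolding H0_def using k by (auto intro!: subgrp_diff subgrp_int_mult Suc.prems x 2)
      then obtain z where z: "z \<in> Zpow r" "f z = x - (\<lambda>i. k * e i)"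
        using f(2) by (auto simp: bij_betw_def image_iff)
      define z' where "z' = z(r := k)"
      have "z' \<in> Zpow (Suc r)" "z'(r := 0) = z" "z' r = k"
        using z(1) by (auto simp: z'_def Zpow_def)
      then have "F z' = (x - (\<lambda>i. k * e i)) + (\<lambda>i. k * e i)"
        unfolding F_def by (simp only: if_True z)
      then have "F z' = x" by (simp only: diff_add_cancel)
      then show "x \<in> F ` Zpow (Suc r)" using \<open>z' \<in> Zpow (Suc r)\<close> by blast
    qed
    ultimately have "bij_betw F (Zpow (Suc r)) H"
      using F by (auto simp: bij_betw_def Homs_def)
    then show ?thesis using F unfolding is_lattice_def by blast
  qed
qed

text \<open>
  Rationally, homomorphisms extend from subgroups: the injectivity of \<open>\<rat>\<close> with
  denominators cleared.
\<close>

lemma Zpow_extend_multiple: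
  fixes h :: "(nat \<Rightarrow> int) \<Rightarrow> int"
  assumes "subgrp H" "H \<subseteq> Zpow n"
    and "\<And>x y. x \<in> H \<Longrightarrow> y \<in> H \<Longrightarrow> h (x + y) = h x + h y"
  shows "\<exists>k c. k \<noteq> 0 \<and> (\<forall>x\<in>H. (\<Sum>i<n. c i * x i) = k * h x)"
  using assms
proof (induction n arbitrary: H)
  case 0
  then have "H \<subseteq> {0}" by (auto simp: Zpow_def zero_fun_def)
  moreover have "h 0 = 0"
  proof -
    have "h 0 = h 0 + h 0"
      using 0(3)[OF subgrp_zero[OF 0(1)] subgrp_zero[OF 0(1)]] by (simp only: add_0_left)
    then show ?thesis by (rule add_cancel_right_right[THEN iffD1])
  qed
  ultimately have "\<forall>x\<in>H. (\<Sum>i<0. 0 * x i) = 1 * h x" by (auto simp del: zero_fun_apply)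
  then show ?case by (intro exI[of _ 1] exI[of _ "\<lambda>_. 0"]) simp
next
  case (Suc n)
  from Suc.prems(1,2) show ?case
  proof (cases rule: Zpow_Suc_subgrp_cases)
    case 1
    then obtain k c where kc: "k \<noteq> 0" "\<forall>x\<in>H. (\<Sum>i<n. c i * x i) = k * h x"
      using Suc.IH Suc.prems by blast
    have "(\<Sum>i<Suc n. c i * x i) = k * h x" if "x \<in> H" for x
    proof -
      have "x n = 0" using 1 that by (auto simp: Zpow_def)
      then show ?thesis using kc that by simp
    qed
    then show ?thesis using kc by blast
  next
    case (2 e)
    define H0 where "H0 = H \<inter> {x. x n = 0}"
    have sub0: "subgrp H0" using Suc.prems(1) by (auto simp: H0_def subgrp_def)
    have "H0 \<subseteq> Zpow n"
      using Suc.prems(2) Zpow_Suc_zero unfolding H0_def by blast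
    from Suc.IH[OF sub0 this] obtain k c where kc: "k \<noteq> 0" "\<forall>x\<in>H0. (\<Sum>i<n. c i * x i) = k * h x"
      using Suc.prems(3) unfolding H0_def by blast
    define q where "q = (\<lambda>x. \<Sum>i<n. c i * x i)"
    \<comment> \<open>For \<open>x\<close> in \<open>H\<close> the vector
      \<open>e n * x - x n * e\<close> lies in \<open>H0\<close>. Inserting it into the formula for
      \<open>H0\<close> and solving for \<open>h x\<close> gives these coefficients, with
      \<open>k * e n\<close> as the new factor.\<close>
    define c' where "c' = (\<lambda>i. if i < n then e n * c i else k * h e - q e)"
    have add_mult: "h (\<lambda>i. t * y i) = t * h y" if "y \<in> H" for y t
      using additive_int_mult[of H y h t, OF Suc.prems(1) that] Suc.prems(3) by auto
    have "(\<Sum>i<Suc n. c' i * x i) = (k * e n) * h x" if x: "x \<in> H" for x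
    proof -
      define y where "y = (\<lambda>i. e n * x i) - (\<lambda>i. x n * e i)"
      have m: "(\<lambda>i. e n * x i) \<in> H" "(\<lambda>i. x n * e i) \<in> H"
        by (intro subgrp_int_mult Suc.prems x 2)+
      have y: "y \<in> H0" unfolding H0_def y_def using subgrp_diff[OF Suc.prems(1) m] by auto
      have "y \<in> H" using y by (simp add: H0_def)
      have "h ((\<lambda>i. e n * x i)) = h (y + (\<lambda>i. x n * e i))" by (simp add: y_def)
      also have "\<dots> = h y + h (\<lambda>i. x n * e i)" by (rule Suc.prems(3)[OF \<open>y \<in> H\<close> m(2)])
      finally have hy: "h y = e n * h x - x n * h e"
        using add_mult[OF x, of "e n"] add_mult[OF 2(1), of "x n"] by simp
      have "q y = e n * q x - x n * q e"
        unfolding q_def y_def sum_distrib_left sum_subtractf[symmetric]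
        by (intro sum.cong) (auto simp: algebra_simps)
      then have "e n * q x - x n * q e = k * (e n * h x - x n * h e)"
        using bspec[OF kc(2) y] hy by (simp add: q_def)
      moreover have "(\<Sum>i<Suc n. c' i * x i) = e n * q x + (k * h e - q e) * x n"
        by (simp add: c'_def q_def sum_distrib_left mult.assoc)
      ultimately show ?thesis by (simp add: algebra_simps)
    qed
    moreover have "k * e n \<noteq> 0" using kc 2 by simp
    ultimately show ?thesis by blast
  qed
qed

lemma is_lattice_iso:
  assumes "is_lattice L"
  obtains r f g where "f \<in> Homs (Zpow r) L" "bij_betw f (Zpow r) L" "g \<in> Homs L (Zpow r)"
    "\<And>z. z \<in> Zpow r \<Longrightarrow> g (f z) = z" "\<And>y. y \<in> L \<Longrightarrow> f (g y) = y"
proof -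
  obtain r f where f: "f \<in> Homs (Zpow r) L" "bij_betw f (Zpow r) L"
    using assms by (auto simp: is_lattice_def)
  define g where "g = (\<lambda>y. if y \<in> L then inv_into (Zpow r) f y else 0)"
  have gf: "g (f z) = z" if "z \<in> Zpow r" for z
    using f that Homs_in[OF f(1) that] by (simp add: g_def bij_betw_def)
  have fg: "f (g y) = y" and gZ: "g y \<in> Zpow r" if "y \<in> L" for y
    using f that by (auto simp: g_def bij_betw_def f_inv_into_f inv_into_into)
  have "g (x + y) = g x + g y" if "x \<in> L" "y \<in> L" for x y
    using gf[OF subgrp_add[OF subgrp_Zpow gZ[OF that(1)] gZ[OF that(2)]]]
      Homs_add[OF f(1) gZ[OF that(1)] gZ[OF that(2)]] fg that by simp
  then have "g \<in> Homs L (Zpow r)" using gZ by (auto simp: Homs_def g_def)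
  then show thesis using that f gf fg by blast
qed

lemma subgrp_vimage:
  assumes "f \<in> Homs A B" "subgrp A" "subgrp H"
  shows "subgrp {z \<in> A. f z \<in> H}"
  unfolding subgrp_def
  using Homs_zero[OF assms(1)] Homs_diff[OF assms(1,2)] assms(2,3)
  by (auto simp: subgrp_zero subgrp_diff)

lemma is_lattice_sub:
  assumes "is_lattice L" "subgrp H" "H \<subseteq> L"
  shows "is_lattice H"
proof -
  obtain r f g where f: "f \<in> Homs (Zpow r) L" "bij_betw f (Zpow r) L" and g: "g \<in> Homs L (Zpow r)"
    and fg: "\<And>z. z \<in> Zpow r \<Longrightarrow> g (f z) = z" "\<And>y. y \<in> L \<Longrightarrow> f (g y) = y"
    using is_lattice_iso[OF assms(1)] by metis
  define H1 where "H1 = {z \<in> Zpow r. f z \<in> H}"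
  have "is_lattice H1" unfolding H1_def
    by (rule is_lattice_subgrp_Zpow[OF subgrp_vimage[OF f(1) subgrp_Zpow assms(2)]]) auto
  then obtain s k where k: "k \<in> Homs (Zpow s) H1" "bij_betw k (Zpow s) H1"
    by (auto simp: is_lattice_def)
  have "f \<circ> k \<in> Homs (Zpow s) H"
    using k(1) Homs_add[OF f(1)] Homs_zero[OF f(1)]
    by (auto simp: Homs_def H1_def image_subset_iff)
  moreover have "bij_betw f H1 H"
    unfolding bij_betw_def
  proof
    show "inj_on f H1" using f(2) by (auto simp: bij_betw_def H1_def inj_on_def)
    show "f ` H1 = H"
    proof
      show "H \<subseteq> f ` H1"
      proof
        fix y assume "y \<in> H"
        then have "g y \<in> H1" "f (g y) = y" using assms(3) fg(2) Homs_in[OF g] by (auto simp: H1_def)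
        then show "y \<in> f ` H1" by (metis imageI)
      qed
    qed (auto simp: H1_def)
  qed
  then have "bij_betw (f \<circ> k) (Zpow s) H" using bij_betw_trans[OF k(2)] by blast
  ultimately show ?thesis unfolding is_lattice_def by blast
qed

lemma is_lattice_Times:
  assumes "is_lattice A" "is_lattice B"
  shows "is_lattice (A \<times> B)"
proof -
  obtain r f f' where f: "f \<in> Homs (Zpow r) A" "f' \<in> Homs A (Zpow r)"
    and ff': "\<And>z. z \<in> Zpow r \<Longrightarrow> f' (f z) = z" "\<And>y. y \<in> A \<Longrightarrow> f (f' y) = y"
    using is_lattice_iso[OF assms(1)] by metis
  obtain s g g' where g: "g \<in> Homs (Zpow s) B" "g' \<in> Homs B (Zpow s)"
    and gg': "\<And>z. z \<in> Zpow s \<Longrightarrow> g' (g z) = z" "\<And>y. y \<in> B \<Longrightarrow> g (g' y) = y"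
    using is_lattice_iso[OF assms(2)] by metis
  \<comment> \<open>\<open>p\<close> and \<open>q\<close> cut a vector of length
    \<open>r + s\<close> into its first \<open>r\<close> and its last \<open>s\<close>
    coordinates.\<close>
  define p where "p = (\<lambda>(z::nat \<Rightarrow> int) i. if i < r then z i else 0)"
  define q where "q = (\<lambda>(z::nat \<Rightarrow> int) i. z (i + r))"
  have p: "p z \<in> Zpow r" for z by (simp add: p_def Zpow_def)
  have q: "q z \<in> Zpow s" if "z \<in> Zpow (r + s)" for z using that by (simp add: q_def Zpow_def)
  have add: "p (x + y) = p x + p y" "q (x + y) = q x + q y" for x y by (auto simp: p_def q_def)
  define F where "F = (\<lambda>z. if z \<in> Zpow (r + s) then (f (p z), g (q z)) else 0)"
  define F' where "F' = (\<lambda>(a, b) i. if i < r then f' a i else g' b (i - r))"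
  have F: "F \<in> Homs (Zpow (r + s)) (A \<times> B)"
    unfolding Homs_def
    using Homs_in[OF f(1) p] Homs_in[OF g(1) q] Homs_add[OF f(1) p p] Homs_add[OF g(1) q q]
      subgrp_add[OF subgrp_Zpow]
    by (auto simp: F_def add plus_prod_def)
  have "bij_betw F (Zpow (r + s)) (A \<times> B)"
  proof (rule bij_betw_byWitness[where f' = F'])
    show "\<forall>a\<in>Zpow (r + s). F' (F a) = a"
      using ff'(1)[OF p] gg'(1)[OF q] by (auto simp: F_def F'_def p_def q_def fun_eq_iff)
    show im: "F' ` (A \<times> B) \<subseteq> Zpow (r + s)"
      using Homs_in[OF g(2)] by (auto simp: F'_def Zpow_def)
    have "p (F' (a, b)) = f' a" "q (F' (a, b)) = g' b" if "a \<in> A" "b \<in> B" for a b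
      using Homs_in[OF f(2) that(1)] by (auto simp: p_def q_def F'_def Zpow_def fun_eq_iff)
    moreover have "F' c \<in> Zpow (r + s)" if "c \<in> A \<times> B" for c using im that by blast
    ultimately show "\<forall>c\<in>A \<times> B. F (F' c) = c"
      using ff'(2) gg'(2) by (auto simp: F_def)
    show "F ` Zpow (r + s) \<subseteq> A \<times> B" using F by (simp add: Homs_def)
  qed
  then show ?thesis using F unfolding is_lattice_def by blast
qed

text \<open>This is \<open>Zpow_extend_multiple\<close> in coordinates. The factor \<open>k\<close>
  cannot be avoided: on the even integers the form \<open>2 z \<mapsto> z\<close> does not extend to
  all integers.\<close>

lemma dual_extend_multiple:
  fixes h :: "'a::ab_group_add \<Rightarrow> int"
  assumes "is_lattice L" "subgrp H" "H \<subseteq> L" 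
    and h: "\<And>x y. x \<in> H \<Longrightarrow> y \<in> H \<Longrightarrow> h (x + y) = h x + h y"
  obtains k q where "k \<noteq> 0" "q \<in> dual L" "\<And>x. x \<in> H \<Longrightarrow> q x = k * h x"
proof -
  obtain r f g where f: "f \<in> Homs (Zpow r) L" and g: "g \<in> Homs L (Zpow r)"
    and fg: "\<And>z. z \<in> Zpow r \<Longrightarrow> g (f z) = z" "\<And>y. y \<in> L \<Longrightarrow> f (g y) = y"
    using is_lattice_iso[OF assms(1)] by metis
  define H1 where "H1 = {z \<in> Zpow r. f z \<in> H}"
  have "subgrp H1" unfolding H1_def by (rule subgrp_vimage[OF f(1) subgrp_Zpow assms(2)])
  moreover have "h (f (x + y)) = h (f x) + h (f y)" if "x \<in> H1" "y \<in> H1" for x y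
    using that Homs_add[OF f(1)] h by (simp add: H1_def)
  moreover have "H1 \<subseteq> Zpow r" by (auto simp: H1_def)
  ultimately obtain k c where k: "k \<noteq> 0" and kc: "\<forall>x\<in>H1. (\<Sum>i<r. c i * x i) = k * h (f x)"
    using Zpow_extend_multiple[of H1 r "h \<circ> f"] by auto
  define q where "q = (\<lambda>y. if y \<in> L then \<Sum>i<r. c i * g y i else 0)"
  have "q \<in> dual L"
    unfolding dual_def Homs_def
    using is_lattice_subgrp[OF assms(1)] Homs_add[OF g]
    by (auto simp: q_def subgrp_add algebra_simps sum.distrib)
  moreover have "q x = k * h x" if x: "x \<in> H" for x
  proof -
    have "x \<in> L" using x assms(3) by blast
    then have "g x \<in> H1" using x fg Homs_in[OF g] by (simp add: H1_def)
    then show ?thesis using kc \<open>x \<in> L\<close> fg by (simp add: q_def)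
  qed
  ultimately show thesis using that k by blast
qed

text \<open>A basis \<open>e\<close> with its dual basis \<open>d\<close>. The axiom
  \<open>realize\<close> later turns integral generators of a cone back into elements of
  \<open>N\<close>.\<close>

locale lattice_basis =
  fixes N :: "'a::ab_group_add set" and r :: nat and e :: "nat \<Rightarrow> 'a" and d :: "nat \<Rightarrow> 'a \<Rightarrow> int"
  assumes subgrp: "subgrp N"
    and e_in: "i < r \<Longrightarrow> e i \<in> N"
    and d_in: "i < r \<Longrightarrow> d i \<in> dual N"
    and d_e: "i < r \<Longrightarrow> j < r \<Longrightarrow> d i (e j) = (if i = j then 1 else 0)"
    and dual_expand: "m \<in> dual N \<Longrightarrow> y \<in> N \<Longrightarrow> m y = (\<Sum>i<r. m (e i) * d i y)"
    and realize: "\<exists>y\<in>N. \<forall>i<r. d i y = z i"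

lemma lattice_basis_exists:
  assumes "is_lattice N"
  shows "\<exists>r e d. lattice_basis N r e d"
proof -
  obtain r f g where f: "f \<in> Homs (Zpow r) N" and g: "g \<in> Homs N (Zpow r)"
    and fg: "\<And>z. z \<in> Zpow r \<Longrightarrow> g (f z) = z" "\<And>y. y \<in> N \<Longrightarrow> f (g y) = y"
    using is_lattice_iso[OF assms(1)] by metis
  note sub = is_lattice_subgrp[OF assms]
  have u: "unitvec i \<in> Zpow r" if "i < r" for i using that by (auto simp: Zpow_def unitvec_def)
  define d where "d = (\<lambda>i y. if y \<in> N then g y i else 0)"
  have "lattice_basis N r (\<lambda>i. f (unitvec i)) d"
  proof
    show "subgrp N" by (rule sub)
    fix i assume i: "i < r"
    show "f (unitvec i) \<in> N" by (rule Homs_in[OF f u[OF i]])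
    show "d i \<in> dual N"
      using sub Homs_add[OF g] by (auto simp: d_def dual_def Homs_def subgrp_add)
    fix j assume "j < r"
    then show "d i (f (unitvec j)) = (if i = j then 1 else 0)"
      using Homs_in[OF f u] fg(1)[OF u] by (simp add: d_def unitvec_def)
  next
    fix m y assume m: "m \<in> dual N" and y: "y \<in> N"
    note m' = m[unfolded dual_def]
    have "m (f z) - (\<Sum>i<r. m (f (unitvec i)) * z i) = 0" if "z \<in> Zpow r" for z
    proof (rule Zpow_additive_zero[OF _ _ that])
      fix y z assume "y \<in> Zpow r" "z \<in> Zpow r"
      then show "m (f (y + z)) - (\<Sum>i<r. m (f (unitvec i)) * (y + z) i) =
          (m (f y) - (\<Sum>i<r. m (f (unitvec i)) * y i)) + (m (f z) - (\<Sum>i<r. m (f (unitvec i)) * z i))"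
        by (simp add: Homs_add[OF f] Homs_add[OF m'] Homs_in[OF f] distrib_left sum.distrib)
    next
      fix i assume i: "i < r"
      then show "m (f (unitvec i)) - (\<Sum>j<r. m (f (unitvec j)) * unitvec i j) = 0"
        using sum_unitvec[OF i, of "\<lambda>j. m (f (unitvec j))"] by simp
    qed
    from this[OF Homs_in[OF g y]] show "m y = (\<Sum>i<r. m (f (unitvec i)) * d i y)"
      using y fg(2) by (simp add: d_def)
  next
    fix z :: "nat \<Rightarrow> int"
    have "(\<lambda>i. if i < r then z i else 0) \<in> Zpow r" (is "?z \<in> _") by (simp add: Zpow_def)
    then have "f ?z \<in> N" "g (f ?z) = ?z" using Homs_in[OF f] fg(1) by auto
    then show "\<exists>y\<in>N. \<forall>i<r. d i y = z i"
      by (intro bexI[of _ "f ?z"]) (auto simp: d_def)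
  qed
  then show ?thesis by blast
qed

lemma ext_add: "x \<in> ext N \<Longrightarrow> m \<in> dual N \<Longrightarrow> m' \<in> dual N \<Longrightarrow> x (m + m') = x m + x m'"
  using Homs_add[of x "dual N" UNIV m m'] by (simp add: ext_def)

lemma ext_int_mult:
  "x \<in> ext N \<Longrightarrow> m \<in> dual N \<Longrightarrow> x (\<lambda>y. k * m y) = of_int k * x m"
  using additive_int_mult[OF subgrp_dual, of m N x k] ext_add[of x N] by blast

lemma dual_sum:
  fixes m :: "'i \<Rightarrow> 'a::ab_group_add \<Rightarrow> int"
  assumes "finite I" "\<And>i. i \<in> I \<Longrightarrow> m i \<in> dual N"
  shows "(\<lambda>y. \<Sum>i\<in>I. c i * m i y) \<in> dual N"
  using assms
proof (induction I rule: finite_induct)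
  case empty
  then show ?case using subgrp_zero[OF subgrp_dual, of N] by (simp add: zero_fun_def)
next
  case (insert i I)
  have "(\<lambda>y. \<Sum>i\<in>insert i I. c i * m i y) = (\<lambda>y. c i * m i y) + (\<lambda>y. \<Sum>i\<in>I. c i * m i y)"
    using insert by (auto simp: fun_eq_iff)
  then show ?case using insert by (simp add: subgrp_add[OF subgrp_dual] subgrp_int_mult[OF subgrp_dual])
qed

lemma ext_sum:
  fixes m :: "'i \<Rightarrow> 'a::ab_group_add \<Rightarrow> int"
  assumes x: "x \<in> ext N" and "finite I" "\<And>i. i \<in> I \<Longrightarrow> m i \<in> dual N"
  shows "x (\<lambda>y. \<Sum>i\<in>I. c i * m i y) = (\<Sum>i\<in>I. of_int (c i) * x (m i))"
  using assms(2,3)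
proof (induction I rule: finite_induct)
  case empty
  then show ?case using Homs_zero[OF x[unfolded ext_def]] by (simp add: zero_fun_def)
next
  case (insert i I)
  have "(\<lambda>y. \<Sum>i\<in>insert i I. c i * m i y) = (\<lambda>y. c i * m i y) + (\<lambda>y. \<Sum>i\<in>I. c i * m i y)"
    using insert by (auto simp: fun_eq_iff)
  moreover have "(\<lambda>y. c i * m i y) \<in> dual N" "(\<lambda>y. \<Sum>i\<in>I. c i * m i y) \<in> dual N"
    using insert by (auto intro: dual_sum subgrp_int_mult[OF subgrp_dual])
  ultimately show ?case using insert by (simp add: ext_add[OF x] ext_int_mult[OF x])
qed

context lattice_basis
begin

lemma dual_eq: "m \<in> dual N \<Longrightarrow> m = (\<lambda>y. \<Sum>i<r. m (e i) * d i y)"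
proof
  fix y assume m: "m \<in> dual N"
  show "m y = (\<Sum>i<r. m (e i) * d i y)"
  proof (cases "y \<in> N")
    case False
    then have "m y = 0" "d i y = 0" if "i < r" for i
      using m d_in[OF that] by (simp_all add: dual_def Homs_outside)
    moreover have "m y = 0" using False m by (simp add: dual_def Homs_outside)
    ultimately show ?thesis by simp
  qed (rule dual_expand[OF m])
qed

lemma ext_expand:
  assumes "x \<in> ext N" "m \<in> dual N"
  shows "x m = (\<Sum>i<r. x (d i) * of_int (m (e i)))"
proof -
  have "x m = x (\<lambda>y. \<Sum>i<r. m (e i) * d i y)" using dual_eq[OF assms(2)] by simp
  also have "\<dots> = (\<Sum>i<r. of_int (m (e i)) * x (d i))"
    by (rule ext_sum[OF assms(1)]) (auto simp: d_in)
  finally show ?thesis by (simp add: mult.commute)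
qed

lemma ext_eqI:
  assumes "x \<in> ext N" "y \<in> ext N" "\<And>i. i < r \<Longrightarrow> x (d i) = y (d i)"
  shows "x = y"
proof
  fix m show "x m = y m"
  proof (cases "m \<in> dual N")
    case True
    show ?thesis unfolding ext_expand[OF assms(1) True] ext_expand[OF assms(2) True]
      by (intro sum.cong) (auto simp: assms(3))
  next
    case False
    then show ?thesis using assms(1,2) by (simp add: ext_def Homs_outside)
  qed
qed

end

lemma tens_in_ext: "n \<in> N \<Longrightarrow> tens N n k \<in> ext N"
  unfolding ext_def Homs_def tens_def by (auto simp: dual_def Homs_def algebra_simps)

section \<open>Polyhedral cones in coordinates\<close>

text \<open>Finite nonnegative combinations in inductive form: closure properties and sign arguments
  become inductions, and the explicit sums of \<open>conic_finite_iff\<close> appear only where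
  weights matter.\<close>

inductive_set conic :: "('i \<Rightarrow> real) set \<Rightarrow> ('i \<Rightarrow> real) set" for G where
  conic_zero: "(\<lambda>_. 0) \<in> conic G"
| conic_step: "x \<in> conic G \<Longrightarrow> g \<in> G \<Longrightarrow> 0 \<le> t \<Longrightarrow> (\<lambda>i. x i + t * g i) \<in> conic G"

lemma conic_gen: "g \<in> G \<Longrightarrow> g \<in> conic G"
  using conic_step[OF conic_zero, of g G 1] by simp

lemma conic_add: "y \<in> conic G \<Longrightarrow> x \<in> conic G \<Longrightarrow> (\<lambda>i. x i + y i) \<in> conic G"
proof (induction rule: conic.induct)
  case (conic_step y g t)
  then show ?case using conic.conic_step[of "\<lambda>i. x i + y i" G g t] by (simp add: add.assoc)
qed simp

lemma conic_scale: "x \<in> conic G \<Longrightarrow> 0 \<le> t \<Longrightarrow> (\<lambda>i. t * x i) \<in> conic G"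
proof (induction rule: conic.induct)
  case (conic_step x g s)
  then show ?case using conic.conic_step[of "\<lambda>i. t * x i" G g "t * s"] by (simp add: algebra_simps)
qed (simp add: conic_zero)

lemma conic_sum:
  "finite I \<Longrightarrow> (\<And>j. j \<in> I \<Longrightarrow> x j \<in> conic G) \<Longrightarrow> (\<lambda>i. \<Sum>j\<in>I. x j i) \<in> conic G"
proof (induction I rule: finite_induct)
  case (insert j I)
  then show ?case using conic_add[of "\<lambda>i. \<Sum>j\<in>I. x j i" G "x j"] by simp
qed (simp add: conic_zero)

lemma conic_sub: "x \<in> conic G \<Longrightarrow> G \<subseteq> conic H \<Longrightarrow> x \<in> conic H"
proof (induction rule: conic.induct)
  case (conic_step x g t)
  then show ?case using conic_add[OF conic_scale[of g H t], of x] by auto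
qed (simp add: conic_zero)

lemma conic_finite_iff:
  assumes "finite G"
  shows "x \<in> conic G \<longleftrightarrow> (\<exists>\<rho>. (\<forall>g\<in>G. 0 \<le> \<rho> g) \<and> x = (\<lambda>i. \<Sum>g\<in>G. \<rho> g * g i))"
proof
  assume "x \<in> conic G"
  then show "\<exists>\<rho>. (\<forall>g\<in>G. 0 \<le> \<rho> g) \<and> x = (\<lambda>i. \<Sum>g\<in>G. \<rho> g * g i)"
  proof (induction rule: conic.induct)
    case conic_zero
    then show ?case by (intro exI[of _ "\<lambda>_. 0"]) auto
  next
    case (conic_step x g t)
    then obtain \<rho> where \<rho>: "\<forall>g\<in>G. 0 \<le> \<rho> g" "x = (\<lambda>i. \<Sum>g\<in>G. \<rho> g * g i)" by blast
    have "(\<Sum>h\<in>G. (\<rho> h + (if h = g then t else 0)) * h i) = x i + t * g i" for i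
    proof -
      have "(\<Sum>h\<in>G. (if h = g then t else 0) * h i) = (\<Sum>h\<in>G. if h = g then t * h i else 0)"
        by (intro sum.cong) auto
      then show ?thesis using conic_step(2) assms by (simp add: \<rho>(2) distrib_right sum.distrib)
    qed
    then show ?case using \<rho>(1) conic_step(3)
      by (intro exI[of _ "\<lambda>h. \<rho> h + (if h = g then t else 0)"]) auto
  qed
next
  assume "\<exists>\<rho>. (\<forall>g\<in>G. 0 \<le> \<rho> g) \<and> x = (\<lambda>i. \<Sum>g\<in>G. \<rho> g * g i)"
  then obtain \<rho> where \<rho>: "\<forall>g\<in>G. 0 \<le> \<rho> g" "x = (\<lambda>i. \<Sum>g\<in>G. \<rho> g * g i)" by blast
  show "x \<in> conic G" unfolding \<rho>(2)
    by (rule conic_sum[OF assms]) (use \<rho>(1) in \<open>blast intro: conic_scale conic_gen\<close>)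
qed

definition linfun :: "(('i \<Rightarrow> real) \<Rightarrow> real) \<Rightarrow> bool" where
  "linfun l \<longleftrightarrow> (\<forall>x y t. l (\<lambda>i. x i + t * y i) = l x + t * l y)"

lemma linfunD: "linfun l \<Longrightarrow> l (\<lambda>i. x i + t * y i) = l x + t * l y"
  by (simp add: linfun_def)

lemma linfun_zero: "linfun l \<Longrightarrow> l (\<lambda>_. 0) = 0"
  using linfunD[of l "\<lambda>_. 0" 1 "\<lambda>_. 0"] by simp

lemma linfun_scale: "linfun l \<Longrightarrow> l (\<lambda>i. t * x i) = t * l x"
  using linfunD[of l "\<lambda>_. 0" t x] linfun_zero[of l] by simp

lemma linfun_add: "linfun l \<Longrightarrow> l (\<lambda>i. x i + y i) = l x + l y"
  using linfunD[of l x 1 y] by simp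

lemma linfun_sum:
  assumes "linfun l" "finite I"
  shows "l (\<lambda>i. \<Sum>j\<in>I. x j i) = (\<Sum>j\<in>I. l (x j))"
  using assms(2)
proof (induction I rule: finite_induct)
  case (insert j I)
  then show ?case using linfun_add[OF assms(1), of "x j" "\<lambda>i. \<Sum>j\<in>I. x j i"] by simp
qed (simp add: linfun_zero[OF assms(1)])

lemma linfun_conic_nonneg:
  assumes "linfun l" "\<And>g. g \<in> G \<Longrightarrow> 0 \<le> l g" "x \<in> conic G"
  shows "0 \<le> l x"
  using assms(3)
proof (induction rule: conic.induct)
  case (conic_step x g t)
  then show ?case using assms(1,2) by (simp add: linfun_def)
qed (simp add: linfun_zero[OF assms(1)])

text \<open>One step of the double description method.\<close>

definition dd_step :: "('i \<Rightarrow> real) set \<Rightarrow> (('i \<Rightarrow> real) \<Rightarrow> real) \<Rightarrow> ('i \<Rightarrow> real) set" where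
  "dd_step G l = {g\<in>G. 0 \<le> l g} \<union>
     (\<lambda>(p, q) i. - l q * p i + l p * q i) ` {(p, q). p \<in> G \<and> q \<in> G \<and> 0 < l p \<and> l q < 0}"

lemma finite_dd_step: "finite G \<Longrightarrow> finite (dd_step G l)"
  unfolding dd_step_def
  by (intro finite_UnI finite_imageI) (auto intro: finite_subset[of _ "G \<times> G"])

text \<open>For the inclusion from right to left, \<open>x\<close> is written as a nonnegative
  combination and the generators are split by the sign of \<open>l\<close>. Since
  \<open>0 \<le> l x\<close>, the mass \<open>S\<close> of the positive part is at least the mass
  \<open>T\<close> of the negative part, so the negative part is absorbed by a share of the positive
  part through the paired rays, which lie on the hyperplane \<open>l = 0\<close>.\<close>

lemma conic_dd_step:
  assumes l: "linfun l" and G: "finite G"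
  shows "conic (dd_step G l) = {x \<in> conic G. 0 \<le> l x}"
proof (intro equalityI subsetI CollectI conjI)
  fix x assume x: "x \<in> conic (dd_step G l)"
  have "dd_step G l \<subseteq> conic G"
  proof
    fix y assume "y \<in> dd_step G l"
    then consider "y \<in> G" | p q where "p \<in> G" "q \<in> G" "0 < l p" "l q < 0"
        "y = (\<lambda>i. - l q * p i + l p * q i)"
      by (auto simp: dd_step_def)
    then show "y \<in> conic G"
    proof cases
      case 2
      then show ?thesis
        using conic_add[OF conic_scale[OF conic_gen[of q G], of "l p"] conic_scale[OF conic_gen[of p G], of "- l q"]]
        by simp
    qed (rule conic_gen)
  qed
  then show "x \<in> conic G" using conic_sub[OF x] by blast
  have "0 \<le> l y" if "y \<in> dd_step G l" for y
  proof -
    have "l (\<lambda>i. - l q * p i + l p * q i) = l (\<lambda>i. - l q * p i) + l p * l q" for p q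
      by (rule linfunD[OF l])
    then have "l (\<lambda>i. - l q * p i + l p * q i) = 0" for p q
      unfolding linfun_scale[OF l] by simp
    then show ?thesis using that by (auto simp: dd_step_def)
  qed
  then show "0 \<le> l x" using linfun_conic_nonneg[OF l _ x] by blast
next
  fix x assume "x \<in> {x \<in> conic G. 0 \<le> l x}"
  then obtain \<rho> where \<rho>: "\<And>g. g \<in> G \<Longrightarrow> 0 \<le> \<rho> g" and x: "x = (\<lambda>i. \<Sum>g\<in>G. \<rho> g * g i)" and lx: "0 \<le> l x"
    using conic_finite_iff[OF G, of x] by blast
  let ?D = "conic (dd_step G l)"
  define P where "P = {g\<in>G. 0 < l g}"
  define Q where "Q = {g\<in>G. l g < 0}"
  define Z where "Z = {g\<in>G. l g = 0}"
  have fin: "finite P" "finite Q" "finite Z" and GPQZ: "G = P \<union> Q \<union> Z"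
    and disj: "P \<inter> Q = {}" "(P \<union> Q) \<inter> Z = {}"
    using G by (auto simp: P_def Q_def Z_def)
  have split: "(\<Sum>g\<in>G. F g) = (\<Sum>g\<in>P. F g) + (\<Sum>g\<in>Q. F g) + (\<Sum>g\<in>Z. F g)" for F :: "_ \<Rightarrow> real"
    unfolding GPQZ using fin disj by (simp add: sum.union_disjoint)
  define S where "S = (\<Sum>g\<in>P. \<rho> g * l g)"
  define T where "T = (\<Sum>g\<in>Q. \<rho> g * - l g)"
  have "l x = (\<Sum>g\<in>G. \<rho> g * l g)"
    unfolding x by (simp add: linfun_sum[OF l G] linfun_scale[OF l])
  also have "\<dots> = S - T" unfolding split S_def T_def by (simp add: Z_def sum_negf)
  finally have ST: "T \<le> S" using lx by simp
  have T0: "0 \<le> T" unfolding T_def by (intro sum_nonneg mult_nonneg_nonneg) (auto simp: Q_def \<rho>)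
  have gen: "(\<lambda>i. \<Sum>g\<in>A. c g * g i) \<in> ?D"
    if A: "finite A" "A \<subseteq> P \<union> Z" "\<And>g. g \<in> A \<Longrightarrow> 0 \<le> c g" for A c
  proof (rule conic_sum[OF A(1)])
    fix g assume g: "g \<in> A"
    have "g \<in> dd_step G l" using g A(2) by (auto simp: dd_step_def P_def Z_def)
    then show "(\<lambda>i. c g * g i) \<in> ?D" by (intro conic_scale conic_gen A(3)[OF g])
  qed
  have genP: "(\<lambda>i. \<Sum>g\<in>P. \<rho> g * g i) \<in> ?D" and genZ: "(\<lambda>i. \<Sum>g\<in>Z. \<rho> g * g i) \<in> ?D"
    using gen[of P \<rho>] gen[of Z \<rho>] fin GPQZ \<rho> by blast+
  show "x \<in> ?D"
  proof (cases "T = 0")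
    case True
    \<comment> \<open>Treated apart because \<open>S\<close> may be 0 as well; here every negative
      generator has weight 0 and drops out.\<close>
    have "\<rho> g * - l g = 0" if "g \<in> Q" for g
      using True sum_nonneg_eq_0_iff[of Q "\<lambda>g. \<rho> g * - l g"] fin(2) that
      by (auto simp: T_def Q_def \<rho> mult_nonneg_nonpos)
    then have "(\<Sum>g\<in>Q. \<rho> g * g i) = 0" for i by (intro sum.neutral) (auto simp: Q_def)
    then have "x = (\<lambda>i. (\<Sum>g\<in>P. \<rho> g * g i) + (\<Sum>g\<in>Z. \<rho> g * g i))"
      unfolding x split by simp
    moreover have "(\<lambda>i. \<Sum>g\<in>P. \<rho> g * g i) \<in> ?D" "(\<lambda>i. \<Sum>g\<in>Z. \<rho> g * g i) \<in> ?D"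
      using genP genZ by blast+
    ultimately show ?thesis using conic_add by simp
  next
    case False
    then have S: "0 < S" using T0 ST by simp
    \<comment> \<open>The share \<open>T / S\<close> of the positive part is used up by the paired
      rays; \<open>1 - T / S\<close> remains.\<close>
    have a: "(\<lambda>i. \<Sum>g\<in>P. (\<rho> g * (1 - T / S)) * g i) \<in> ?D"
      by (rule gen) (use fin S ST in \<open>auto simp: P_def \<rho>\<close>)
    have b: "(\<lambda>i. \<Sum>g\<in>Z. \<rho> g * g i) \<in> ?D"
      by (rule genZ)
    \<comment> \<open>The weight \<open>\<rho> p * \<rho> q / S\<close> makes the sum over all pairs
      return the negative part exactly once: summing \<open>\<rho> p * l p\<close> over
      \<open>p\<close> gives \<open>S\<close>, which cancels.\<close>
    have "(\<lambda>i. (\<rho> p * \<rho> q / S) * (- l q * p i + l p * q i)) \<in> ?D" if "p \<in> P" "q \<in> Q" for p q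
    proof (rule conic_scale)
      have "(\<lambda>i. - l q * p i + l p * q i) \<in> dd_step G l"
        using that unfolding dd_step_def P_def Q_def by (intro UnI2 image_eqI[of _ _ "(p, q)"]) auto
      then show "(\<lambda>i. - l q * p i + l p * q i) \<in> ?D" by (rule conic_gen)
      show "0 \<le> \<rho> p * \<rho> q / S" using that S \<rho> by (simp add: P_def Q_def)
    qed
    then have c: "(\<lambda>i. \<Sum>z\<in>P \<times> Q. (case z of (p, q) \<Rightarrow> (\<lambda>i. (\<rho> p * \<rho> q / S) * (- l q * p i + l p * q i))) i) \<in> ?D"
      using fin by (intro conic_sum) auto
    have "(\<Sum>z\<in>P \<times> Q. (case z of (p, q) \<Rightarrow> (\<lambda>i. (\<rho> p * \<rho> q / S) * (- l q * p i + l p * q i))) i)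
        = (\<Sum>p\<in>P. \<rho> p * (T / S) * p i) + (\<Sum>q\<in>Q. \<rho> q * q i)" for i
    proof -
      have "(\<Sum>z\<in>P \<times> Q. (case z of (p, q) \<Rightarrow> (\<lambda>i. (\<rho> p * \<rho> q / S) * (- l q * p i + l p * q i))) i)
          = (\<Sum>p\<in>P. \<Sum>q\<in>Q. (\<rho> p * p i / S) * (\<rho> q * - l q) + (\<rho> p * l p) * (\<rho> q * q i / S))"
        unfolding sum.cartesian_product by (intro sum.cong) (auto simp: algebra_simps)
      also have "\<dots> = (\<Sum>p\<in>P. \<rho> p * p i / S) * T + S * (\<Sum>q\<in>Q. \<rho> q * q i / S)"
        by (simp only: sum.distrib sum_product S_def T_def)
      also have "\<dots> = (\<Sum>p\<in>P. \<rho> p * (T / S) * p i) + (\<Sum>q\<in>Q. \<rho> q * q i)"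
        using S by (simp add: sum_distrib_left sum_distrib_right algebra_simps)
      finally show ?thesis .
    qed
    then have "x = (\<lambda>i. ((\<Sum>g\<in>P. (\<rho> g * (1 - T / S)) * g i) + (\<Sum>g\<in>Z. \<rho> g * g i)) +
       (\<Sum>z\<in>P \<times> Q. (case z of (p, q) \<Rightarrow> (\<lambda>i. (\<rho> p * \<rho> q / S) * (- l q * p i + l p * q i))) i))"
      unfolding x split by (simp add: fun_eq_iff algebra_simps sum.distrib sum_subtractf)
    then show ?thesis using conic_add[OF c conic_add[OF b a]] by simp
  qed
qed

section \<open>Integral vectors and the theorems of Weyl, Farkas and Minkowski\<close>

definition Rpow :: "nat \<Rightarrow> (nat \<Rightarrow> real) set" where
  "Rpow n = {x. \<forall>i\<ge>n. x i = 0}"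

text \<open>Integral vectors stay real vectors, so that rationality of a cone is a membership that
  \<open>dd_step\<close> preserves.\<close>

definition Lpow :: "nat \<Rightarrow> (nat \<Rightarrow> real) set" where
  "Lpow n = {x\<in>Rpow n. \<forall>i. x i \<in> \<int>}"

definition dot :: "nat \<Rightarrow> (nat \<Rightarrow> real) \<Rightarrow> (nat \<Rightarrow> real) \<Rightarrow> real" where
  "dot n x y = (\<Sum>i<n. x i * y i)"

lemma linfun_dot: "linfun (dot n x)"
  by (simp add: linfun_def dot_def algebra_simps sum.distrib sum_distrib_left)

lemma dot_commute: "dot n x y = dot n y x"
  by (simp add: dot_def mult.commute)

lemma dot_Lpow_Ints: "x \<in> Lpow n \<Longrightarrow> y \<in> Lpow n \<Longrightarrow> dot n x y \<in> \<int>"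
  by (auto simp: dot_def Lpow_def)

lemma conic_Rpow: "x \<in> conic G \<Longrightarrow> G \<subseteq> Rpow n \<Longrightarrow> x \<in> Rpow n"
  by (induction rule: conic.induct) (auto simp: Rpow_def)

text \<open>The unit vectors and their negatives: generators for the empty system of inequalities,
  from which the double description method starts.\<close>

definition Rpow_gens :: "nat \<Rightarrow> (nat \<Rightarrow> real) set" where
  "Rpow_gens n = (\<lambda>(j, s) i. if i = j then s else 0) ` ({..<n} \<times> {1, -1})"

lemma conic_Rpow_gens: "conic (Rpow_gens n) = Rpow n"
proof (intro equalityI subsetI)
  fix x assume "x \<in> conic (Rpow_gens n)"
  moreover have "Rpow_gens n \<subseteq> Rpow n" by (auto simp: Rpow_gens_def Rpow_def)
  ultimately show "x \<in> Rpow n" by (rule conic_Rpow)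
next
  fix x assume x: "x \<in> Rpow n"
  have "(\<lambda>i. \<bar>x j\<bar> * (if i = j then sgn (x j) else 0)) \<in> conic (Rpow_gens n)" if "j < n" for j
  proof (cases "x j = 0")
    case False
    then have "(\<lambda>i. if i = j then sgn (x j) else 0) \<in> Rpow_gens n"
      unfolding Rpow_gens_def using that by (intro image_eqI[of _ _ "(j, sgn (x j))"]) (auto simp: sgn_if)
    then show ?thesis by (intro conic_scale conic_gen) auto
  qed (simp add: conic_zero)
  then have "(\<lambda>i. \<Sum>j<n. \<bar>x j\<bar> * (if i = j then sgn (x j) else 0)) \<in> conic (Rpow_gens n)"
    by (intro conic_sum) auto
  moreover have "(\<Sum>j<n. \<bar>x j\<bar> * (if i = j then sgn (x j) else 0)) = x i" for i
  proof -
    have "(\<Sum>j<n. \<bar>x j\<bar> * (if i = j then sgn (x j) else 0)) = (\<Sum>j<n. if i = j then x j else 0)"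
      by (intro sum.cong) (auto simp: abs_mult_sgn)
    then show ?thesis using x by (simp add: Rpow_def)
  qed
  ultimately show "x \<in> conic (Rpow_gens n)" by simp
qed

lemma Rpow_gens_Lpow: "Rpow_gens n \<subseteq> Lpow n" and finite_Rpow_gens: "finite (Rpow_gens n)"
  by (auto simp: Rpow_gens_def Lpow_def Rpow_def)

text \<open>The coefficients of a paired ray are dot products of integral vectors, hence integers:
  no denominators arise.\<close>

lemma dd_step_Lpow:
  assumes "G \<subseteq> Lpow n" "b \<in> Lpow n"
  shows "dd_step G (dot n b) \<subseteq> Lpow n"
proof
  fix x assume "x \<in> dd_step G (dot n b)"
  then consider "x \<in> G" | p q where "p \<in> G" "q \<in> G" "x = (\<lambda>i. - dot n b q * p i + dot n b p * q i)"
    by (auto simp: dd_step_def)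
  then show "x \<in> Lpow n"
  proof cases
    case 2
    then have "p \<in> Lpow n" "q \<in> Lpow n" "dot n b p \<in> \<int>" "dot n b q \<in> \<int>"
      using assms dot_Lpow_Ints by blast+
    then show ?thesis unfolding 2 Lpow_def Rpow_def by auto
  qed (use assms in blast)
qed

text \<open>Weyl's theorem and Farkas' lemma share one induction: both steps rest on \<open>dd_step\<close>.\<close>

lemma weyl_farkas:
  assumes "finite B" "B \<subseteq> Lpow n"
  shows "(\<exists>A. finite A \<and> A \<subseteq> Lpow n \<and> {x \<in> Rpow n. \<forall>b\<in>B. 0 \<le> dot n b x} = conic A) \<and>
    (\<forall>u\<in>Rpow n. (\<forall>x\<in>Rpow n. (\<forall>b\<in>B. 0 \<le> dot n b x) \<longrightarrow> 0 \<le> dot n u x) \<longrightarrow> u \<in> conic B)"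
  using assms
proof (induction B rule: finite_induct)
  case empty
  have "u \<in> conic {}" if u: "u \<in> Rpow n" and pos: "\<forall>x\<in>Rpow n. 0 \<le> dot n u x" for u
  proof -
    \<comment> \<open>Without inequalities \<open>u\<close> is nonnegative everywhere, also at
      \<open>- u\<close>, which forces \<open>u = 0\<close>.\<close>
    have "(\<lambda>i. - u i) \<in> Rpow n" using u by (simp add: Rpow_def)
    then have "0 \<le> dot n u (\<lambda>i. - u i)" using pos by blast
    then have "(\<Sum>i<n. u i * u i) \<le> 0" by (simp add: dot_def sum_negf)
    then have "(\<Sum>i<n. u i * u i) = 0" by (simp add: order_antisym sum_nonneg)
    then have "u i = 0" if "i < n" for i using that sum_nonneg_eq_0_iff[of "{..<n}" "\<lambda>i. u i * u i"] by auto
    then have "u i = 0" for i using u by (cases "i < n") (auto simp: Rpow_def)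
    then have "u = (\<lambda>_. 0)" by blast
    then show ?thesis using conic_zero by simp
  qed
  moreover have "\<exists>A. finite A \<and> A \<subseteq> Lpow n \<and> Rpow n = conic A"
    by (intro exI[of _ "Rpow_gens n"]) (simp add: conic_Rpow_gens Rpow_gens_Lpow finite_Rpow_gens)
  ultimately show ?case by simp
next
  case (insert b B)
  define C where "C = {x \<in> Rpow n. \<forall>b\<in>B. 0 \<le> dot n b x}"
  have b: "b \<in> Lpow n" and B: "B \<subseteq> Lpow n" using insert.prems by auto
  from insert.IH[OF B] obtain A where A: "finite A" "A \<subseteq> Lpow n" "C = conic A"
    unfolding C_def by blast
  have farkas: "u \<in> conic B" if "u \<in> Rpow n" "\<forall>x\<in>C. 0 \<le> dot n u x" for u
    using insert.IH[OF B] that unfolding C_def by blast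
  have eq: "{x \<in> Rpow n. \<forall>b\<in>insert b B. 0 \<le> dot n b x} = conic (dd_step A (dot n b))"
    unfolding conic_dd_step[OF linfun_dot A(1)] A(3)[symmetric] by (auto simp: C_def)
  have "u \<in> conic (insert b B)" if u: "u \<in> Rpow n"
    and pos: "\<forall>x\<in>Rpow n. (\<forall>b\<in>insert b B. 0 \<le> dot n b x) \<longrightarrow> 0 \<le> dot n u x" for u
  proof -
    have pos': "0 \<le> dot n u x" if "x \<in> C" "0 \<le> dot n b x" for x
      using that pos by (auto simp: C_def)
    have AC: "x \<in> C" if "x \<in> A" for x using that A(3) conic_gen by blast
    \<comment> \<open>A multiplier \<open>t \<ge> 0\<close> is sought such that
      \<open>u - t b\<close> is nonnegative on the generators \<open>A\<close> of \<open>C\<close>.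
      A generator \<open>p\<close> with positive value of \<open>b\<close> demands
      \<open>t \<le> f p\<close>, a generator \<open>q\<close> with negative value demands
      \<open>f q \<le> t\<close>.\<close>
    define f where "f = (\<lambda>x. dot n u x / dot n b x)"
    define Ps where "Ps = f ` {p\<in>A. 0 < dot n b p}"
    \<comment> \<open>The extra element 0 makes \<open>t = Max Qs\<close> nonnegative and keeps the
      set nonempty.\<close>
    define Qs where "Qs = insert 0 (f ` {q\<in>A. dot n b q < 0})"
    have finPQ: "finite Ps" "finite Qs" using A(1) by (auto simp: Ps_def Qs_def)
    have fpos: "0 \<le> f p" if "p \<in> A" "0 < dot n b p" for p
      using pos'[OF AC[OF that(1)]] that by (simp add: f_def)
    \<comment> \<open>The paired ray of \<open>p\<close> and \<open>q\<close> belongs to the new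
      cone, so \<open>u\<close> is nonnegative there; this says that the two demands on
      \<open>t\<close> are consistent.\<close>
    have cmp: "f q \<le> f p" if "p \<in> A" "q \<in> A" "0 < dot n b p" "dot n b q < 0" for p q
    proof -
      define x where "x = (\<lambda>i. - dot n b q * p i + dot n b p * q i)"
      have val: "dot n w x = - dot n b q * dot n w p + dot n b p * dot n w q" for w
        unfolding x_def dot_def by (simp add: algebra_simps sum.distrib sum_distrib_left sum_subtractf)
      have "x \<in> dd_step A (dot n b)" using that by (auto simp: x_def dd_step_def)
      then have "x \<in> C" "0 \<le> dot n b x"
        using conic_gen[of x] conic_dd_step[OF linfun_dot A(1), of n b] A(3) by auto
      then have "0 \<le> dot n u x" by (rule pos')
      then show ?thesis using that(3,4) unfolding val f_def
        by (simp add: field_simps)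
    qed
    define t where "t = Max Qs"
    have t0: "0 \<le> t" unfolding t_def using finPQ by (simp add: Qs_def)
    have tP: "t \<le> f p" if "p \<in> A" "0 < dot n b p" for p
      unfolding t_def using finPQ(2) fpos cmp that by (auto simp: Qs_def)
    have tQ: "f q \<le> t" if "q \<in> A" "dot n b q < 0" for q
      unfolding t_def using finPQ(2) that by (intro Max_ge) (auto simp: Qs_def)
    \<comment> \<open>Nonnegative on all of \<open>C\<close>, so that the induction hypothesis puts
      \<open>v\<close> into \<open>conic B\<close>; adding back \<open>t b\<close> gives
      \<open>u\<close>.\<close>
    define v where "v = (\<lambda>i. u i - t * b i)"
    have vx: "dot n v x = dot n u x - t * dot n b x" for x
      by (simp add: v_def dot_def algebra_simps sum_subtractf sum_distrib_left)
    have "0 \<le> dot n v g" if g: "g \<in> A" for g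
    proof -
      consider "dot n b g = 0" | "0 < dot n b g" | "dot n b g < 0" by linarith
      then show ?thesis
      proof cases
        case 1
        then show ?thesis using pos'[OF AC[OF g]] by (simp add: vx)
      next
        case 2
        then show ?thesis using tP[OF g 2] by (simp add: vx f_def field_simps)
      next
        case 3
        then show ?thesis using tQ[OF g 3] by (simp add: vx f_def field_simps)
      qed
    qed
    then have "\<forall>x\<in>C. 0 \<le> dot n v x" unfolding A(3) using linfun_conic_nonneg[OF linfun_dot] by blast
    moreover have "v \<in> Rpow n" using u b by (simp add: v_def Rpow_def Lpow_def)
    ultimately have "v \<in> conic B" by (intro farkas)
    then have "v \<in> conic (insert b B)" using conic_sub[of v B] conic_gen by blast
    then have "(\<lambda>i. v i + t * b i) \<in> conic (insert b B)" by (intro conic_step t0) auto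
    then show ?thesis by (simp add: v_def)
  qed
  then show ?case unfolding eq
    using finite_dd_step[OF A(1)] dd_step_Lpow[OF A(2) b] by blast
qed

text \<open>Duality: by Weyl's theorem the dual cone of \<open>conic A\<close> is generated by a
  finite set \<open>B\<close> of integral vectors, and Farkas' lemma for \<open>A\<close> says that
  \<open>conic A\<close> is the dual of its dual.\<close>

lemma minkowski:
  assumes "finite A" "A \<subseteq> Lpow n"
  shows "\<exists>B. finite B \<and> B \<subseteq> Lpow n \<and> conic A = {x \<in> Rpow n. \<forall>b\<in>B. 0 \<le> dot n b x}"
proof -
  obtain B where B: "finite B" "B \<subseteq> Lpow n" "{x \<in> Rpow n. \<forall>a\<in>A. 0 \<le> dot n a x} = conic B"
    using weyl_farkas[OF assms] by blast
  have "conic A = {x \<in> Rpow n. \<forall>b\<in>B. 0 \<le> dot n b x}"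
  proof (intro equalityI subsetI CollectI conjI ballI)
    fix x assume x: "x \<in> conic A"
    show "x \<in> Rpow n" using conic_Rpow[OF x] assms(2) by (auto simp: Lpow_def)
    fix b assume "b \<in> B"
    then have "\<forall>a\<in>A. 0 \<le> dot n a b" using B(3) conic_gen by blast
    then show "0 \<le> dot n b x" using linfun_conic_nonneg[OF linfun_dot _ x] by (metis dot_commute)
  next
    fix x assume x: "x \<in> {x \<in> Rpow n. \<forall>b\<in>B. 0 \<le> dot n b x}"
    have "0 \<le> dot n x u" if "u \<in> conic B" for u
      using linfun_conic_nonneg[OF linfun_dot _ that] x by (metis (mono_tags) dot_commute mem_Collect_eq)
    then show "x \<in> conic A" using weyl_farkas[OF assms] B(3) x by blast
  qed
  then show ?thesis using B by blast
qed

section \<open>Rational cones\<close>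

lemma sum_fun_apply: "(\<Sum>i\<in>I. f i) x = (\<Sum>i\<in>I. f i x)"
  by (induction I rule: infinite_finite_induct) auto

text \<open>The generator form occurring in \<open>sc_rational_cone\<close>. It makes dual monoids
  explicit, whereas the inequality form \<open>hcone\<close> suits faces and fiber products; the
  theorems of Weyl and Minkowski convert between the two.\<close>

definition gcone :: "'a::ab_group_add set \<Rightarrow> 'a set \<Rightarrow> 'a rcone" where
  "gcone N A = {\<Sum>n\<in>A. tens N n (r n) | r. \<forall>n\<in>A. 0 \<le> r n}"

definition hcone :: "'a::ab_group_add set \<Rightarrow> ('a \<Rightarrow> int) set \<Rightarrow> 'a rcone" where
  "hcone N B = {x \<in> ext N. \<forall>m\<in>B. 0 \<le> x m}"

lemma sum_in_subgrp: "subgrp H \<Longrightarrow> (\<And>i. i \<in> I \<Longrightarrow> f i \<in> H) \<Longrightarrow> (\<Sum>i\<in>I. f i) \<in> H"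
  by (induction I rule: infinite_finite_induct) (auto simp: subgrp_zero subgrp_add)

lemma gcone_subset_ext: "A \<subseteq> N \<Longrightarrow> gcone N A \<subseteq> ext N"
  unfolding gcone_def by (auto intro!: sum_in_subgrp[OF subgrp_ext] tens_in_ext)

lemma tens_0: "tens N n 0 = 0"
  by (simp add: tens_def fun_eq_iff)

lemma gcone_zero: "0 \<in> gcone N A"
  unfolding gcone_def by (intro CollectI exI[of _ "\<lambda>_. 0"]) (auto simp: tens_0)

lemma gcone_step:
  assumes "finite A" "x \<in> gcone N A" "a \<in> A" "0 \<le> t"
  shows "x + tens N a t \<in> gcone N A"
proof -
  obtain \<rho> where \<rho>: "x = (\<Sum>n\<in>A. tens N n (\<rho> n))" "\<forall>n\<in>A. 0 \<le> \<rho> n"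
    using assms(2) by (auto simp: gcone_def)
  have "x + tens N a t = (\<Sum>n\<in>A. tens N n ((\<rho>(a := \<rho> a + t)) n))"
    unfolding \<rho>(1) sum.remove[OF assms(1,3)] by (auto simp: tens_def fun_eq_iff algebra_simps intro!: sum.cong)
  then show ?thesis unfolding gcone_def using \<rho>(2) assms(4)
    by (intro CollectI exI[of _ "\<rho>(a := \<rho> a + t)"]) auto
qed

lemma gcone_gen: "finite A \<Longrightarrow> a \<in> A \<Longrightarrow> tens N a 1 \<in> gcone N A"
  using gcone_step[OF _ gcone_zero, of A a 1 N] by simp

lemma linear_form_sum:
  assumes u: "linear_form N u" and "finite I" "\<And>i. i \<in> I \<Longrightarrow> x i \<in> ext N"
  shows "u (\<Sum>i\<in>I. x i) = (\<Sum>i\<in>I. u (x i))"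
  using assms(2,3)
proof (induction I rule: finite_induct)
  case empty
  have "(0::('a \<Rightarrow> int) \<Rightarrow> real) \<in> ext N" by (rule subgrp_zero[OF subgrp_ext])
  moreover have "scale 0 0 = (0::('a \<Rightarrow> int) \<Rightarrow> real)" by (simp add: scale_def fun_eq_iff)
  ultimately have "u 0 = 0 * u 0" using u unfolding linear_form_def by metis
  then show ?case by (simp only: sum.empty mult_zero_left)
next
  case (insert i I)
  then have "x i \<in> ext N" "(\<Sum>i\<in>I. x i) \<in> ext N" by (auto intro: sum_in_subgrp[OF subgrp_ext])
  then have "u (x i + (\<Sum>i\<in>I. x i)) = u (x i) + u (\<Sum>i\<in>I. x i)"
    using u unfolding linear_form_def by blast
  moreover have "u (\<Sum>i\<in>I. x i) = (\<Sum>i\<in>I. u (x i))" using insert by blast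
  ultimately show ?case by (simp only: sum.insert[OF insert.hyps])
qed

section \<open>Transport of the cone theorems to lattices by dual bases\<close>

context lattice_basis
begin

text \<open>Both coordinate maps are cut off at \<open>r\<close> in order to land in
  \<open>Rpow r\<close>. As the bases are dual, the pairing becomes the dot product
  (\<open>eval_dot\<close>).\<close>

definition coord :: "(('a \<Rightarrow> int) \<Rightarrow> real) \<Rightarrow> nat \<Rightarrow> real" where
  "coord x = (\<lambda>i. if i < r then x (d i) else 0)"

definition dcoord :: "('a \<Rightarrow> int) \<Rightarrow> nat \<Rightarrow> real" where
  "dcoord m = (\<lambda>i. if i < r then of_int (m (e i)) else 0)"

lemma eval_dot: "x \<in> ext N \<Longrightarrow> m \<in> dual N \<Longrightarrow> x m = dot r (dcoord m) (coord x)"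
  by (simp add: ext_expand dot_def coord_def dcoord_def mult.commute)

lemma coord_Rpow: "coord x \<in> Rpow r"
  by (simp add: coord_def Rpow_def)

lemma coord_inj: "x \<in> ext N \<Longrightarrow> y \<in> ext N \<Longrightarrow> coord x = coord y \<Longrightarrow> x = y"
  by (rule ext_eqI) (auto simp: coord_def fun_eq_iff split: if_splits)

lemma coord_surj:
  assumes "\<xi> \<in> Rpow r"
  shows "\<exists>x\<in>ext N. coord x = \<xi>"
proof -
  define x where "x = (\<lambda>m. if m \<in> dual N then \<Sum>i<r. \<xi> i * of_int (m (e i)) else 0)"
  have "x \<in> ext N"
    using subgrp_add[OF subgrp_dual, of _ N]
    by (auto simp: ext_def Homs_def x_def algebra_simps sum.distrib)
  moreover have "coord x = \<xi>"
  proof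
    fix i
    show "coord x i = \<xi> i"
    proof (cases "i < r")
      case True
      have "(\<Sum>j<r. \<xi> j * of_int (d i (e j))) = (\<Sum>j<r. if j = i then \<xi> j else 0)"
        using True by (intro sum.cong) (auto simp: d_e)
      then show ?thesis using True by (simp add: coord_def x_def d_in)
    qed (use assms in \<open>simp add: coord_def Rpow_def\<close>)
  qed
  ultimately show ?thesis by blast
qed

lemma dcoord_Lpow: "dcoord m \<in> Lpow r"
  by (simp add: dcoord_def Lpow_def Rpow_def)

lemma dcoord_inj: "inj_on dcoord (dual N)"
proof (rule inj_onI)
  fix m m' assume m: "m \<in> dual N" "m' \<in> dual N" and eq: "dcoord m = dcoord m'"
  have "m (e i) = m' (e i)" if "i < r" for i
    using fun_cong[OF eq, of i] that by (simp add: dcoord_def)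
  then show "m = m'" using dual_eq[OF m(1)] dual_eq[OF m(2)] by simp
qed

lemma dcoord_surj:
  assumes "b \<in> Lpow r"
  shows "b \<in> dcoord ` dual N"
proof -
  \<comment> \<open>The floors only turn integral reals into integers.\<close>
  define m where "m = (\<lambda>y. \<Sum>i<r. \<lfloor>b i\<rfloor> * d i y)"
  have "m \<in> dual N" unfolding m_def by (intro dual_sum) (auto simp: d_in)
  moreover have "dcoord m = b"
  proof
    fix j
    show "dcoord m j = b j"
    proof (cases "j < r")
      case True
      have "(\<Sum>i<r. \<lfloor>b i\<rfloor> * d i (e j)) = (\<Sum>i<r. if i = j then \<lfloor>b i\<rfloor> else 0)"
        using True by (intro sum.cong) (auto simp: d_e)
      then show ?thesis using True assms by (simp add: dcoord_def m_def Lpow_def)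
    qed (use assms in \<open>simp add: dcoord_def Lpow_def Rpow_def\<close>)
  qed
  ultimately show ?thesis by blast
qed

lemma coord_tens: "n \<in> N \<Longrightarrow> coord (tens N n t) = (\<lambda>i. t * coord (tens N n 1) i)"
  by (simp add: coord_def tens_def d_in fun_eq_iff)

lemma coord_tens_Lpow: "n \<in> N \<Longrightarrow> coord (tens N n 1) \<in> Lpow r"
  by (simp add: coord_def tens_def d_in Lpow_def Rpow_def)

lemma coord_tens_surj:
  assumes "b \<in> Lpow r"
  shows "b \<in> (\<lambda>n. coord (tens N n 1)) ` N"
proof -
  obtain y where "y \<in> N" "\<forall>i<r. d i y = \<lfloor>b i\<rfloor>" using realize[of "\<lambda>i. \<lfloor>b i\<rfloor>"] by blast
  moreover from this have "coord (tens N y 1) = b"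
    using assms by (auto simp: coord_def tens_def d_in Lpow_def Rpow_def fun_eq_iff)
  ultimately show ?thesis by blast
qed

lemma coord_gcone:
  assumes A: "finite A" "A \<subseteq> N"
  shows "coord ` gcone N A = conic ((\<lambda>a. coord (tens N a 1)) ` A)"
proof (intro equalityI subsetI)
  fix \<xi> assume "\<xi> \<in> coord ` gcone N A"
  then obtain \<rho> where \<rho>: "\<xi> = coord (\<Sum>n\<in>A. tens N n (\<rho> n))" "\<forall>n\<in>A. 0 \<le> \<rho> n"
    by (auto simp: gcone_def)
  have "\<xi> = (\<lambda>i. \<Sum>n\<in>A. coord (tens N n (\<rho> n)) i)"
    unfolding \<rho>(1) by (auto simp: coord_def sum_fun_apply)
  also have "\<dots> = (\<lambda>i. \<Sum>n\<in>A. (\<lambda>i. \<rho> n * coord (tens N n 1) i) i)"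
    using A(2) by (intro ext sum.cong refl) (metis coord_tens subsetD)
  also have "\<dots> \<in> conic ((\<lambda>a. coord (tens N a 1)) ` A)"
  proof (rule conic_sum[OF A(1)])
    fix n assume "n \<in> A"
    then show "(\<lambda>i. \<rho> n * coord (tens N n 1) i) \<in> conic ((\<lambda>a. coord (tens N a 1)) ` A)"
      using \<rho>(2) by (intro conic_scale conic_gen) auto
  qed
  finally show "\<xi> \<in> conic ((\<lambda>a. coord (tens N a 1)) ` A)" .
next
  fix \<xi> assume "\<xi> \<in> conic ((\<lambda>a. coord (tens N a 1)) ` A)"
  then show "\<xi> \<in> coord ` gcone N A"
  proof (induction rule: conic.induct)
    case conic_zero
    have "coord 0 = (\<lambda>_. 0)" by (simp add: coord_def fun_eq_iff)
    then show ?case using gcone_zero[of N A] by (metis imageI)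
  next
    case (conic_step \<xi> g t)
    then obtain x a where x: "x \<in> gcone N A" "\<xi> = coord x" and a: "a \<in> A" "g = coord (tens N a 1)" by blast
    have "coord (tens N a t) = (\<lambda>i. t * coord (tens N a 1) i)"
      using a(1) A(2) by (intro coord_tens) blast
    then have "(\<lambda>i. \<xi> i + t * g i) = coord (x + tens N a t)"
      unfolding x(2) a(2) by (auto simp: coord_def fun_eq_iff split: if_splits)
    then show ?case using gcone_step[OF A(1) x(1) a(1) conic_step(3)] by simp
  qed
qed

lemma gcone_iff_coord:
  assumes "finite A" "A \<subseteq> N"
  shows "x \<in> gcone N A \<longleftrightarrow> x \<in> ext N \<and> coord x \<in> conic ((\<lambda>a. coord (tens N a 1)) ` A)"
proof -
  have "x \<in> gcone N A" if x: "x \<in> ext N" and im: "coord x \<in> coord ` gcone N A"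
  proof -
    obtain y where y: "y \<in> gcone N A" "coord x = coord y" using im by blast
    then have "x = y" using coord_inj x gcone_subset_ext[OF assms(2)] by blast
    then show ?thesis using y(1) by simp
  qed
  then show ?thesis
    unfolding coord_gcone[OF assms, symmetric] using gcone_subset_ext[OF assms(2)] by blast
qed

lemma hcone_iff_coord:
  assumes "B \<subseteq> dual N"
  shows "x \<in> hcone N B \<longleftrightarrow> x \<in> ext N \<and> coord x \<in> {\<xi>\<in>Rpow r. \<forall>b\<in>dcoord ` B. 0 \<le> dot r b \<xi>}"
  using assms coord_Rpow by (auto simp: hcone_def eval_dot subset_iff)

text \<open>Minkowski's theorem in coordinates. The inequalities it provides are integral, hence by
  \<open>dcoord_surj\<close> they are coordinates of forms in \<open>dual N\<close>.\<close>

lemma gcone_is_hcone: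
  assumes A: "finite A" "A \<subseteq> N"
  shows "\<exists>B. finite B \<and> B \<subseteq> dual N \<and> gcone N A = hcone N B"
proof -
  have "finite ((\<lambda>a. coord (tens N a 1)) ` A)" "(\<lambda>a. coord (tens N a 1)) ` A \<subseteq> Lpow r"
    using A coord_tens_Lpow by auto
  from minkowski[OF this] obtain B' where B': "finite B'" "B' \<subseteq> Lpow r"
    "conic ((\<lambda>a. coord (tens N a 1)) ` A) = {x \<in> Rpow r. \<forall>b\<in>B'. 0 \<le> dot r b x}" by blast
  have "B' \<subseteq> dcoord ` dual N" using B'(2) dcoord_surj by blast
  then obtain B where B: "B \<subseteq> dual N" "finite B" "B' = dcoord ` B"
    using finite_subset_image[OF B'(1)] by metis
  have "gcone N A = hcone N B"
    by (rule Set.set_eqI) (simp only: gcone_iff_coord[OF A] hcone_iff_coord[OF B(1)] B'(3) B(3))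
  then show ?thesis using B by blast
qed

text \<open>Weyl's theorem in coordinates; the integral generators come from \<open>N\<close> by
  \<open>coord_tens_surj\<close>.\<close>

lemma hcone_is_gcone:
  assumes B: "finite B" "B \<subseteq> dual N"
  shows "\<exists>A. finite A \<and> A \<subseteq> N \<and> hcone N B = gcone N A"
proof -
  have "finite (dcoord ` B)" "dcoord ` B \<subseteq> Lpow r" using B dcoord_Lpow by auto
  from weyl_farkas[OF this] obtain A' where A': "finite A'" "A' \<subseteq> Lpow r"
    "{x \<in> Rpow r. \<forall>b\<in>dcoord ` B. 0 \<le> dot r b x} = conic A'" by blast
  have "A' \<subseteq> (\<lambda>n. coord (tens N n 1)) ` N" using A'(2) coord_tens_surj by blast
  then obtain A where A: "A \<subseteq> N" "finite A" "A' = (\<lambda>n. coord (tens N n 1)) ` A"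
    using finite_subset_image[OF A'(1)] by metis
  have "hcone N B = gcone N A"
    by (rule Set.set_eqI) (simp only: gcone_iff_coord[OF A(2,1)] hcone_iff_coord[OF B(2)] A'(3) A(3))
  then show ?thesis using A by blast
qed

text \<open>A \<open>linear_form\<close> is constrained on \<open>ext N\<close> only, so
  \<open>u\<close> is evaluated through the expansion of \<open>x\<close> in the tensors of the
  basis \<open>e\<close>.\<close>

lemma linear_form_dot:
  assumes u: "linear_form N u" and x: "x \<in> ext N"
  shows "u x = dot r (\<lambda>i. if i < r then u (tens N (e i) 1) else 0) (coord x)"
proof -
  have t: "tens N (e i) (1::real) \<in> ext N" "scale (x (d i)) (tens N (e i) 1) \<in> ext N"
      "scale (x (d i)) (tens N (e i) 1) = tens N (e i) (x (d i))" if "i < r" for i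
  proof -
    show 1: "scale (x (d i)) (tens N (e i) 1) = tens N (e i) (x (d i))"
      by (simp add: scale_def tens_def fun_eq_iff)
    show "tens N (e i) (1::real) \<in> ext N" by (intro tens_in_ext e_in that)
    show "scale (x (d i)) (tens N (e i) 1) \<in> ext N" unfolding 1 by (intro tens_in_ext e_in that)
  qed
  have "x = (\<Sum>i<r. scale (x (d i)) (tens N (e i) 1))"
  proof (rule ext_eqI[OF x])
    show "(\<Sum>i<r. scale (x (d i)) (tens N (e i) 1)) \<in> ext N"
      using t(2) by (intro sum_in_subgrp[OF subgrp_ext]) auto
    fix i assume i: "i < r"
    have "(\<Sum>j<r. scale (x (d j)) (tens N (e j) 1) (d i)) = (\<Sum>j<r. if j = i then x (d j) else 0)"
      using i by (intro sum.cong) (auto simp: scale_def tens_def d_in d_e)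
    then show "x (d i) = (\<Sum>i<r. scale (x (d i)) (tens N (e i) 1)) (d i)"
      using i by (simp add: sum_fun_apply)
  qed
  then have "u x = u (\<Sum>i<r. scale (x (d i)) (tens N (e i) 1))" by simp
  also have "\<dots> = (\<Sum>i<r. u (scale (x (d i)) (tens N (e i) 1)))"
    by (rule linear_form_sum[OF u]) (use t(2) in auto)
  also have "\<dots> = (\<Sum>i<r. x (d i) * u (tens N (e i) 1))"
    using u t(1) by (intro sum.cong) (auto simp: linear_form_def)
  finally show ?thesis by (simp add: dot_def coord_def mult.commute)
qed

lemma farkas_basis:
  assumes B: "finite B" "B \<subseteq> dual N" and u: "linear_form N u"
    and pos: "\<And>x. x \<in> hcone N B \<Longrightarrow> 0 \<le> u x"
  shows "\<exists>\<rho>. (\<forall>m\<in>B. 0 \<le> \<rho> m) \<and> (\<forall>x\<in>ext N. u x = (\<Sum>m\<in>B. \<rho> m * x m))"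
proof -
  define v where "v = (\<lambda>i. if i < r then u (tens N (e i) 1) else 0)"
  have uv: "u x = dot r v (coord x)" if "x \<in> ext N" for x
    unfolding v_def by (rule linear_form_dot[OF u that])
  have fin: "finite (dcoord ` B)" and sub: "dcoord ` B \<subseteq> Lpow r" using B dcoord_Lpow by auto
  have "0 \<le> dot r v \<xi>" if \<xi>: "\<xi> \<in> Rpow r" "\<forall>b\<in>dcoord ` B. 0 \<le> dot r b \<xi>" for \<xi>
  proof -
    obtain x where x: "x \<in> ext N" "coord x = \<xi>" using coord_surj[OF \<xi>(1)] by blast
    then have "x \<in> hcone N B" unfolding hcone_iff_coord[OF B(2)] using \<xi> by blast
    then show ?thesis using pos uv x by metis
  qed
  moreover have "v \<in> Rpow r" by (simp add: v_def Rpow_def)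
  ultimately have "v \<in> conic (dcoord ` B)" using weyl_farkas[OF fin sub] by blast
  then obtain \<rho> where \<rho>: "\<forall>g\<in>dcoord ` B. 0 \<le> \<rho> g" "v = (\<lambda>i. \<Sum>g\<in>dcoord ` B. \<rho> g * g i)"
    using conic_finite_iff[OF fin] by blast
  \<comment> \<open>Farkas' lemma gives weights for coordinate vectors; injectivity of
    \<open>dcoord\<close> turns them into weights for the forms in \<open>B\<close>.\<close>
  have inj: "inj_on dcoord B" using dcoord_inj B(2) inj_on_subset by blast
  have "u x = (\<Sum>m\<in>B. \<rho> (dcoord m) * x m)" if x: "x \<in> ext N" for x
  proof -
    have "u x = dot r (coord x) (\<lambda>i. \<Sum>m\<in>B. \<rho> (dcoord m) * dcoord m i)"
      unfolding uv[OF x] \<rho>(2) by (simp add: dot_commute sum.reindex[OF inj])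
    also have "\<dots> = (\<Sum>m\<in>B. \<rho> (dcoord m) * dot r (coord x) (dcoord m))"
      by (simp add: linfun_sum[OF linfun_dot B(1)] linfun_scale[OF linfun_dot])
    also have "\<dots> = (\<Sum>m\<in>B. \<rho> (dcoord m) * x m)"
      using B(2) x by (intro sum.cong) (auto simp: eval_dot dot_commute)
    finally show ?thesis .
  qed
  then show ?thesis using \<rho>(1) by (intro exI[of _ "\<lambda>m. \<rho> (dcoord m)"]) auto
qed

end

lemma hcone_to_gcone:
  assumes "is_lattice N" "finite B" "B \<subseteq> dual N"
  obtains A where "finite A" "A \<subseteq> N" "hcone N B = gcone N A"
proof -
  obtain r e d where "lattice_basis N r e d" using lattice_basis_exists[OF assms(1)] by blast
  then show thesis using lattice_basis.hcone_is_gcone[OF _ assms(2,3)] that by blast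
qed

lemma sc_rational_cone_hcone:
  assumes "is_lattice N" "sc_rational_cone N \<sigma>"
  obtains B where "finite B" "B \<subseteq> dual N" "\<sigma> = hcone N B"
proof -
  obtain r e d where "lattice_basis N r e d" using lattice_basis_exists[OF assms(1)] by blast
  moreover obtain A where "finite A" "A \<subseteq> N" "\<sigma> = gcone N A"
    using assms(2) by (auto simp: sc_rational_cone_def gcone_def)
  ultimately show thesis using lattice_basis.gcone_is_hcone[of N r e d A] that by metis
qed

text \<open>Weyl's theorem makes finitely many integral inequalities as good as generators.\<close>

lemma sc_rational_coneI:
  assumes "is_lattice N" "finite B" "B \<subseteq> dual N" "\<sigma> = hcone N B"
    "\<And>x. x \<in> \<sigma> \<Longrightarrow> - x \<in> \<sigma> \<Longrightarrow> x = 0"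
  shows "sc_rational_cone N \<sigma>"
proof -
  obtain A where "finite A" "A \<subseteq> N" "\<sigma> = gcone N A"
    using hcone_to_gcone[OF assms(1-3)] assms(4) by metis
  then show ?thesis unfolding sc_rational_cone_def gcone_def[symmetric] using assms(5)
    by (intro conjI exI[of _ A]) auto
qed

lemma farkas:
  assumes "is_lattice N" "finite B" "B \<subseteq> dual N" "linear_form N u"
    and "\<And>x. x \<in> hcone N B \<Longrightarrow> 0 \<le> u x"
  obtains \<rho> where "\<And>m. m \<in> B \<Longrightarrow> 0 \<le> \<rho> m" "\<And>x. x \<in> ext N \<Longrightarrow> u x = (\<Sum>m\<in>B. \<rho> m * x m)"
proof -
  obtain r e d where "lattice_basis N r e d" using lattice_basis_exists[OF assms(1)] by blast
  then show thesis using lattice_basis.farkas_basis[OF _ assms(2-5)] that by blast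
qed

section \<open>Monomial ideals\<close>

text \<open>For \<open>B \<subseteq> S\<close> these are the exponents of the monomials in the ideal
  generated by \<open>B\<close>; \<open>m - b \<in> S\<close> is divisibility of monomials.\<close>

definition up_closure :: "'m::ab_group_add set \<Rightarrow> 'm set \<Rightarrow> 'm set" where
  "up_closure S B = {m. \<exists>b\<in>B. m - b \<in> S}"

locale submonoid =
  fixes S :: "'m::ab_group_add set"
  assumes zero: "0 \<in> S" and add: "x \<in> S \<Longrightarrow> y \<in> S \<Longrightarrow> x + y \<in> S"
begin

abbreviation "R \<equiv> monoid_algebra S"

lemma cring_R: "cring R"
  using zero add by (rule monoid_algebra_cring)

lemma ring_R: "ring R"
  using cring_R by (simp add: cring_def)

lemma R_simps [simp]:
  "p \<in> carrier R \<longleftrightarrow> Poly_Mapping.keys p \<subseteq> S"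
  "p \<oplus>\<^bsub>R\<^esub> q = p + q" "p \<otimes>\<^bsub>R\<^esub> q = p * q" "\<zero>\<^bsub>R\<^esub> = 0" "\<one>\<^bsub>R\<^esub> = 1"
  by (simp_all add: monoid_algebra_def)

lemma up_closure_add: "m \<in> up_closure S B \<Longrightarrow> s \<in> S \<Longrightarrow> m + s \<in> up_closure S B"
  using add by (fastforce simp: up_closure_def add_diff_eq algebra_simps)

lemma up_closure_self: "b \<in> B \<Longrightarrow> b \<in> up_closure S B"
  unfolding up_closure_def using zero by (intro CollectI bexI[of _ b]) auto

lemma up_closure_subset: "B \<subseteq> S \<Longrightarrow> up_closure S B \<subseteq> S"
proof
  fix m assume B: "B \<subseteq> S" and "m \<in> up_closure S B"
  then obtain b where "b \<in> B" "m - b \<in> S" by (auto simp: up_closure_def)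
  then show "m \<in> S" using add[of b "m - b"] B by auto
qed

lemma up_closure_mono: "B \<subseteq> up_closure S E \<Longrightarrow> up_closure S B \<subseteq> up_closure S E"
proof
  fix m assume B: "B \<subseteq> up_closure S E" and "m \<in> up_closure S B"
  then obtain b where "b \<in> B" "m - b \<in> S" by (auto simp: up_closure_def)
  then show "m \<in> up_closure S E" using up_closure_add[of b E "m - b"] B by auto
qed

lemma monom_carrier: "B \<subseteq> S \<Longrightarrow> monom ` B \<subseteq> carrier R"
  by (auto simp: monom_def)

lemma ideal_keys_up_closure:
  assumes "B \<subseteq> S"
  shows "ideal {p. Poly_Mapping.keys p \<subseteq> up_closure S B} R" (is "ideal ?I R")
proof (rule idealI[OF ring_R])
  interpret ring R by (rule ring_R)
  have sub: "?I \<subseteq> carrier R" using up_closure_subset[OF assms] by auto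
  show "subgroup ?I (add_monoid R)"
  proof
    show "?I \<subseteq> carrier (add_monoid R)" using sub by simp
  next
    fix p q assume "p \<in> ?I" "q \<in> ?I"
    then show "p \<otimes>\<^bsub>add_monoid R\<^esub> q \<in> ?I"
      using Poly_Mapping.keys_add[of p q] by auto
  next
    fix p assume p: "p \<in> ?I"
    then have "p \<in> carrier R" using sub by blast
    then have "\<ominus>\<^bsub>R\<^esub> p = - p" by (intro minus_equality) auto
    then show "inv\<^bsub>add_monoid R\<^esub> p \<in> ?I" using p by (simp add: a_inv_def)
  qed auto
  have *: "q * p \<in> ?I" if p: "p \<in> ?I" and q: "q \<in> carrier R" for p q
  proof
    have "k \<in> up_closure S B" if k: "k \<in> Poly_Mapping.keys (q * p)" for k
    proof -
      obtain s m where "k = m + s" "s \<in> Poly_Mapping.keys q" "m \<in> Poly_Mapping.keys p"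
        using Poly_Mapping.keys_mult[of q p] k add.commute by fast
      then show ?thesis using p q by (auto intro!: up_closure_add)
    qed
    then show "Poly_Mapping.keys (q * p) \<subseteq> up_closure S B" by blast
  qed
  fix p q assume "p \<in> ?I" "q \<in> carrier R"
  then show "q \<otimes>\<^bsub>R\<^esub> p \<in> ?I" "p \<otimes>\<^bsub>R\<^esub> q \<in> ?I" using * by (auto simp: mult.commute)
qed

lemma ideal_monomial_ideal: "B \<subseteq> S \<Longrightarrow> ideal (monomial_ideal S B) R"
  unfolding monomial_ideal_def by (rule ring.genideal_ideal[OF ring_R monom_carrier])

text \<open>Polynomials supported in the up-closure form an ideal, which gives one inclusion;
  conversely each monomial of such a polynomial is a multiple of a generator.\<close>

lemma monomial_ideal_eq:
  assumes B: "B \<subseteq> S"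
  shows "monomial_ideal S B = {p. Poly_Mapping.keys p \<subseteq> up_closure S B}"
proof
  have "monom ` B \<subseteq> {p. Poly_Mapping.keys p \<subseteq> up_closure S B}"
    using up_closure_self by (auto simp: monom_def)
  then show "monomial_ideal S B \<subseteq> {p. Poly_Mapping.keys p \<subseteq> up_closure S B}"
    unfolding monomial_ideal_def by (rule ring.genideal_minimal[OF ring_R ideal_keys_up_closure[OF B]])
next
  interpret I: ideal "monomial_ideal S B" R by (rule ideal_monomial_ideal[OF B])
  have single: "Poly_Mapping.single k c \<in> monomial_ideal S B" if k: "k \<in> up_closure S B" for k c
  proof -
    obtain b where b: "b \<in> B" "k - b \<in> S" using k by (auto simp: up_closure_def)
    then have "monom b \<in> monomial_ideal S B"
      unfolding monomial_ideal_def using ring.genideal_self[OF ring_R monom_carrier[OF B]] by blast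
    moreover have "Poly_Mapping.single (k - b) c \<in> carrier R" using b by auto
    ultimately have "Poly_Mapping.single (k - b) c * monom b \<in> monomial_ideal S B"
      using I.I_l_closed by (metis R_simps(3))
    then show ?thesis by (simp add: monom_def mult_single)
  qed
  have "p \<in> monomial_ideal S B" if "Poly_Mapping.keys p \<subseteq> up_closure S B" for p
    using that
  proof (induction "card (Poly_Mapping.keys p)" arbitrary: p)
    case 0
    then have "p = \<zero>\<^bsub>R\<^esub>" by simp
    then show ?case using additive_subgroup.zero_closed[OF I.additive_subgroup_axioms] by (simp only:)
  next
    case (Suc n)
    then obtain k where k: "k \<in> Poly_Mapping.keys p" by fastforce
    define q where "q = p - Poly_Mapping.single k (Poly_Mapping.lookup p k)"
    have "Poly_Mapping.keys q = Poly_Mapping.keys p - {k}"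
      by (auto simp: q_def in_keys_iff lookup_minus lookup_single when_def split: if_splits)
    then have "q \<in> monomial_ideal S B"
      using Suc k by (intro Suc.hyps(1)) (auto simp: card_Diff_singleton)
    moreover have "Poly_Mapping.single k (Poly_Mapping.lookup p k) \<in> monomial_ideal S B"
      using single Suc.prems k by blast
    ultimately have "q + Poly_Mapping.single k (Poly_Mapping.lookup p k) \<in> monomial_ideal S B"
      using additive_subgroup.a_closed[OF I.additive_subgroup_axioms] by (metis R_simps(2))
    then show ?case by (simp add: q_def)
  qed
  then show "{p. Poly_Mapping.keys p \<subseteq> up_closure S B} \<subseteq> monomial_ideal S B" by blast
qed

lemma monom_in_monomial_ideal: "B \<subseteq> S \<Longrightarrow> monom m \<in> monomial_ideal S B \<longleftrightarrow> m \<in> up_closure S B"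
  by (simp add: monomial_ideal_eq monom_def)

lemma monomial_ideal_eq_iff:
  assumes "B \<subseteq> S" "B' \<subseteq> S"
  shows "monomial_ideal S B = monomial_ideal S B' \<longleftrightarrow> up_closure S B = up_closure S B'"
proof
  assume "monomial_ideal S B = monomial_ideal S B'"
  then have "m \<in> up_closure S B \<longleftrightarrow> m \<in> up_closure S B'" for m
    unfolding monom_in_monomial_ideal[OF assms(1), symmetric] monom_in_monomial_ideal[OF assms(2), symmetric]
    by simp
  then show "up_closure S B = up_closure S B'" by blast
qed (simp add: monomial_ideal_eq assms)

text \<open>This merges the two summands of \<open>J\<^sup>\<sigma>\<close> into one ideal with a
  single generating set.\<close>

lemma monomial_ideal_Un:
  assumes "A \<subseteq> S" "B \<subseteq> S"
  shows "monomial_ideal S A <+>\<^bsub>R\<^esub> monomial_ideal S B = monomial_ideal S (A \<union> B)"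
proof
  interpret ring R by (rule ring_R)
  interpret A: ideal "monomial_ideal S A" R by (rule ideal_monomial_ideal[OF assms(1)])
  interpret B: ideal "monomial_ideal S B" R by (rule ideal_monomial_ideal[OF assms(2)])
  have AB: "A \<union> B \<subseteq> S" using assms by blast
  have "m + 0 \<in> monomial_ideal S A <+>\<^bsub>R\<^esub> monomial_ideal S B" if "m \<in> monomial_ideal S A" for m
    unfolding set_add_def' using that additive_subgroup.zero_closed[OF B.additive_subgroup_axioms] by (intro UN_I[of m] UN_I[of 0]) auto
  moreover have "0 + m \<in> monomial_ideal S A <+>\<^bsub>R\<^esub> monomial_ideal S B" if "m \<in> monomial_ideal S B" for m
    unfolding set_add_def' using that additive_subgroup.zero_closed[OF A.additive_subgroup_axioms] by (intro UN_I[of m] UN_I[of 0]) auto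
  moreover have "monom m \<in> monomial_ideal S A" if "m \<in> A" for m
    using monom_in_monomial_ideal[OF assms(1)] up_closure_self[OF that] by blast
  moreover have "monom m \<in> monomial_ideal S B" if "m \<in> B" for m
    using monom_in_monomial_ideal[OF assms(2)] up_closure_self[OF that] by blast
  ultimately have "monom ` (A \<union> B) \<subseteq> monomial_ideal S A <+>\<^bsub>R\<^esub> monomial_ideal S B" by auto
  then show "monomial_ideal S (A \<union> B) \<subseteq> monomial_ideal S A <+>\<^bsub>R\<^esub> monomial_ideal S B"
    unfolding monomial_ideal_def[of S "A \<union> B"]
    by (intro genideal_minimal add_ideals A.ideal_axioms B.ideal_axioms)
  have "up_closure S A \<subseteq> up_closure S (A \<union> B)" "up_closure S B \<subseteq> up_closure S (A \<union> B)"
    by (auto simp: up_closure_def)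
  then have "p + q \<in> monomial_ideal S (A \<union> B)" if "p \<in> monomial_ideal S A" "q \<in> monomial_ideal S B" for p q
    using that Poly_Mapping.keys_add[of p q]
    unfolding monomial_ideal_eq[OF assms(1)] monomial_ideal_eq[OF assms(2)] monomial_ideal_eq[OF AB] by blast
  then show "monomial_ideal S A <+>\<^bsub>R\<^esub> monomial_ideal S B \<subseteq> monomial_ideal S (A \<union> B)"
    unfolding set_add_def' by auto
qed

lemma minimal_monomial_generators_iff:
  assumes E: "E \<subseteq> S"
  shows "is_minimal_monomial_generators S (monomial_ideal S E) B \<longleftrightarrow>
    B \<subseteq> S \<and> up_closure S B = up_closure S E \<and> (\<forall>a\<in>B. \<forall>b\<in>B. b - a \<in> S \<longrightarrow> a = b)"
proof (intro iffI conjI ballI impI)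
  assume min: "is_minimal_monomial_generators S (monomial_ideal S E) B"
  then show BS: "B \<subseteq> S" by (simp add: is_minimal_monomial_generators_def)
  show up: "up_closure S B = up_closure S E"
    using min monomial_ideal_eq_iff[OF BS E] by (simp add: is_minimal_monomial_generators_def)
  fix a b assume ab: "a \<in> B" "b \<in> B" "b - a \<in> S"
  show "a = b"
  proof (rule ccontr)
    assume "a \<noteq> b"
    have "x \<in> up_closure S (B - {b})" if "x \<in> B" for x
    proof (cases "x = b")
      case True
      then show ?thesis using ab \<open>a \<noteq> b\<close> by (auto simp: up_closure_def)
    next
      case False
      then show ?thesis using that by (intro up_closure_self) blast
    qed
    then have "B \<subseteq> up_closure S (B - {b})" by blast
    moreover have "B - {b} \<subseteq> up_closure S B" using up_closure_self by blast
    ultimately have "up_closure S (B - {b}) = up_closure S B"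
      using up_closure_mono by (intro equalityI) auto
    then have "monomial_ideal S (B - {b}) = monomial_ideal S E"
      using monomial_ideal_eq_iff[of "B - {b}" E] BS E up by blast
    moreover have "B - {b} \<subset> B" using ab by blast
    ultimately show False using min by (auto simp: is_minimal_monomial_generators_def)
  qed
next
  assume B: "B \<subseteq> S \<and> up_closure S B = up_closure S E \<and> (\<forall>a\<in>B. \<forall>b\<in>B. b - a \<in> S \<longrightarrow> a = b)"
  have "monomial_ideal S B' \<noteq> monomial_ideal S E" if B': "B' \<subset> B" for B'
  proof
    assume "monomial_ideal S B' = monomial_ideal S E"
    then have up: "up_closure S B' = up_closure S B" using monomial_ideal_eq_iff[of B' E] B B' E by blast
    obtain b where b: "b \<in> B" "b \<notin> B'" using B' by blast
    then have "b \<in> up_closure S B'" using up up_closure_self by blast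
    then obtain b' where "b' \<in> B'" "b - b' \<in> S" by (auto simp: up_closure_def)
    then show False using b B B' by blast
  qed
  moreover have "monomial_ideal S B = monomial_ideal S E" using monomial_ideal_eq_iff[of B E] B E by blast
  ultimately show "is_minimal_monomial_generators S (monomial_ideal S E) B"
    using B by (simp add: is_minimal_monomial_generators_def)
qed

text \<open>Divisibility is only a preorder, so one minimal element is chosen from each class modulo units.\<close>

lemma minimal_monomial_generators_exist:
  fixes \<rho> :: "'m \<Rightarrow> nat"
  assumes E: "E \<subseteq> S"
    and rank: "\<And>a b. a \<in> S \<Longrightarrow> b \<in> S \<Longrightarrow> b - a \<in> S \<Longrightarrow> a - b \<notin> S \<Longrightarrow> \<rho> a < \<rho> b"
  shows "\<exists>B. is_minimal_monomial_generators S (monomial_ideal S E) B"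
proof -
  define E0 where "E0 = {m\<in>E. \<forall>e\<in>E. m - e \<in> S \<longrightarrow> e - m \<in> S}"
  have trans: "z - x \<in> S" if "y - x \<in> S" "z - y \<in> S" for x y z
    using add[OF that] by simp
  have below: "\<exists>m\<in>E0. e - m \<in> S" if "e \<in> E" for e
    using that
  \<comment> \<open>Strict divisors have smaller rank, so the descent to a minimal element of
    \<open>E\<close> ends.\<close>
  proof (induction "\<rho> e" arbitrary: e rule: less_induct)
    case less
    show ?case
    proof (cases "e \<in> E0")
      case True
      then show ?thesis using zero by (intro bexI[of _ e]) auto
    next
      case False
      then obtain e' where e': "e' \<in> E" "e - e' \<in> S" "e' - e \<notin> S" using less.prems by (auto simp: E0_def)
      then have "\<rho> e' < \<rho> e" using rank E less.prems by blast
      then obtain m where "m \<in> E0" "e' - m \<in> S" using less.hyps e'(1) by blast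
      then show ?thesis using trans e'(2) by blast
    qed
  qed
  \<comment> \<open>The selecting predicate depends only on the class of \<open>m\<close> modulo
    units, so associated elements get the same representative.\<close>
  define rep where "rep = (\<lambda>m. SOME m'. m' \<in> E0 \<and> m' - m \<in> S \<and> m - m' \<in> S)"
  have rep: "rep m \<in> E0" "rep m - m \<in> S" "m - rep m \<in> S" if "m \<in> E0" for m
  proof -
    have "\<exists>m'. m' \<in> E0 \<and> m' - m \<in> S \<and> m - m' \<in> S" using that zero by (intro exI[of _ m]) auto
    from someI_ex[OF this] show "rep m \<in> E0" "rep m - m \<in> S" "m - rep m \<in> S"
      unfolding rep_def by blast+
  qed
  have rep_eq: "rep m = rep m'" if "m - m' \<in> S" "m' - m \<in> S" for m m'
  proof -
    have "(x - m \<in> S \<and> m - x \<in> S) = (x - m' \<in> S \<and> m' - x \<in> S)" for x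
      using trans that by blast
    then show ?thesis unfolding rep_def by simp
  qed
  have sub: "rep ` E0 \<subseteq> E" using rep(1) by (auto simp: E0_def)
  have "a = b" if "a \<in> rep ` E0" "b \<in> rep ` E0" "b - a \<in> S" for a b
  proof -
    obtain m m' where m: "a = rep m" "b = rep m'" "m \<in> E0" "m' \<in> E0" using \<open>a \<in> _\<close> \<open>b \<in> _\<close> by blast
    then have "m' - m \<in> S" using trans rep that(3) by metis
    moreover from this have "m - m' \<in> S" using m(3,4) by (auto simp: E0_def)
    ultimately show ?thesis using rep_eq m(1,2) by blast
  qed
  moreover have "up_closure S (rep ` E0) = up_closure S E"
  proof
    show "up_closure S (rep ` E0) \<subseteq> up_closure S E"
      using sub up_closure_self by (intro up_closure_mono) blast
    have "E \<subseteq> up_closure S (rep ` E0)"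
    proof
      fix e assume "e \<in> E"
      then obtain m where "m \<in> E0" "e - m \<in> S" using below by blast
      then have "rep m \<in> rep ` E0" "e - rep m \<in> S" using trans rep by blast+
      then show "e \<in> up_closure S (rep ` E0)" by (auto simp: up_closure_def)
    qed
    then show "up_closure S E \<subseteq> up_closure S (rep ` E0)" by (rule up_closure_mono)
  qed
  ultimately show ?thesis
    unfolding minimal_monomial_generators_iff[OF E] using sub E by (intro exI[of _ "rep ` E0"]) blast
qed

end

section \<open>Dickson's lemma, finiteness and existence of minimal generators\<close>

lemma nat_seq_mono_subseq:
  fixes s :: "nat \<Rightarrow> nat"
  obtains \<phi> :: "nat \<Rightarrow> nat" where "strict_mono \<phi>" "mono (\<lambda>n. s (\<phi> n))"
proof -
  obtain f where f: "strict_mono f" "monoseq (\<lambda>n. s (f n))" using seq_monosub[of s] by blast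
  show thesis
  proof (cases "incseq (\<lambda>n. s (f n))")
    case True
    then show thesis by (rule that[OF f(1)])
  next
    case False
    \<comment> \<open>A nonincreasing sequence of naturals is constant from a place
      \<open>n0\<close> on at which it is smallest.\<close>
    then have dec: "s (f n) \<le> s (f m)" if "m \<le> n" for m n
      using f(2) that by (auto simp: monoseq_iff decseq_def)
    obtain n0 where n0: "\<And>n. s (f n0) \<le> s (f n)"
      using ex_has_least_nat[of "\<lambda>_. True" 0 "\<lambda>n. s (f n)"] by blast
    have "s (f (n + n0)) = s (f n0)" for n using n0[of "n + n0"] dec[of n0 "n + n0"] by simp
    then have "mono (\<lambda>n. s (f (n + n0)))" by (simp add: mono_def)
    moreover have "strict_mono (\<lambda>n. f (n + n0))" using f(1) by (simp add: strict_mono_def)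
    ultimately show thesis using that by blast
  qed
qed

text \<open>The subsequence is refined once for each element of the finite set \<open>A\<close>;
  refining preserves the monotonicity already reached.\<close>

lemma dickson:
  fixes h :: "'x \<Rightarrow> nat \<Rightarrow> nat"
  assumes "finite A"
  shows "\<exists>\<phi> :: nat \<Rightarrow> nat. strict_mono \<phi> \<and> (\<forall>a\<in>A. mono (\<lambda>n. h a (\<phi> n)))"
  using assms
proof (induction A rule: finite_induct)
  case empty
  show ?case by (intro exI[of _ id]) (simp add: strict_mono_def)
next
  case (insert a A)
  from insert.IH obtain \<phi> :: "nat \<Rightarrow> nat"
    where \<phi>0: "strict_mono \<phi> \<and> (\<forall>b\<in>A. mono (\<lambda>n. h b (\<phi> n)))" by (rule exE)
  then have \<phi>: "strict_mono \<phi>" "\<And>b. b \<in> A \<Longrightarrow> mono (\<lambda>n. h b (\<phi> n))" by simp_all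
  obtain \<psi> :: "nat \<Rightarrow> nat" where \<psi>: "strict_mono \<psi>" "mono (\<lambda>n. h a (\<phi> (\<psi> n)))"
    by (rule nat_seq_mono_subseq[of "\<lambda>n. h a (\<phi> n)"])
  have "mono (\<lambda>n. h b (\<phi> (\<psi> n)))" if "b \<in> A" for b
  proof (rule monoI)
    fix x y :: nat assume "x \<le> y"
    then have "\<psi> x \<le> \<psi> y" using strict_mono_mono[OF \<psi>(1)] by (simp add: mono_def)
    then show "h b (\<phi> (\<psi> x)) \<le> h b (\<phi> (\<psi> y))" by (rule monoD[OF \<phi>(2)[OF that]])
  qed
  then have "\<forall>b\<in>insert a A. mono (\<lambda>n. h b (\<phi> (\<psi> n)))" using \<psi>(2) by blast
  moreover have "strict_mono (\<lambda>n. \<phi> (\<psi> n))" using \<phi>(1) \<psi>(1) by (simp add: strict_mono_def)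
  ultimately show ?case by (intro exI[of _ "\<lambda>n. \<phi> (\<psi> n)"] conjI)
qed

lemma dual_monoid_gcone:
  assumes "finite A" "A \<subseteq> N"
  shows "dual_monoid N (gcone N A) = {m \<in> dual N. \<forall>a\<in>A. 0 \<le> m a}"
proof (intro equalityI subsetI CollectI conjI ballI)
  fix m a assume m: "m \<in> dual_monoid N (gcone N A)" and a: "a \<in> A"
  then have "0 \<le> tens N a (1::real) m" using gcone_gen[OF assms(1) a, of N] unfolding dual_monoid_def by blast
  moreover have "m \<in> dual N" using m by (simp add: dual_monoid_def)
  ultimately show "0 \<le> m a" by (simp add: tens_def)
next
  fix m assume m: "m \<in> {m \<in> dual N. \<forall>a\<in>A. 0 \<le> m a}"
  have "0 \<le> x m" if "x \<in> gcone N A" for x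
    using that m by (auto simp: gcone_def sum_fun_apply tens_def intro!: sum_nonneg)
  then show "m \<in> dual_monoid N (gcone N A)" using m by (simp add: dual_monoid_def)
qed (auto simp: dual_monoid_def)

lemma sc_rational_cone_gcone:
  assumes "sc_rational_cone N \<sigma>"
  obtains A where "finite A" "A \<subseteq> N" "\<sigma> = gcone N A"
  using assms by (auto simp: sc_rational_cone_def gcone_def)

lemma submonoid_dual_monoid:
  assumes "\<sigma> \<subseteq> ext N"
  shows "submonoid (dual_monoid N \<sigma>)"
proof
  have "x 0 = 0" if "x \<in> \<sigma>" for x using assms that Homs_zero unfolding ext_def by blast
  then have "0 \<le> x 0" if "x \<in> \<sigma>" for x using that by (metis order_refl)
  then show "0 \<in> dual_monoid N \<sigma>" unfolding dual_monoid_def using subgrp_zero[OF subgrp_dual] by blast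
  fix m m' assume m: "m \<in> dual_monoid N \<sigma>" "m' \<in> dual_monoid N \<sigma>"
  have eq: "x (m + m') = x m + x m'" if "x \<in> \<sigma>" for x
    using assms that m by (intro ext_add[of x N]) (auto simp: dual_monoid_def)
  have "0 \<le> x (m + m')" if "x \<in> \<sigma>" for x
    using that m unfolding eq[OF that] by (simp add: dual_monoid_def)
  then show "m + m' \<in> dual_monoid N \<sigma>"
    using m subgrp_add[OF subgrp_dual] unfolding dual_monoid_def by blast
qed

text \<open>On generators \<open>A\<close> of \<open>\<sigma>\<close> the order of the dual monoid
  is the componentwise order of the values, which are natural numbers for members of the monoid.
  Dickson's lemma finds two comparable terms in any sequence of distinct elements of
  \<open>B\<close>.\<close>

lemma dual_monoid_antichain_finite:
  assumes \<sigma>: "sc_rational_cone N \<sigma>" and B: "B \<subseteq> dual_monoid N \<sigma>"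
    and anti: "\<And>a b. a \<in> B \<Longrightarrow> b \<in> B \<Longrightarrow> b - a \<in> dual_monoid N \<sigma> \<Longrightarrow> a = b"
  shows "finite B"
proof (rule ccontr)
  assume "infinite B"
  then obtain f :: "nat \<Rightarrow> _" where f: "inj f" "range f \<subseteq> B"
    using infinite_countable_subset by blast
  obtain A where A: "finite A" "A \<subseteq> N" "\<sigma> = gcone N A" by (rule sc_rational_cone_gcone[OF \<sigma>])
  obtain \<phi> :: "nat \<Rightarrow> nat" where \<phi>: "strict_mono \<phi>" "\<And>a. a \<in> A \<Longrightarrow> mono (\<lambda>n. nat (f (\<phi> n) a))"
    using dickson[OF A(1), of "\<lambda>a n. nat (f n a)"] by blast
  have nn: "0 \<le> f n a" "f n \<in> dual N" if "a \<in> A" for a n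
    using f(2) B that unfolding A(3) dual_monoid_gcone[OF A(1,2)] by blast+
  have "f (\<phi> 0) a \<le> f (\<phi> 1) a" if "a \<in> A" for a
  proof -
    have "nat (f (\<phi> 0) a) \<le> nat (f (\<phi> 1) a)" using \<phi>(2)[OF that] by (simp add: mono_def)
    then show ?thesis using nn[OF that] by (simp add: nat_le_eq_zle)
  qed
  moreover have "f n \<in> dual N" for n using f(2) B by (auto simp: dual_monoid_def)
  ultimately have "f (\<phi> 1) - f (\<phi> 0) \<in> dual_monoid N \<sigma>"
    unfolding A(3) dual_monoid_gcone[OF A(1,2)] by (simp add: subgrp_diff[OF subgrp_dual])
  then have "f (\<phi> 0) = f (\<phi> 1)" using anti f(2) by blast
  then have "\<phi> 0 = \<phi> 1" using f(1) by (simp add: inj_eq)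
  then show False using \<phi>(1) by (metis strict_monoD zero_less_one less_irrefl)
qed

lemma dual_monoid_minimal_generators_exist:
  assumes \<sigma>: "sc_rational_cone N \<sigma>" and E: "E \<subseteq> dual_monoid N \<sigma>"
  shows "\<exists>B. is_minimal_monomial_generators (dual_monoid N \<sigma>) (monomial_ideal (dual_monoid N \<sigma>) E) B"
proof -
  obtain A where A: "finite A" "A \<subseteq> N" "\<sigma> = gcone N A" by (rule sc_rational_cone_gcone[OF \<sigma>])
  interpret submonoid "dual_monoid N \<sigma>"
    by (rule submonoid_dual_monoid) (simp add: A(3) gcone_subset_ext[OF A(2)])
  note S = dual_monoid_gcone[OF A(1,2), folded A(3)]
  show ?thesis
  \<comment> \<open>The rank adds the values at the generators of \<open>\<sigma>\<close>: a strict
    divisor is smaller at some generator and larger at none.\<close>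
  proof (rule minimal_monomial_generators_exist[OF E, where \<rho> = "\<lambda>m. nat (\<Sum>a\<in>A. m a)"])
    fix m m' assume m: "m \<in> dual_monoid N \<sigma>" "m' \<in> dual_monoid N \<sigma>" 
      and le: "m' - m \<in> dual_monoid N \<sigma>" and nle: "m - m' \<notin> dual_monoid N \<sigma>"
    have d: "m - m' \<in> dual N" using m by (simp add: S subgrp_diff[OF subgrp_dual])
    have le': "m a \<le> m' a" if "a \<in> A" for a using le that by (auto simp: S)
    obtain a where a: "a \<in> A" "m a < m' a" using nle d by (auto simp: S not_le)
    have "(\<Sum>a\<in>A. m a) < (\<Sum>a\<in>A. m' a)" by (rule sum_strict_mono_ex1[OF A(1)]) (use le' a in auto)
    moreover have "0 \<le> (\<Sum>a\<in>A. m a)" using m by (intro sum_nonneg) (auto simp: S)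
    ultimately show "nat (\<Sum>a\<in>A. m a) < nat (\<Sum>a\<in>A. m' a)" by simp
  qed
qed

section \<open>Functoriality\<close>

lemma pullback_dual: "\<phi> \<in> Homs N N' \<Longrightarrow> m \<in> dual N' \<Longrightarrow> pullback \<phi> m \<in> dual N"
  unfolding pullback_def dual_def by (rule Homs_comp)

lemma pullback_add: "pullback \<phi> (m + m') = pullback \<phi> m + pullback \<phi> m'"
  and pullback_diff: "pullback \<phi> (m - m') = pullback \<phi> m - pullback \<phi> m'"
  by (auto simp: pullback_def)

lemma pullback_comp: "pullback \<phi> (pullback \<psi> m) = pullback (\<psi> \<circ> \<phi>) m"
  by (simp add: pullback_def o_assoc)

lemma ext_map_apply: "m \<in> dual N' \<Longrightarrow> ext_map N' \<phi> x m = x (pullback \<phi> m)"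
  by (simp add: ext_map_def)

lemma ext_map_ext:
  assumes "\<phi> \<in> Homs N N'" "x \<in> ext N"
  shows "ext_map N' \<phi> x \<in> ext N'"
  unfolding ext_def Homs_def
proof (intro CollectI conjI ballI allI impI)
  fix m m' assume m: "m \<in> dual N'" "m' \<in> dual N'"
  show "ext_map N' \<phi> x (m + m') = ext_map N' \<phi> x m + ext_map N' \<phi> x m'"
    unfolding ext_map_apply[OF subgrp_add[OF subgrp_dual m]] ext_map_apply[OF m(1)] ext_map_apply[OF m(2)] pullback_add
    by (rule ext_add[OF assms(2) pullback_dual[OF assms(1) m(1)] pullback_dual[OF assms(1) m(2)]])
qed (auto simp: ext_map_def)

lemma ext_map_comp:
  assumes "\<psi> \<in> Homs N' N''"
  shows "ext_map N'' \<psi> (ext_map N' \<phi> x) = ext_map N'' (\<psi> \<circ> \<phi>) x"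
  using pullback_dual[OF assms] by (auto simp: ext_map_def pullback_comp)

lemma ext_map_scale: "ext_map N' \<phi> (scale k x) = scale k (ext_map N' \<phi> x)"
  and ext_map_add: "ext_map N' \<phi> (x + y) = ext_map N' \<phi> x + ext_map N' \<phi> y"
  and ext_map_uminus: "ext_map N' \<phi> (- x) = - ext_map N' \<phi> (x :: _ \<Rightarrow> 'k::comm_ring_1)"
  and ext_map_0: "ext_map N' \<phi> 0 = 0"
  by (auto simp: ext_map_def scale_def)

lemma scale_scale: "scale k (scale l x) = scale (k * l) x"
  by (simp add: scale_def mult.assoc)

lemma scale_ext: "x \<in> ext N \<Longrightarrow> scale k x \<in> ext N"
  by (auto simp: ext_def Homs_def scale_def distrib_left)

lemma dual_monoid_pullback:
  assumes "\<phi> \<in> Homs N N'" "ext_map N' \<phi> ` \<rho> \<subseteq> \<sigma>" "m \<in> dual_monoid N' \<sigma>"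
  shows "pullback \<phi> m \<in> dual_monoid N \<rho>"
proof -
  have m: "m \<in> dual N'" using assms(3) by (simp add: dual_monoid_def)
  have "0 \<le> x (pullback \<phi> m)" if "x \<in> \<rho>" for x
    using assms(2,3) that unfolding ext_map_apply[OF m, symmetric] by (auto simp: dual_monoid_def)
  then show ?thesis using pullback_dual[OF assms(1) m] by (simp add: dual_monoid_def)
qed

lemma cone_le_pullback:
  assumes "\<phi> \<in> Homs N N'" "ext_map N' \<phi> ` \<rho> \<subseteq> \<sigma>" "cone_le N' \<sigma> m m'"
  shows "cone_le N \<rho> (pullback \<phi> m) (pullback \<phi> m')"
  using dual_monoid_pullback[OF assms(1,2)] assms(3) unfolding cone_le_def pullback_diff[symmetric] by blast

lemma dual_monoid_antimono: "\<sigma> \<subseteq> \<tau> \<Longrightarrow> dual_monoid N \<tau> \<subseteq> dual_monoid N \<sigma>"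
  by (auto simp: dual_monoid_def)

lemma cone_le_trans:
  assumes "\<sigma> \<subseteq> ext N" "cone_le N \<sigma> l m" "cone_le N \<sigma> m n"
  shows "cone_le N \<sigma> l n"
  using submonoid.add[OF submonoid_dual_monoid[OF assms(1)], of "m - l" "n - m"] assms(2,3)
  by (simp add: cone_le_def)

lemma cone_le_subset: "\<sigma> \<subseteq> \<tau> \<Longrightarrow> cone_le N \<tau> l m \<Longrightarrow> cone_le N \<sigma> l m"
  unfolding cone_le_def using dual_monoid_antimono by blast

lemma sc_rational_cone_ext: "sc_rational_cone N \<sigma> \<Longrightarrow> \<sigma> \<subseteq> ext N"
  using sc_rational_cone_gcone gcone_subset_ext by metis

section \<open>Faces\<close>

text \<open>The sum of the forms in \<open>C\<close> cuts out this face: its terms are nonnegative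
  on the cone, so it vanishes only where all of them do.\<close>

lemma face_hcone:
  assumes "C \<subseteq> B" "finite C"
  shows "face_of_cone N {x \<in> hcone N B. \<forall>m\<in>C. x m = 0} (hcone N B)"
proof -
  have nn: "0 \<le> x m" if "x \<in> hcone N B" "m \<in> C" for x m
    using that assms by (auto simp: hcone_def)
  have "linear_form N (\<lambda>x. \<Sum>m\<in>C. x m)"
    by (auto simp: linear_form_def sum.distrib scale_def sum_distrib_left)
  moreover have "(\<Sum>m\<in>C. x m) = 0 \<longleftrightarrow> (\<forall>m\<in>C. x m = 0)" if "x \<in> hcone N B" for x
    by (rule sum_nonneg_eq_0_iff[OF assms(2) nn[OF that]])
  ultimately show ?thesis unfolding face_of_cone_def
    using nn by (intro exI[of _ "\<lambda>x. \<Sum>m\<in>C. x m"] conjI ballI sum_nonneg) auto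
qed

text \<open>Farkas' lemma writes the form \<open>u\<close> of the face as a nonnegative combination
  of \<open>B\<close>; on the cone, \<open>u\<close> vanishes exactly where the forms of nonzero
  weight vanish.\<close>

lemma faces_of_hcone:
  assumes "is_lattice N" "finite B" "B \<subseteq> dual N" "face_of_cone N \<tau> (hcone N B)"
  obtains C where "C \<subseteq> B" "\<tau> = {x \<in> hcone N B. \<forall>m\<in>C. x m = 0}"
proof -
  obtain u where u: "linear_form N u" "\<And>x. x \<in> hcone N B \<Longrightarrow> 0 \<le> u x" "\<tau> = {x \<in> hcone N B. u x = 0}"
    using assms(4) by (auto simp: face_of_cone_def)
  obtain \<rho> where \<rho>: "\<And>m. m \<in> B \<Longrightarrow> 0 \<le> \<rho> m" "\<And>x. x \<in> ext N \<Longrightarrow> u x = (\<Sum>m\<in>B. \<rho> m * x m)"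
    using farkas[OF assms(1-3) u(1,2)] by blast
  have "u x = 0 \<longleftrightarrow> (\<forall>m\<in>{m\<in>B. \<rho> m \<noteq> 0}. x m = 0)" if "x \<in> hcone N B" for x
  proof -
    have x: "x \<in> ext N" "\<And>m. m \<in> B \<Longrightarrow> 0 \<le> x m" using that by (auto simp: hcone_def)
    have "u x = 0 \<longleftrightarrow> (\<forall>m\<in>B. \<rho> m * x m = 0)"
      unfolding \<rho>(2)[OF x(1)] by (rule sum_nonneg_eq_0_iff[OF assms(2)]) (simp add: \<rho>(1) x(2))
    then show ?thesis by auto
  qed
  then show thesis by (intro that[of "{m\<in>B. \<rho> m \<noteq> 0}"]) (auto simp: u(3))
qed

lemma linear_form_ext_map:
  assumes \<phi>: "\<phi> \<in> Homs N Q" and u: "linear_form Q u"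
  shows "linear_form N (\<lambda>x. u (ext_map Q \<phi> x))"
proof -
  have "ext_map Q \<phi> x \<in> ext Q" if "x \<in> ext N" for x :: "_ \<Rightarrow> real" by (rule ext_map_ext[OF \<phi> that])
  then show ?thesis using u unfolding linear_form_def ext_map_add ext_map_scale by blast
qed

lemma linear_form_add: "linear_form N u \<Longrightarrow> linear_form N v \<Longrightarrow> linear_form N (\<lambda>x. u x + v x)"
  unfolding linear_form_def by (auto simp: distrib_left simp del: plus_fun_apply)

text \<open>The form of the face is pulled back along \<open>\<phi>\<close>. This keeps the cones
  that are cut down in \<open>pair_containing\<close> inside their fans.\<close>

lemma face_preimage:
  assumes \<phi>: "\<phi> \<in> Homs N Q" and face: "face_of_cone Q \<kappa> \<kappa>'" and \<sigma>: "\<sigma> \<subseteq> ext N"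
    and im: "ext_map Q \<phi> ` \<sigma> \<subseteq> \<kappa>'"
  shows "face_of_cone N {x \<in> \<sigma>. ext_map Q \<phi> x \<in> \<kappa>} \<sigma>"
proof -
  obtain u where u: "linear_form Q u" "\<forall>x\<in>\<kappa>'. 0 \<le> u x" "\<kappa> = {x \<in> \<kappa>'. u x = 0}"
    using face by (auto simp: face_of_cone_def)
  have "linear_form N (\<lambda>x. u (ext_map Q \<phi> x))"
    by (rule linear_form_ext_map[OF \<phi> u(1)])
  then show ?thesis unfolding face_of_cone_def
    using u(2,3) im by (intro exI[of _ "\<lambda>x. u (ext_map Q \<phi> x)"]) auto
qed

text \<open>
  Faces are defined by real forms; the sum \<open>m\<^sub>0\<close> of the inequalities that become equalities is an
  integral form cutting out the same face.
\<close>

lemma face_dual_monoid: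
  assumes lat: "is_lattice N" and \<tau>: "sc_rational_cone N \<tau>" and face: "face_of_cone N \<kappa> \<tau>"
    and m: "m \<in> dual_monoid N \<kappa>"
  obtains m0 k0 where "m0 \<in> dual N" "\<And>x. x \<in> \<kappa> \<Longrightarrow> x m0 = 0"
    "\<And>k. k \<ge> k0 \<Longrightarrow> (\<lambda>n. k * m0 n) + m \<in> dual_monoid N \<tau>"
proof -
  obtain B where B: "finite B" "B \<subseteq> dual N" "\<tau> = hcone N B" by (rule sc_rational_cone_hcone[OF lat \<tau>])
  obtain A where A: "finite A" "A \<subseteq> N" "\<tau> = gcone N A" by (rule sc_rational_cone_gcone[OF \<tau>])
  obtain C where C: "C \<subseteq> B" "\<kappa> = {x \<in> \<tau>. \<forall>m\<in>C. x m = 0}"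
    using faces_of_hcone[OF lat B(1,2) face[unfolded B(3)]] B(3) by blast
  have finC: "finite C" by (rule finite_subset[OF C(1) B(1)])
  have CN: "\<And>m. m \<in> C \<Longrightarrow> m \<in> dual N" using C(1) B(2) by blast
  define m0 where "m0 = (\<lambda>n. \<Sum>m\<in>C. 1 * m n)"
  have m0: "m0 \<in> dual N" unfolding m0_def by (rule dual_sum[OF finC CN])
  have xm0: "x m0 = (\<Sum>m\<in>C. x m)" if "x \<in> ext N" for x :: "_ \<Rightarrow> real"
    unfolding m0_def using ext_sum[OF that finC CN, of "\<lambda>m. m" "\<lambda>_. 1"] by simp
  have mN: "m \<in> dual N" using m by (simp add: dual_monoid_def)
  have nn: "0 \<le> x m'" if "x \<in> \<tau>" "m' \<in> C" for x m' using that C(1) by (auto simp: B(3) hcone_def)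
  have \<tau>ext: "x \<in> ext N" if "x \<in> \<tau>" for x using that by (simp add: B(3) hcone_def)
  \<comment> \<open>For \<open>k \<ge> k0\<close> every generator \<open>a\<close> of
    \<open>\<tau>\<close> is settled: if \<open>m0 a = 0\<close>, then \<open>a\<close> lies in
    \<open>\<kappa>\<close>, where \<open>m\<close> is nonnegative; otherwise the integer
    \<open>m0 a\<close> is at least 1 and \<open>k\<close> outweighs \<open>m a\<close>.\<close>
  define k0 where "k0 = (\<Sum>a\<in>A. \<bar>m a\<bar>)"
  show thesis
  proof (rule that[OF m0])
    fix x assume "x \<in> \<kappa>"
    then have "x \<in> \<tau>" "\<forall>m\<in>C. x m = 0" using C(2) by auto
    then show "x m0 = 0" using xm0[OF \<tau>ext[of x]] by simp
  next
    fix k assume k: "k0 \<le> k"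
    have "0 \<le> k * m0 a + m a" if a: "a \<in> A" for a
    proof -
      have t: "tens N a 1 \<in> \<tau>" unfolding A(3) by (rule gcone_gen[OF A(1) a])
      have "real_of_int (m0 a) = tens N a 1 m0" using m0 by (simp add: tens_def)
      also have "\<dots> = (\<Sum>m\<in>C. tens N a 1 m)" by (rule xm0[OF \<tau>ext[OF t]])
      finally have eq: "real_of_int (m0 a) = (\<Sum>m\<in>C. tens N a 1 m)" .
      also have "\<dots> \<ge> 0" by (intro sum_nonneg nn[OF t])
      finally have m0a: "0 \<le> m0 a" by simp
      show ?thesis
      proof (cases "m0 a = 0")
        case True
        then have "(\<Sum>m\<in>C. tens N a (1::real) m) = 0" using eq by simp
        then have "\<forall>m\<in>C. tens N a (1::real) m = 0" using sum_nonneg_eq_0_iff[OF finC] nn[OF t] by blast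
        then have "tens N a 1 \<in> \<kappa>" using C(2) t by blast
        then have "0 \<le> tens N a (1::real) m" using m unfolding dual_monoid_def by blast
        then show ?thesis using True mN by (simp add: tens_def)
      next
        case False
        have "\<bar>m a\<bar> \<le> k0" unfolding k0_def using A(1) a by (intro member_le_sum) auto
        moreover have "k * 1 \<le> k * m0 a"
          using False m0a k \<open>\<bar>m a\<bar> \<le> k0\<close> by (intro mult_left_mono) auto
        ultimately show ?thesis using k by linarith
      qed
    qed
    moreover have "(\<lambda>n. k * m0 n) + m \<in> dual N"
      by (intro subgrp_add[OF subgrp_dual] subgrp_int_mult[OF subgrp_dual] m0 mN)
    ultimately show "(\<lambda>n. k * m0 n) + m \<in> dual_monoid N \<tau>"
      unfolding A(3) dual_monoid_gcone[OF A(1,2)] by simp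
  qed
qed

section \<open>The fiber product of lattices\<close>

locale lattice_fiber_product =
  fixes N' :: "'a::ab_group_add set" and N'' :: "'b::ab_group_add set" and Q :: "'q::ab_group_add set"
    and \<phi>' :: "'a \<Rightarrow> 'q" and \<phi>'' :: "'b \<Rightarrow> 'q"
  assumes lat': "is_lattice N'" and lat'': "is_lattice N''" and latQ: "is_lattice Q"
    and hom': "\<phi>' \<in> Homs N' Q" and hom'': "\<phi>'' \<in> Homs N'' Q"
begin

definition N where "N = fp_lat N' N'' \<phi>' \<phi>''"

lemma sub': "subgrp N'" and sub'': "subgrp N''" and subQ: "subgrp Q"
  using lat' lat'' latQ by (auto intro: is_lattice_subgrp)

lemma in_N: "(n', n'') \<in> N \<longleftrightarrow> n' \<in> N' \<and> n'' \<in> N'' \<and> \<phi>' n' = \<phi>'' n''"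
  by (simp add: N_def fp_lat_def)

lemma subgrp_N: "subgrp N"
  unfolding subgrp_def
  by (auto simp: in_N zero_prod_def minus_prod_def subgrp_zero sub' sub'' subgrp_diff
      Homs_zero[OF hom'] Homs_zero[OF hom''] Homs_diff[OF hom' sub'] Homs_diff[OF hom'' sub''])

lemma N_subset: "N \<subseteq> N' \<times> N''"
  by (auto simp: N_def fp_lat_def)

lemma lat_N: "is_lattice N"
  by (rule is_lattice_sub[OF is_lattice_Times[OF lat' lat''] subgrp_N N_subset])

lemma proj1_hom: "proj1 N \<in> Homs N N'" and proj2_hom: "proj2 N \<in> Homs N N''"
  using N_subset subgrp_add[OF subgrp_N] unfolding Homs_def
  by (auto simp: proj1_def proj2_def)

lemma proj_commute: "\<phi>' \<circ> proj1 N = \<phi>'' \<circ> proj2 N"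
  using Homs_zero[OF hom'] Homs_zero[OF hom''] by (auto simp: fun_eq_iff proj1_def proj2_def in_N)

lemma pullback_proj1: "m' \<in> dual N' \<Longrightarrow> pullback (proj1 N) m' = fp_pi N m' 0"
  and pullback_proj2: "m'' \<in> dual N'' \<Longrightarrow> pullback (proj2 N) m'' = fp_pi N 0 m''"
  using Homs_zero by (auto simp: fun_eq_iff pullback_def proj1_def proj2_def fp_pi_def dual_def)

text \<open>Some multiple of \<open>m\<close> extends from the subgroup \<open>N\<close> to
  \<open>N' \<times> N''\<close>, and the extension is the sum of its restrictions to the two
  factors.\<close>

lemma dual_N_multiple:
  assumes m: "m \<in> dual N"
  obtains k m' m'' where "k \<noteq> 0" "m' \<in> dual N'" "m'' \<in> dual N''"
    "(\<lambda>n. k * m n) = pullback (proj1 N) m' + pullback (proj2 N) m''"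
proof -
  have "m (x + y) = m x + m y" if "x \<in> N" "y \<in> N" for x y
    using Homs_add[OF m[unfolded dual_def] that] .
  then obtain k q where k: "k \<noteq> 0" and q: "q \<in> dual (N' \<times> N'')" and qm: "\<And>x. x \<in> N \<Longrightarrow> q x = k * m x"
    using dual_extend_multiple[OF is_lattice_Times[OF lat' lat''] subgrp_N N_subset, of m] by blast
  have qadd: "q (x + y) = q x + q y" if "x \<in> N' \<times> N''" "y \<in> N' \<times> N''" for x y
    using Homs_add[OF q[unfolded dual_def] that] .
  define m' where "m' = (\<lambda>n'. if n' \<in> N' then q (n', 0) else 0)"
  define m'' where "m'' = (\<lambda>n''. if n'' \<in> N'' then q (0, n'') else 0)"
  have z: "0 \<in> N'" "0 \<in> N''" using sub' sub'' by (simp_all add: subgrp_zero)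
  have m': "m' \<in> dual N'"
  proof -
    have "q (x + y, 0) = q (x, 0) + q (y, 0)" if "x \<in> N'" "y \<in> N'" for x y
      using qadd[of "(x, 0)" "(y, 0)"] that z by (simp add: plus_prod_def)
    then show ?thesis by (auto simp: dual_def Homs_def m'_def subgrp_add[OF sub'])
  qed
  have m'': "m'' \<in> dual N''"
  proof -
    have "q (0, x + y) = q (0, x) + q (0, y)" if "x \<in> N''" "y \<in> N''" for x y
      using qadd[of "(0, x)" "(0, y)"] that z by (simp add: plus_prod_def)
    then show ?thesis by (auto simp: dual_def Homs_def m''_def subgrp_add[OF sub''])
  qed
  have "k * m n = (pullback (proj1 N) m' + pullback (proj2 N) m'') n" for n
  proof (cases "n \<in> N")
    case True
    then have "n \<in> N' \<times> N''" using N_subset by blast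
    then obtain n' n'' where n: "n = (n', n'')" "n' \<in> N'" "n'' \<in> N''" by blast
    have "q n = q (n', 0) + q (0, n'')" using qadd[of "(n', 0)" "(0, n'')"] n z by (simp add: plus_prod_def)
    then show ?thesis using True qm[OF True] n by (simp add: pullback_def proj1_def proj2_def m'_def m''_def)
  next
    case False
    have "m n = 0" using m False by (simp add: dual_def Homs_outside)
    then show ?thesis using False Homs_zero[OF m'[unfolded dual_def]] Homs_zero[OF m''[unfolded dual_def]]
      by (simp add: pullback_def proj1_def proj2_def)
  qed
  then show thesis using that k m' m'' by blast
qed

text \<open>A nonzero multiple of each \<open>m\<close> is a sum of forms pulled back from the
  factors, and the factor cancels in characteristic 0. This makes the point \<open>c\<close> unique
  and lets equations in \<open>ext N\<close> be checked on the two projections.\<close>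

lemma ext_proj_eqI:
  fixes x y :: "('a \<times> 'b \<Rightarrow> int) \<Rightarrow> 'k::field_char_0"
  assumes x: "x \<in> ext N" and y: "y \<in> ext N"
    and 1: "ext_map N' (proj1 N) x = ext_map N' (proj1 N) y"
    and 2: "ext_map N'' (proj2 N) x = ext_map N'' (proj2 N) y"
  shows "x = y"
proof
  fix m
  show "x m = y m"
  proof (cases "m \<in> dual N")
    case True
    then obtain k m' m'' where k: "k \<noteq> 0" and m: "m' \<in> dual N'" "m'' \<in> dual N''"
      and eq: "(\<lambda>n. k * m n) = pullback (proj1 N) m' + pullback (proj2 N) m''" by (rule dual_N_multiple)
    have "of_int k * z m = ext_map N' (proj1 N) z m' + ext_map N'' (proj2 N) z m''" if z: "z \<in> ext N"
      for z :: "('a \<times> 'b \<Rightarrow> int) \<Rightarrow> 'k"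
      unfolding ext_int_mult[OF z True, symmetric] eq ext_map_apply[OF m(1)] ext_map_apply[OF m(2)]
      by (rule ext_add[OF z pullback_dual[OF proj1_hom m(1)] pullback_dual[OF proj2_hom m(2)]])
    from this[OF x] this[OF y] have "of_int k * x m = of_int k * y m" unfolding 1 2 by simp
    then show ?thesis using k by simp
  next
    case False
    then show ?thesis using x y by (simp add: ext_def Homs_outside)
  qed
qed

text \<open>A pair \<open>(m', m'')\<close> vanishing on \<open>N\<close> comes, rationally, from \<open>Q\<close>.\<close>

lemma relation_vanishes:
  fixes x' :: "('a \<Rightarrow> int) \<Rightarrow> 'k::field_char_0" and x'' :: "('b \<Rightarrow> int) \<Rightarrow> 'k"
  assumes x': "x' \<in> ext N'" and x'': "x'' \<in> ext N''"
    and compat: "ext_map Q \<phi>' x' = ext_map Q \<phi>'' x''"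
    and m': "m' \<in> dual N'" and m'': "m'' \<in> dual N''"
    and van: "\<And>n' n''. (n', n'') \<in> N \<Longrightarrow> m' n' + m'' n'' = 0"
  shows "x' m' + x'' m'' = 0"
proof -
  note m'h = m'[unfolded dual_def] and m''h = m''[unfolded dual_def]
  \<comment> \<open>The image of \<open>N' \<times> N''\<close> under the difference map, whose
    kernel is \<open>N\<close>. The form given by \<open>m'\<close> and \<open>m''\<close> vanishes
    on \<open>N\<close>, hence descends to \<open>h\<close> on \<open>I\<close>, and a multiple of
    \<open>h\<close> extends to \<open>q\<close> on \<open>Q\<close>.\<close>
  define I where "I = {\<phi>' n' - \<phi>'' n'' | n' n''. n' \<in> N' \<and> n'' \<in> N''}"
  define h where "h = (\<lambda>y. SOME v. \<exists>n'\<in>N'. \<exists>n''\<in>N''. y = \<phi>' n' - \<phi>'' n'' \<and> v = m' n' + m'' n'')"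
  have h: "h (\<phi>' n' - \<phi>'' n'') = m' n' + m'' n''" if n: "n' \<in> N'" "n'' \<in> N''" for n' n''
  proof -
    have "\<exists>v. \<exists>p'\<in>N'. \<exists>p''\<in>N''. \<phi>' n' - \<phi>'' n'' = \<phi>' p' - \<phi>'' p'' \<and> v = m' p' + m'' p''"
      using n by blast
    from someI_ex[OF this] obtain p' p'' where p: "p' \<in> N'" "p'' \<in> N''"
      and eq: "\<phi>' n' - \<phi>'' n'' = \<phi>' p' - \<phi>'' p''" and hv: "h (\<phi>' n' - \<phi>'' n'') = m' p' + m'' p''"
      unfolding h_def by blast
    have "\<phi>' (n' - p') = \<phi>'' (n'' - p'')"
      using eq by (simp add: Homs_diff[OF hom' sub'] Homs_diff[OF hom'' sub''] n p algebra_simps)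
    then have "(n' - p', n'' - p'') \<in> N" using n p sub' sub'' by (simp add: in_N subgrp_diff)
    from van[OF this] show ?thesis
      using hv by (simp add: Homs_diff[OF m'h sub'] Homs_diff[OF m''h sub''] n p)
  qed
  have sub: "subgrp I"
    unfolding subgrp_def
  proof (intro conjI ballI)
    have "0 = \<phi>' 0 - \<phi>'' 0" by (simp add: Homs_zero[OF hom'] Homs_zero[OF hom''])
    then show "0 \<in> I" unfolding I_def using subgrp_zero[OF sub'] subgrp_zero[OF sub''] by blast
  next
    fix x y assume "x \<in> I" "y \<in> I"
    then obtain n' n'' p' p'' where np: "n' \<in> N'" "n'' \<in> N''" "p' \<in> N'" "p'' \<in> N''"
      "x = \<phi>' n' - \<phi>'' n''" "y = \<phi>' p' - \<phi>'' p''" unfolding I_def by blast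
    then have "x - y = \<phi>' (n' - p') - \<phi>'' (n'' - p'')"
      by (simp add: Homs_diff[OF hom' sub'] Homs_diff[OF hom'' sub''])
    then show "x - y \<in> I" unfolding I_def using np subgrp_diff[OF sub'] subgrp_diff[OF sub''] by blast
  qed
  have IQ: "I \<subseteq> Q" using Homs_in[OF hom'] Homs_in[OF hom''] subgrp_diff[OF subQ] by (auto simp: I_def)
  have hadd: "h (x + y) = h x + h y" if xy: "x \<in> I" "y \<in> I" for x y
  proof -
    obtain n' n'' p' p'' where np: "n' \<in> N'" "n'' \<in> N''" "p' \<in> N'" "p'' \<in> N''"
      "x = \<phi>' n' - \<phi>'' n''" "y = \<phi>' p' - \<phi>'' p''" using xy unfolding I_def by blast
    have "x + y = \<phi>' (n' + p') - \<phi>'' (n'' + p'')"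
      using np by (simp add: Homs_add[OF hom'] Homs_add[OF hom''])
    then have "h (x + y) = m' (n' + p') + m'' (n'' + p'')"
      using np h subgrp_add[OF sub'] subgrp_add[OF sub''] by simp
    then show ?thesis using np h by (simp add: Homs_add[OF m'h] Homs_add[OF m''h])
  qed
  obtain k q where k: "k \<noteq> 0" and q: "q \<in> dual Q" and qI: "\<And>x. x \<in> I \<Longrightarrow> q x = k * h x"
    using dual_extend_multiple[OF latQ sub IQ hadd] by blast
  note qh = q[unfolded dual_def]
  have qh0: "q 0 = 0" by (rule Homs_zero[OF qh])
  have 1: "pullback \<phi>' q = (\<lambda>n. k * m' n)"
  proof
    fix n show "pullback \<phi>' q n = k * m' n"
    proof (cases "n \<in> N'")
      case True
      have "\<phi>' n - \<phi>'' 0 \<in> I" using True subgrp_zero[OF sub''] by (auto simp: I_def)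
      from qI[OF this] show ?thesis using h[OF True subgrp_zero[OF sub'']]
        by (simp add: Homs_zero[OF hom''] Homs_zero[OF m''h] pullback_def)
    qed (simp add: Homs_outside[OF hom'] Homs_outside[OF m'h] qh0 pullback_def)
  qed
  \<comment> \<open>The sign is that of \<open>\<phi>''\<close> in the difference map. Since
    \<open>x'\<close> and \<open>x''\<close> agree on the pullbacks of \<open>q\<close> by
    \<open>compat\<close>, it produces the relation.\<close>
  have 2: "pullback \<phi>'' q = (\<lambda>n. (- k) * m'' n)"
  proof
    fix n show "pullback \<phi>'' q n = (- k) * m'' n"
    proof (cases "n \<in> N''")
      case True
      have "\<phi>' 0 - \<phi>'' n \<in> I" using True subgrp_zero[OF sub'] by (auto simp: I_def)
      from qI[OF this] show ?thesis using h[OF subgrp_zero[OF sub'] True]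
        by (simp add: Homs_zero[OF hom'] Homs_zero[OF m'h] pullback_def
            Homs_uminus[OF qh subQ] Homs_in[OF hom'' True])
    qed (simp add: Homs_outside[OF hom''] Homs_outside[OF m''h] qh0 pullback_def)
  qed
  have "of_int k * x' m' = x' (pullback \<phi>' q)" unfolding 1 ext_int_mult[OF x' m'] ..
  also have "\<dots> = x'' (pullback \<phi>'' q)" using fun_cong[OF compat, of q] q by (simp add: ext_map_apply)
  also have "\<dots> = - (of_int k * x'' m'')" unfolding 2 ext_int_mult[OF x'' m''] by simp
  finally have "of_int k * (x' m' + x'' m'') = 0" by (simp add: distrib_left)
  then show ?thesis using k by simp
qed

text \<open>The value at \<open>m\<close> has to be \<open>(x' m' + x'' m'') / k\<close> for every
  representation of \<open>k m\<close> by forms on the factors; \<open>relation_vanishes\<close>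
  makes it independent of the representation.\<close>

lemma ext_glue:
  fixes x' :: "('a \<Rightarrow> int) \<Rightarrow> 'k::field_char_0" and x'' :: "('b \<Rightarrow> int) \<Rightarrow> 'k"
  assumes x': "x' \<in> ext N'" and x'': "x'' \<in> ext N''"
    and compat: "ext_map Q \<phi>' x' = ext_map Q \<phi>'' x''"
  shows "\<exists>x\<in>ext N. ext_map N' (proj1 N) x = x' \<and> ext_map N'' (proj2 N) x = x''"
proof -
  let ?\<pi> = "\<lambda>m' m''. pullback (proj1 N) m' + pullback (proj2 N) m''"
  define rep where "rep = (\<lambda>m k m' m''. k \<noteq> (0::int) \<and> m' \<in> dual N' \<and> m'' \<in> dual N'' \<and>
    (\<lambda>n. k * m n) = ?\<pi> m' m'')"
  have uniq: "v = w" if "rep m k m' m''" "of_int k * v = x' m' + x'' m''"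
    "rep m l p' p''" "of_int l * w = x' p' + x'' p''" for m k m' m'' l p' p'' and v w :: 'k
  proof -
    have d: "m' \<in> dual N'" "m'' \<in> dual N''" "p' \<in> dual N'" "p'' \<in> dual N''" "k \<noteq> 0" "l \<noteq> 0"
      and eq: "(\<lambda>n. k * m n) = ?\<pi> m' m''" "(\<lambda>n. l * m n) = ?\<pi> p' p''"
      using that by (auto simp: rep_def)
    \<comment> \<open>The difference of the two representations after cross-multiplication; it
      vanishes on \<open>N\<close>.\<close>
    define q' where "q' = (\<lambda>n. l * m' n) + (\<lambda>n. (- k) * p' n)"
    define q'' where "q'' = (\<lambda>n. l * m'' n) + (\<lambda>n. (- k) * p'' n)"
    have i: "(\<lambda>n. l * m' n) \<in> dual N'" "(\<lambda>n. (- k) * p' n) \<in> dual N'"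
      "(\<lambda>n. l * m'' n) \<in> dual N''" "(\<lambda>n. (- k) * p'' n) \<in> dual N''"
      by (rule subgrp_int_mult[OF subgrp_dual], rule d)+
    have "q' n' + q'' n'' = 0" if n: "(n', n'') \<in> N" for n' n''
    proof -
      have "k * m (n', n'') = m' n' + m'' n''" "l * m (n', n'') = p' n' + p'' n''"
        using fun_cong[OF eq(1), of "(n', n'')"] fun_cong[OF eq(2), of "(n', n'')"] n
        by (simp_all add: pullback_def proj1_def proj2_def)
      then have "l * (m' n' + m'' n'') = k * (p' n' + p'' n'')" by (metis mult.left_commute)
      then show ?thesis by (simp add: q'_def q''_def algebra_simps)
    qed
    moreover have "q' \<in> dual N'" "q'' \<in> dual N''"
      unfolding q'_def q''_def by (rule subgrp_add[OF subgrp_dual i(1,2)], rule subgrp_add[OF subgrp_dual i(3,4)])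
    ultimately have "x' q' + x'' q'' = 0" by (intro relation_vanishes[OF x' x'' compat])
    then have "of_int l * (x' m' + x'' m'') = of_int k * (x' p' + x'' p'')"
      unfolding q'_def q''_def ext_add[OF x' i(1,2)] ext_add[OF x'' i(3,4)]
        ext_int_mult[OF x' d(1)] ext_int_mult[OF x' d(3)] ext_int_mult[OF x'' d(2)] ext_int_mult[OF x'' d(4)]
      by (simp add: algebra_simps)
    then have "of_int l * (of_int k * v) = of_int k * (of_int l * w)" using that by simp
    then show "v = w" using d(5,6) by simp
  qed
  define x where "x = (\<lambda>m. if m \<in> dual N then
    SOME v. \<exists>k m' m''. rep m k m' m'' \<and> of_int k * v = x' m' + x'' m'' else 0)"
  have x: "of_int k * x m = x' m' + x'' m''" if m: "m \<in> dual N" and r: "rep m k m' m''" for m k m' m''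
  proof -
    have "k \<noteq> 0" using r by (simp add: rep_def)
    then have v: "of_int k * ((x' m' + x'' m'') / of_int k) = x' m' + x'' m''" by simp
    then have "\<exists>v. \<exists>k m' m''. rep m k m' m'' \<and> of_int k * v = x' m' + x'' m''" using r by blast
    from someI_ex[OF this] obtain l p' p'' where l: "rep m l p' p''" "of_int l * x m = x' p' + x'' p''"
      unfolding x_def if_P[OF m] by blast
    then show ?thesis using uniq[OF l r v] v by simp
  qed
  have "x \<in> ext N"
    unfolding ext_def Homs_def
  proof (intro CollectI conjI ballI allI impI)
    fix m p assume mp: "m \<in> dual N" "p \<in> dual N"
    obtain k m' m'' where r1: "rep m k m' m''" using dual_N_multiple[OF mp(1)] unfolding rep_def by metis
    obtain l p' p'' where r2: "rep p l p' p''" using dual_N_multiple[OF mp(2)] unfolding rep_def by metis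
    have d: "m' \<in> dual N'" "m'' \<in> dual N''" "p' \<in> dual N'" "p'' \<in> dual N''" "k \<noteq> 0" "l \<noteq> 0"
      and eq: "(\<lambda>n. k * m n) = ?\<pi> m' m''" "(\<lambda>n. l * p n) = ?\<pi> p' p''"
      using r1 r2 by (auto simp: rep_def)
    have i: "(\<lambda>n. l * m' n) \<in> dual N'" "(\<lambda>n. k * p' n) \<in> dual N'"
      "(\<lambda>n. l * m'' n) \<in> dual N''" "(\<lambda>n. k * p'' n) \<in> dual N''"
      using d by (auto intro: subgrp_int_mult[OF subgrp_dual])
    \<comment> \<open>Representations can be added once they have the common factor
      \<open>k * l\<close>.\<close>
    have "(k * l) * (m + p) n = ?\<pi> ((\<lambda>n. l * m' n) + (\<lambda>n. k * p' n)) ((\<lambda>n. l * m'' n) + (\<lambda>n. k * p'' n)) n" for n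
    proof -
      have "(k * l) * (m + p) n = l * (k * m n) + k * (l * p n)" by (simp add: algebra_simps)
      also have "\<dots> = l * ?\<pi> m' m'' n + k * ?\<pi> p' p'' n" using fun_cong[OF eq(1), of n] fun_cong[OF eq(2), of n] by simp
      finally show ?thesis by (simp add: pullback_def algebra_simps)
    qed
    then have "rep (m + p) (k * l) ((\<lambda>n. l * m' n) + (\<lambda>n. k * p' n)) ((\<lambda>n. l * m'' n) + (\<lambda>n. k * p'' n))"
      unfolding rep_def using d i by (auto intro: subgrp_add[OF subgrp_dual] simp del: plus_fun_apply)
    from x[OF subgrp_add[OF subgrp_dual mp] this]
    have "of_int (k * l) * x (m + p) = of_int l * (x' m' + x'' m'') + of_int k * (x' p' + x'' p'')"
      unfolding ext_add[OF x' i(1,2)] ext_add[OF x'' i(3,4)]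
        ext_int_mult[OF x' d(1)] ext_int_mult[OF x' d(3)] ext_int_mult[OF x'' d(2)] ext_int_mult[OF x'' d(4)]
      by (simp add: algebra_simps)
    then have "of_int (k * l) * x (m + p) = of_int (k * l) * (x m + x p)"
      unfolding x[OF mp(1) r1, symmetric] x[OF mp(2) r2, symmetric] by (simp add: algebra_simps)
    then show "x (m + p) = x m + x p" using d(5,6) by simp
  qed (auto simp: x_def)
  moreover have "ext_map N' (proj1 N) x = x'"
  proof
    fix m' show "ext_map N' (proj1 N) x m' = x' m'"
    proof (cases "m' \<in> dual N'")
      case True
      have "pullback (proj2 N) 0 = 0" by (simp add: pullback_def fun_eq_iff)
      then have "rep (pullback (proj1 N) m') 1 m' 0"
        unfolding rep_def using True subgrp_zero[OF subgrp_dual, of N''] by auto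
      from x[OF pullback_dual[OF proj1_hom True] this] show ?thesis
        using True Homs_zero[OF x''[unfolded ext_def]] by (simp add: ext_map_apply)
    qed (use x' in \<open>simp add: ext_map_def ext_def Homs_outside\<close>)
  qed
  moreover have "ext_map N'' (proj2 N) x = x''"
  proof
    fix m'' show "ext_map N'' (proj2 N) x m'' = x'' m''"
    proof (cases "m'' \<in> dual N''")
      case True
      have "pullback (proj1 N) 0 = 0" by (simp add: pullback_def fun_eq_iff)
      then have "rep (pullback (proj2 N) m'') 1 0 m''"
        unfolding rep_def using True subgrp_zero[OF subgrp_dual, of N'] by auto
      from x[OF pullback_dual[OF proj2_hom True] this] show ?thesis
        using True Homs_zero[OF x'[unfolded ext_def]] by (simp add: ext_map_apply)
    qed (use x'' in \<open>simp add: ext_map_def ext_def Homs_outside\<close>)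
  qed
  ultimately show ?thesis by blast
qed

text \<open>The crosswise scaling gives both points the image \<open>(a' a'')\<^sup>2 d\<close> in
  \<open>Q\<close>; so \<open>ext_glue\<close> provides the point and \<open>ext_proj_eqI\<close>
  its uniqueness, as the definite description in \<open>fp_pt\<close> requires.\<close>

lemma fp_pt_props:
  assumes c': "c' \<in> ext N'" and c'': "c'' \<in> ext N''"
    and d: "ext_map Q \<phi>' c' = scale (a'\<^sup>2) d" "ext_map Q \<phi>'' c'' = scale (a''\<^sup>2) d"
  defines "c \<equiv> fp_pt N' N'' N c' c'' a' a''"
  shows "c \<in> ext N" "ext_map N' (proj1 N) c = scale (a''\<^sup>2) c'" "ext_map N'' (proj2 N) c = scale (a'\<^sup>2) c''"
proof -
  have "ext_map Q \<phi>' (scale (a''\<^sup>2) c') = ext_map Q \<phi>'' (scale (a'\<^sup>2) c'')"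
    by (simp add: ext_map_scale d scale_scale mult.commute)
  then have "\<exists>x. x \<in> ext N \<and> ext_map N' (proj1 N) x = scale (a''\<^sup>2) c' \<and> ext_map N'' (proj2 N) x = scale (a'\<^sup>2) c''"
    using ext_glue[OF scale_ext[OF c'] scale_ext[OF c'']] by blast
  then have "\<exists>!x. x \<in> ext N \<and> ext_map N' (proj1 N) x = scale (a''\<^sup>2) c' \<and> ext_map N'' (proj2 N) x = scale (a'\<^sup>2) c''"
    using ext_proj_eqI by metis
  from theI'[OF this]
  show "c \<in> ext N" "ext_map N' (proj1 N) c = scale (a''\<^sup>2) c'" "ext_map N'' (proj2 N) c = scale (a'\<^sup>2) c''"
    unfolding c_def fp_pt_def by blast+
qed

section \<open>Cones of pairs and their faces\<close>

definition fcone :: "'a rcone \<Rightarrow> 'b rcone \<Rightarrow> ('a \<times> 'b) rcone" where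
  "fcone \<sigma>' \<sigma>'' = fp_cone N' N'' N \<sigma>' \<sigma>''"

lemma in_fcone: "x \<in> fcone \<sigma>' \<sigma>'' \<longleftrightarrow>
    x \<in> ext N \<and> ext_map N' (proj1 N) x \<in> \<sigma>' \<and> ext_map N'' (proj2 N) x \<in> \<sigma>''"
  by (simp add: fcone_def fp_cone_def)

lemma fcone_Int: "fcone \<sigma>' \<sigma>'' \<inter> fcone \<tau>' \<tau>'' = fcone (\<sigma>' \<inter> \<tau>') (\<sigma>'' \<inter> \<tau>'')"
  by (auto simp: in_fcone)

lemma fcone_ext: "fcone \<sigma>' \<sigma>'' \<subseteq> ext N"
  by (auto simp: in_fcone)

lemma fcone_hcone:
  assumes B: "B' \<subseteq> dual N'" "B'' \<subseteq> dual N''"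
  shows "fcone (hcone N' B') (hcone N'' B'') =
    hcone N (pullback (proj1 N) ` B' \<union> pullback (proj2 N) ` B'')"
proof -
  have "ext_map N' (proj1 N) x \<in> hcone N' B' \<longleftrightarrow> (\<forall>m\<in>B'. 0 \<le> x (pullback (proj1 N) m))" if "x \<in> ext N" for x
  proof -
    have "ext_map N' (proj1 N) x m = x (pullback (proj1 N) m)" if "m \<in> B'" for m
      using that B(1) by (intro ext_map_apply) blast
    then show ?thesis using ext_map_ext[OF proj1_hom that] by (simp add: hcone_def)
  qed
  moreover have "ext_map N'' (proj2 N) x \<in> hcone N'' B'' \<longleftrightarrow> (\<forall>m\<in>B''. 0 \<le> x (pullback (proj2 N) m))" if "x \<in> ext N" for x
  proof -
    have "ext_map N'' (proj2 N) x m = x (pullback (proj2 N) m)" if "m \<in> B''" for m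
      using that B(2) by (intro ext_map_apply) blast
    then show ?thesis using ext_map_ext[OF proj2_hom that] by (simp add: hcone_def)
  qed
  ultimately have "x \<in> fcone (hcone N' B') (hcone N'' B'') \<longleftrightarrow> x \<in> ext N \<and>
      (\<forall>m\<in>B'. 0 \<le> x (pullback (proj1 N) m)) \<and> (\<forall>m\<in>B''. 0 \<le> x (pullback (proj2 N) m))" for x
    unfolding in_fcone by blast
  then show ?thesis by (auto simp: hcone_def)
qed

lemma pullback_proj_dual:
  "B' \<subseteq> dual N' \<Longrightarrow> B'' \<subseteq> dual N'' \<Longrightarrow> pullback (proj1 N) ` B' \<union> pullback (proj2 N) ` B'' \<subseteq> dual N"
  using pullback_dual[OF proj1_hom] pullback_dual[OF proj2_hom] by blast

text \<open>Strong convexity is inherited because an element of \<open>ext N\<close> with zero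
  projections is zero.\<close>

lemma sc_rational_fcone:
  assumes \<sigma>: "sc_rational_cone N' \<sigma>'" "sc_rational_cone N'' \<sigma>''"
  shows "sc_rational_cone N (fcone \<sigma>' \<sigma>'')"
proof -
  obtain B' where B': "finite B'" "B' \<subseteq> dual N'" "\<sigma>' = hcone N' B'"
    by (rule sc_rational_cone_hcone[OF lat' \<sigma>(1)])
  obtain B'' where B'': "finite B''" "B'' \<subseteq> dual N''" "\<sigma>'' = hcone N'' B''"
    by (rule sc_rational_cone_hcone[OF lat'' \<sigma>(2)])
  show ?thesis
  proof (rule sc_rational_coneI[OF lat_N])
    show "fcone \<sigma>' \<sigma>'' = hcone N (pullback (proj1 N) ` B' \<union> pullback (proj2 N) ` B'')"
      unfolding B'(3) B''(3) by (rule fcone_hcone[OF B'(2) B''(2)])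
    show "pullback (proj1 N) ` B' \<union> pullback (proj2 N) ` B'' \<subseteq> dual N"
      by (rule pullback_proj_dual[OF B'(2) B''(2)])
    fix x assume x: "x \<in> fcone \<sigma>' \<sigma>''" "- x \<in> fcone \<sigma>' \<sigma>''"
    then have "ext_map N' (proj1 N) x = 0" "ext_map N'' (proj2 N) x = 0"
      using \<sigma> unfolding in_fcone sc_rational_cone_def ext_map_uminus by blast+
    then show "x = 0"
      using x(1) subgrp_zero[OF subgrp_ext] unfolding in_fcone by (intro ext_proj_eqI) (auto simp: ext_map_0)
  qed (use B' B'' in simp)
qed

text \<open>The inequalities of the cone are pulled back from the factors, so those turned into
  equalities split into \<open>C'\<close> and \<open>C''\<close>, each of which cuts out a face in
  its factor.\<close>

lemma fcone_faces:
  assumes \<sigma>: "sc_rational_cone N' \<sigma>'" "sc_rational_cone N'' \<sigma>''"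
    and face: "face_of_cone N \<tau> (fcone \<sigma>' \<sigma>'')"
  obtains \<tau>' \<tau>'' where "face_of_cone N' \<tau>' \<sigma>'" "face_of_cone N'' \<tau>'' \<sigma>''" "\<tau> = fcone \<tau>' \<tau>''"
proof -
  obtain B' where B': "finite B'" "B' \<subseteq> dual N'" "\<sigma>' = hcone N' B'"
    by (rule sc_rational_cone_hcone[OF lat' \<sigma>(1)])
  obtain B'' where B'': "finite B''" "B'' \<subseteq> dual N''" "\<sigma>'' = hcone N'' B''"
    by (rule sc_rational_cone_hcone[OF lat'' \<sigma>(2)])
  let ?B = "pullback (proj1 N) ` B' \<union> pullback (proj2 N) ` B''"
  have f\<sigma>: "fcone \<sigma>' \<sigma>'' = hcone N ?B" unfolding B'(3) B''(3) by (rule fcone_hcone[OF B'(2) B''(2)])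
  have fin: "finite ?B" using B'(1) B''(1) by simp
  obtain C where C: "C \<subseteq> ?B" "\<tau> = {x \<in> hcone N ?B. \<forall>m\<in>C. x m = 0}"
    by (rule faces_of_hcone[OF lat_N fin pullback_proj_dual[OF B'(2) B''(2)] face[unfolded f\<sigma>]])
  define C' where "C' = {m\<in>B'. pullback (proj1 N) m \<in> C}"
  define C'' where "C'' = {m\<in>B''. pullback (proj2 N) m \<in> C}"
  define \<tau>' where "\<tau>' = {x \<in> \<sigma>'. \<forall>m\<in>C'. x m = 0}"
  define \<tau>'' where "\<tau>'' = {x \<in> \<sigma>''. \<forall>m\<in>C''. x m = 0}"
  have "\<tau> = {x \<in> fcone \<sigma>' \<sigma>''. \<forall>m\<in>C. x m = 0}" unfolding f\<sigma> by (rule C(2))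
  also have "\<dots> = fcone \<tau>' \<tau>''"
  proof -
    have "(\<forall>m\<in>C. x m = 0) \<longleftrightarrow> (\<forall>m\<in>C'. ext_map N' (proj1 N) x m = 0) \<and> (\<forall>m\<in>C''. ext_map N'' (proj2 N) x m = 0)"
      for x :: "_ \<Rightarrow> real"
    proof -
      have "(\<forall>m\<in>C'. ext_map N' (proj1 N) x m = 0) \<longleftrightarrow> (\<forall>m\<in>C'. x (pullback (proj1 N) m) = 0)"
      proof -
        have "ext_map N' (proj1 N) x m = x (pullback (proj1 N) m)" if "m \<in> C'" for m
          using that B'(2) by (intro ext_map_apply) (auto simp: C'_def)
        then show ?thesis by simp
      qed
      moreover have "(\<forall>m\<in>C''. ext_map N'' (proj2 N) x m = 0) \<longleftrightarrow> (\<forall>m\<in>C''. x (pullback (proj2 N) m) = 0)"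
      proof -
        have "ext_map N'' (proj2 N) x m = x (pullback (proj2 N) m)" if "m \<in> C''" for m
          using that B''(2) by (intro ext_map_apply) (auto simp: C''_def)
        then show ?thesis by simp
      qed
      moreover have "C = pullback (proj1 N) ` C' \<union> pullback (proj2 N) ` C''"
        using C(1) by (auto simp: C'_def C''_def)
      ultimately show ?thesis by (simp add: ball_Un)
    qed
    then show ?thesis by (auto simp: in_fcone \<tau>'_def \<tau>''_def)
  qed
  finally have "\<tau> = fcone \<tau>' \<tau>''" .
  moreover have "face_of_cone N' \<tau>' \<sigma>'" unfolding \<tau>'_def B'(3)
    by (rule face_hcone) (use B'(1) in \<open>auto simp: C'_def\<close>)
  moreover have "face_of_cone N'' \<tau>'' \<sigma>''" unfolding \<tau>''_def B''(3)
    by (rule face_hcone) (use B''(1) in \<open>auto simp: C''_def\<close>)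
  ultimately show thesis using that by blast
qed

text \<open>The forms of the two faces are pulled back and added; both are nonnegative on the cone,
  so the sum vanishes only where both do.\<close>

lemma fcone_face:
  assumes "face_of_cone N' \<tau>' \<sigma>'" "face_of_cone N'' \<tau>'' \<sigma>''"
  shows "face_of_cone N (fcone \<tau>' \<tau>'') (fcone \<sigma>' \<sigma>'')"
proof -
  obtain u' where u': "linear_form N' u'" "\<forall>x\<in>\<sigma>'. 0 \<le> u' x" "\<tau>' = {x\<in>\<sigma>'. u' x = 0}"
    using assms(1) by (auto simp: face_of_cone_def)
  obtain u'' where u'': "linear_form N'' u''" "\<forall>x\<in>\<sigma>''. 0 \<le> u'' x" "\<tau>'' = {x\<in>\<sigma>''. u'' x = 0}"
    using assms(2) by (auto simp: face_of_cone_def)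
  define u where "u = (\<lambda>x. u' (ext_map N' (proj1 N) x) + u'' (ext_map N'' (proj2 N) x))"
  have "linear_form N u" unfolding u_def
    by (intro linear_form_add linear_form_ext_map[OF proj1_hom u'(1)] linear_form_ext_map[OF proj2_hom u''(1)])
  moreover have "\<forall>x\<in>fcone \<sigma>' \<sigma>''. 0 \<le> u x" using u'(2) u''(2) by (auto simp: in_fcone u_def)
  moreover have "fcone \<tau>' \<tau>'' = {x\<in>fcone \<sigma>' \<sigma>''. u x = 0}"
    using u'(2) u''(2) by (auto simp: in_fcone u_def u'(3) u''(3) add_nonneg_eq_0_iff)
  ultimately show ?thesis unfolding face_of_cone_def by blast
qed

end

section \<open>The decorated fiber product\<close>

lemma is_fanD:
  assumes "is_fan N \<Sigma>"
  shows "finite \<Sigma>" "\<sigma> \<in> \<Sigma> \<Longrightarrow> sc_rational_cone N \<sigma>"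
    "\<sigma> \<in> \<Sigma> \<Longrightarrow> face_of_cone N \<tau> \<sigma> \<Longrightarrow> \<tau> \<in> \<Sigma>"
    "\<sigma> \<in> \<Sigma> \<Longrightarrow> \<tau> \<in> \<Sigma> \<Longrightarrow> face_of_cone N (\<sigma> \<inter> \<tau>) \<sigma>"
    "\<sigma> \<in> \<Sigma> \<Longrightarrow> \<tau> \<in> \<Sigma> \<Longrightarrow> face_of_cone N (\<sigma> \<inter> \<tau>) \<tau>"
  using assms unfolding is_fan_def by auto

lemma admissibleD:
  assumes "admissible N c \<Sigma> \<B>" "\<sigma> \<in> \<Sigma>"
  shows "finite (\<B> \<sigma>)" "\<B> \<sigma> \<noteq> {}" "\<B> \<sigma> \<subseteq> dual_monoid N \<sigma>"
    "m \<in> dual_monoid N \<sigma> \<Longrightarrow> c m \<noteq> 0 \<Longrightarrow> \<exists>b\<in>\<B> \<sigma>. cone_le N \<sigma> b m"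
    "\<sigma>' \<in> \<Sigma> \<Longrightarrow> b \<in> \<B> \<sigma> \<Longrightarrow> \<exists>b'\<in>\<B> \<sigma>'. cone_le N (\<sigma> \<inter> \<sigma>') b' b"
  using assms unfolding admissible_def by auto

lemma decorated_fanD:
  assumes "decorated_fan X"
  shows "is_lattice (lat X)" "pt X \<in> ext (lat X)" "is_fan (lat X) (fan X)"
    "admissible (lat X) (pt X) (fan X) (dec X)"
  using assms by (simp_all add: decorated_fan_def)

lemma dfan_morphismD:
  assumes "dfan_morphism X Y (\<phi>, a)"
  shows "decorated_fan X" "decorated_fan Y" "\<phi> \<in> Homs (lat X) (lat Y)"
    "ext_map (lat Y) \<phi> (pt X) = scale (a\<^sup>2) (pt Y)"
    "\<sigma> \<in> fan X \<Longrightarrow> \<exists>\<sigma>'\<in>fan Y. ext_map (lat Y) \<phi> ` \<sigma> \<subseteq> \<sigma>'"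
    "a \<noteq> 0 \<Longrightarrow> \<sigma> \<in> fan X \<Longrightarrow> \<sigma>' \<in> fan Y \<Longrightarrow> ext_map (lat Y) \<phi> ` \<sigma> \<subseteq> \<sigma>' \<Longrightarrow> b' \<in> dec Y \<sigma>' \<Longrightarrow>
      \<exists>b\<in>dec X \<sigma>. cone_le (lat X) \<sigma> b (pullback \<phi> b')"
  using assms unfolding dfan_morphism_def by auto

lemma dfan_morphismI:
  assumes "decorated_fan X" "decorated_fan Y" "\<phi> \<in> Homs (lat X) (lat Y)"
    "ext_map (lat Y) \<phi> (pt X) = scale (a\<^sup>2) (pt Y)"
    "\<And>\<sigma>. \<sigma> \<in> fan X \<Longrightarrow> \<exists>\<sigma>'\<in>fan Y. ext_map (lat Y) \<phi> ` \<sigma> \<subseteq> \<sigma>'"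
    "\<And>\<sigma> \<sigma>' b'. a \<noteq> 0 \<Longrightarrow> \<sigma> \<in> fan X \<Longrightarrow> \<sigma>' \<in> fan Y \<Longrightarrow> ext_map (lat Y) \<phi> ` \<sigma> \<subseteq> \<sigma>' \<Longrightarrow>
      b' \<in> dec Y \<sigma>' \<Longrightarrow> \<exists>b\<in>dec X \<sigma>. cone_le (lat X) \<sigma> b (pullback \<phi> b')"
  shows "dfan_morphism X Y (\<phi>, a)"
  using assms unfolding dfan_morphism_def by auto

section \<open>The ideal of a pair, existence of a decoration, and the fan\<close>

locale dfan_cospan =
  fixes X' :: "'a::ab_group_add dfan" and X'' :: "'b::ab_group_add dfan"
    and Y :: "'q::ab_group_add dfan"
    and \<phi>' :: "'a \<Rightarrow> 'q" and \<phi>'' :: "'b \<Rightarrow> 'q" and a' a'' :: complex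
  assumes mor': "dfan_morphism X' Y (\<phi>', a')"
    and mor'': "dfan_morphism X'' Y (\<phi>'', a'')"
    and nz: "\<not> (a' = 0 \<and> a'' = 0)"
begin

lemmas X' = decorated_fanD[OF dfan_morphismD(1)[OF mor']]
lemmas X'' = decorated_fanD[OF dfan_morphismD(1)[OF mor'']]
lemmas Y = decorated_fanD[OF dfan_morphismD(2)[OF mor']]

sublocale lattice_fiber_product "lat X'" "lat X''" "lat Y" \<phi>' \<phi>''
  using X'(1) X''(1) Y(1) dfan_morphismD(3)[OF mor'] dfan_morphismD(3)[OF mor''] by unfold_locales

definition c where "c = fp_pt (lat X') (lat X'') N (pt X') (pt X'') a' a''"

lemmas c_props = fp_pt_props[OF X'(2) X''(2) dfan_morphismD(4)[OF mor'] dfan_morphismD(4)[OF mor''], folded c_def]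

definition pairs where "pairs = fp_pairs (lat Y) (fan X') (fan X'') (fan Y) \<phi>' \<phi>''"

text \<open>The case distinction of \<open>fp_ideal\<close> in crosswise form: as \<open>a'\<close>
  and \<open>a''\<close> are not both 0, the case \<open>a' = 0\<close> has
  \<open>a'' \<noteq> 0\<close> and keeps the forms from \<open>X'\<close>, and symmetrically. The
  scalar of the projection to \<open>X'\<close> is \<open>a''\<close>.\<close>

definition gens :: "'a rcone \<Rightarrow> 'b rcone \<Rightarrow> ('a \<times> 'b \<Rightarrow> int) set" where
  "gens \<sigma>' \<sigma>'' = (if a'' \<noteq> 0 then pullback (proj1 N) ` dec X' \<sigma>' else {}) \<union>
    (if a' \<noteq> 0 then pullback (proj2 N) ` dec X'' \<sigma>'' else {})"

definition igens :: "'a rcone \<Rightarrow> 'b rcone \<Rightarrow> ('a \<times> 'b \<Rightarrow> int) set" where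
  "igens \<sigma>' \<sigma>'' = {m \<in> dual_monoid N (fcone \<sigma>' \<sigma>''). c m \<noteq> 0} \<union> gens \<sigma>' \<sigma>''"

lemma in_pairs: "(\<sigma>', \<sigma>'') \<in> pairs \<longleftrightarrow> \<sigma>' \<in> fan X' \<and> \<sigma>'' \<in> fan X'' \<and>
    (\<exists>\<kappa>\<in>fan Y. ext_map (lat Y) \<phi>' ` \<sigma>' \<subseteq> \<kappa> \<and> ext_map (lat Y) \<phi>'' ` \<sigma>'' \<subseteq> \<kappa>)"
  by (auto simp: pairs_def fp_pairs_def)

lemma pairsD: "(\<sigma>', \<sigma>'') \<in> pairs \<Longrightarrow> \<sigma>' \<in> fan X'" "(\<sigma>', \<sigma>'') \<in> pairs \<Longrightarrow> \<sigma>'' \<in> fan X''"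
  by (simp_all add: in_pairs)

lemma sc_fcone: "(\<sigma>', \<sigma>'') \<in> pairs \<Longrightarrow> sc_rational_cone N (fcone \<sigma>' \<sigma>'')"
  by (intro sc_rational_fcone is_fanD(2)[OF X'(3)] is_fanD(2)[OF X''(3)] pairsD)

lemma submonoid_fcone: "submonoid (dual_monoid N (fcone \<sigma>' \<sigma>''))"
  by (rule submonoid_dual_monoid[OF fcone_ext])

lemma proj1_fcone: "ext_map (lat X') (proj1 N) ` fcone \<sigma>' \<sigma>'' \<subseteq> \<sigma>'"
  and proj2_fcone: "ext_map (lat X'') (proj2 N) ` fcone \<sigma>' \<sigma>'' \<subseteq> \<sigma>''"
  by (auto simp: in_fcone)

lemma igens_subset:
  assumes p: "(\<sigma>', \<sigma>'') \<in> pairs"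
  shows "gens \<sigma>' \<sigma>'' \<subseteq> dual_monoid N (fcone \<sigma>' \<sigma>'')" "igens \<sigma>' \<sigma>'' \<subseteq> dual_monoid N (fcone \<sigma>' \<sigma>'')"
proof -
  have "pullback (proj1 N) ` dec X' \<sigma>' \<subseteq> dual_monoid N (fcone \<sigma>' \<sigma>'')"
    using dual_monoid_pullback[OF proj1_hom proj1_fcone] admissibleD(3)[OF X'(4) pairsD(1)[OF p]] by blast
  moreover have "pullback (proj2 N) ` dec X'' \<sigma>'' \<subseteq> dual_monoid N (fcone \<sigma>' \<sigma>'')"
    using dual_monoid_pullback[OF proj2_hom proj2_fcone] admissibleD(3)[OF X''(4) pairsD(2)[OF p]] by blast
  ultimately show "gens \<sigma>' \<sigma>'' \<subseteq> dual_monoid N (fcone \<sigma>' \<sigma>'')" by (auto simp: gens_def)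
  then show "igens \<sigma>' \<sigma>'' \<subseteq> dual_monoid N (fcone \<sigma>' \<sigma>'')" by (auto simp: igens_def)
qed

lemma gens_nonempty: "(\<sigma>', \<sigma>'') \<in> pairs \<Longrightarrow> gens \<sigma>' \<sigma>'' \<noteq> {}"
  using nz admissibleD(2)[OF X'(4) pairsD(1)] admissibleD(2)[OF X''(4) pairsD(2)]
  by (auto simp: gens_def)

lemma fp_ideal_eq:
  assumes p: "(\<sigma>', \<sigma>'') \<in> pairs"
  shows "fp_ideal N c a' a'' (dual_monoid N (fcone \<sigma>' \<sigma>'')) (dec X' \<sigma>') (dec X'' \<sigma>'') =
    monomial_ideal (dual_monoid N (fcone \<sigma>' \<sigma>'')) (igens \<sigma>' \<sigma>'')"
proof -
  have "b \<in> dual (lat X')" if "b \<in> dec X' \<sigma>'" for b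
    using admissibleD(3)[OF X'(4) pairsD(1)[OF p]] that by (auto simp: dual_monoid_def)
  then have 1: "{fp_pi N b' 0 | b'. b' \<in> dec X' \<sigma>'} = pullback (proj1 N) ` dec X' \<sigma>'"
    using pullback_proj1 by (auto simp: image_iff)
  have "b \<in> dual (lat X'')" if "b \<in> dec X'' \<sigma>''" for b
    using admissibleD(3)[OF X''(4) pairsD(2)[OF p]] that by (auto simp: dual_monoid_def)
  then have 2: "{fp_pi N 0 b'' | b''. b'' \<in> dec X'' \<sigma>''} = pullback (proj2 N) ` dec X'' \<sigma>''"
    using pullback_proj2 by (auto simp: image_iff)
  have 3: "(if a' \<noteq> 0 \<and> a'' \<noteq> 0
      then pullback (proj1 N) ` dec X' \<sigma>' \<union> pullback (proj2 N) ` dec X'' \<sigma>''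
      else if a' = 0 then pullback (proj1 N) ` dec X' \<sigma>'
      else pullback (proj2 N) ` dec X'' \<sigma>'') = gens \<sigma>' \<sigma>''"
    using nz by (auto simp: gens_def)
  show ?thesis
    unfolding fp_ideal_def 1 2 3 igens_def
    by (rule submonoid.monomial_ideal_Un[OF submonoid_fcone]) (use igens_subset[OF p] in auto)
qed

text \<open>Condition (ii) for the decorations of \<open>X'\<close> and \<open>X''\<close>, pulled
  back. The set \<open>\<rho>\<close> is left free, as the lemma serves both the intersection of two
  cones and a single cone defined by two pairs.\<close>

lemma gens_compatible:
  assumes p: "(\<sigma>', \<sigma>'') \<in> pairs" "(\<tau>', \<tau>'') \<in> pairs" and g: "g \<in> gens \<sigma>' \<sigma>''"
    and \<rho>: "\<rho> \<subseteq> fcone \<sigma>' \<sigma>'' \<inter> fcone \<tau>' \<tau>''"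
  shows "\<exists>h\<in>gens \<tau>' \<tau>''. cone_le N \<rho> h g"
proof -
  consider b where "a'' \<noteq> 0" "b \<in> dec X' \<sigma>'" "g = pullback (proj1 N) b"
    | b where "a' \<noteq> 0" "b \<in> dec X'' \<sigma>''" "g = pullback (proj2 N) b"
    using g by (auto simp: gens_def split: if_splits)
  then show ?thesis
  proof cases
    case 1
    obtain b1 where b1: "b1 \<in> dec X' \<tau>'" "cone_le (lat X') (\<sigma>' \<inter> \<tau>') b1 b"
      using admissibleD(5)[OF X'(4) pairsD(1)[OF p(1)] pairsD(1)[OF p(2)] 1(2)] by blast
    have "ext_map (lat X') (proj1 N) ` \<rho> \<subseteq> \<sigma>' \<inter> \<tau>'" using \<rho> by (auto simp: in_fcone)
    from cone_le_pullback[OF proj1_hom this b1(2)] show ?thesis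
      using 1 b1(1) by (auto simp: gens_def)
  next
    case 2
    obtain b1 where b1: "b1 \<in> dec X'' \<tau>''" "cone_le (lat X'') (\<sigma>'' \<inter> \<tau>'') b1 b"
      using admissibleD(5)[OF X''(4) pairsD(2)[OF p(1)] pairsD(2)[OF p(2)] 2(2)] by blast
    have "ext_map (lat X'') (proj2 N) ` \<rho> \<subseteq> \<sigma>'' \<inter> \<tau>''" using \<rho> by (auto simp: in_fcone)
    from cone_le_pullback[OF proj2_hom this b1(2)] show ?thesis
      using 2 b1(1) by (auto simp: gens_def)
  qed
qed

text \<open>Decorations are indexed by cones, not by pairs. The forms with
  \<open>c m \<noteq> 0\<close> depend on the cone only, and by \<open>gens_compatible\<close> each
  pulled back form of one pair dominates one of the other.\<close>

lemma monomial_ideal_igens_cong: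
  assumes p: "(\<sigma>', \<sigma>'') \<in> pairs" "(\<tau>', \<tau>'') \<in> pairs" and eq: "fcone \<sigma>' \<sigma>'' = fcone \<tau>' \<tau>''"
  shows "monomial_ideal (dual_monoid N (fcone \<sigma>' \<sigma>'')) (igens \<sigma>' \<sigma>'') =
    monomial_ideal (dual_monoid N (fcone \<sigma>' \<sigma>'')) (igens \<tau>' \<tau>'')"
proof -
  interpret submonoid "dual_monoid N (fcone \<sigma>' \<sigma>'')" by (rule submonoid_fcone)
  have sub: "up_closure (dual_monoid N (fcone \<sigma>' \<sigma>'')) (igens \<rho>' \<rho>'')
      \<subseteq> up_closure (dual_monoid N (fcone \<sigma>' \<sigma>'')) (igens \<kappa>' \<kappa>'')"
    if r: "(\<rho>', \<rho>'') \<in> pairs" and k: "(\<kappa>', \<kappa>'') \<in> pairs"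
      and e: "fcone \<rho>' \<rho>'' = fcone \<sigma>' \<sigma>''" "fcone \<kappa>' \<kappa>'' = fcone \<sigma>' \<sigma>''"
    for \<rho>' \<rho>'' \<kappa>' \<kappa>''
  proof (rule up_closure_mono, rule subsetI)
    fix m assume "m \<in> igens \<rho>' \<rho>''"
    then consider "m \<in> igens \<kappa>' \<kappa>''" | "m \<in> gens \<rho>' \<rho>''" unfolding igens_def e by blast
    then show "m \<in> up_closure (dual_monoid N (fcone \<sigma>' \<sigma>'')) (igens \<kappa>' \<kappa>'')"
    proof cases
      case 2
      then obtain h where "h \<in> gens \<kappa>' \<kappa>''" "cone_le N (fcone \<sigma>' \<sigma>'') h m"
        using gens_compatible[OF r k 2, of "fcone \<sigma>' \<sigma>''"] e by auto
      then show ?thesis by (auto simp: up_closure_def igens_def cone_le_def)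
    qed (rule up_closure_self)
  qed
  show ?thesis
    using monomial_ideal_eq_iff[OF igens_subset(2)[OF p(1)] igens_subset(2)[OF p(2), folded eq]]
      sub[OF p refl eq[symmetric]] sub[OF p(2,1) eq[symmetric] refl] by blast
qed

lemma fp_decoration_iff:
  "fp_decoration X' X'' Y (\<phi>', a') (\<phi>'', a'') \<B> \<longleftrightarrow>
    (\<forall>(\<sigma>', \<sigma>'')\<in>pairs. is_minimal_monomial_generators (dual_monoid N (fcone \<sigma>' \<sigma>''))
      (monomial_ideal (dual_monoid N (fcone \<sigma>' \<sigma>'')) (igens \<sigma>' \<sigma>'')) (\<B> (fcone \<sigma>' \<sigma>'')))"
  unfolding fp_decoration_def Let_def prod.case N_def[symmetric] c_def[symmetric] pairs_def[symmetric]
    fcone_def[symmetric]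
  by (intro ball_cong refl) (auto simp: fp_ideal_eq)

lemma fp_decoration_exists: "\<exists>\<B>. fp_decoration X' X'' Y (\<phi>', a') (\<phi>'', a'') \<B>"
proof -
  \<comment> \<open>A single set has to serve all pairs that define the same cone; a minimal
    generating set for one of them does, as their ideals coincide.\<close>
  define P where "P = (\<lambda>\<sigma> B. \<forall>\<sigma>' \<sigma>''. (\<sigma>', \<sigma>'') \<in> pairs \<and> fcone \<sigma>' \<sigma>'' = \<sigma> \<longrightarrow>
    is_minimal_monomial_generators (dual_monoid N \<sigma>) (monomial_ideal (dual_monoid N \<sigma>) (igens \<sigma>' \<sigma>'')) B)"
  have "P (fcone \<sigma>' \<sigma>'') (SOME B. P (fcone \<sigma>' \<sigma>'') B)" if p: "(\<sigma>', \<sigma>'') \<in> pairs" for \<sigma>' \<sigma>''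
  proof (rule someI_ex)
    obtain B where B: "is_minimal_monomial_generators (dual_monoid N (fcone \<sigma>' \<sigma>''))
        (monomial_ideal (dual_monoid N (fcone \<sigma>' \<sigma>'')) (igens \<sigma>' \<sigma>'')) B"
      using dual_monoid_minimal_generators_exist[OF sc_fcone[OF p] igens_subset(2)[OF p]] by blast
    have "P (fcone \<sigma>' \<sigma>'') B" unfolding P_def
    proof (intro allI impI)
      fix \<tau>' \<tau>'' assume t: "(\<tau>', \<tau>'') \<in> pairs \<and> fcone \<tau>' \<tau>'' = fcone \<sigma>' \<sigma>''"
      then have "monomial_ideal (dual_monoid N (fcone \<sigma>' \<sigma>'')) (igens \<sigma>' \<sigma>'') =
          monomial_ideal (dual_monoid N (fcone \<sigma>' \<sigma>'')) (igens \<tau>' \<tau>'')"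
        by (intro monomial_ideal_igens_cong[OF p]) auto
      then show "is_minimal_monomial_generators (dual_monoid N (fcone \<sigma>' \<sigma>''))
          (monomial_ideal (dual_monoid N (fcone \<sigma>' \<sigma>'')) (igens \<tau>' \<tau>'')) B" using B by simp
    qed
    then show "\<exists>B. P (fcone \<sigma>' \<sigma>'') B" by blast
  qed
  then show ?thesis unfolding fp_decoration_iff P_def
    by (intro exI[of _ "\<lambda>\<sigma>. SOME B. P \<sigma> B"]) (auto simp: P_def)
qed

definition \<Sigma> where "\<Sigma> = (\<lambda>(\<sigma>', \<sigma>''). fcone \<sigma>' \<sigma>'') ` pairs"

lemma fp_object_sel:
  fixes \<B>
  defines "P \<equiv> fp_object X' X'' Y (\<phi>', a') (\<phi>'', a'') \<B>"
  shows "lat P = N" "pt P = c" "fan P = \<Sigma>" "dec P = \<B>"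
  by (simp_all add: P_def fp_object_def Let_def N_def c_def \<Sigma>_def pairs_def fcone_def)

text \<open>A pair of faces still maps into the same cone of the fan of \<open>Y\<close>, so
  \<open>fcone_faces\<close> gives closure under faces; intersections are formed in each
  component.\<close>

lemma is_fan_\<Sigma>: "is_fan N \<Sigma>"
  unfolding is_fan_def
proof (intro conjI ballI allI impI)
  have "pairs \<subseteq> fan X' \<times> fan X''" by (auto simp: in_pairs)
  then show "finite \<Sigma>"
    unfolding \<Sigma>_def using is_fanD(1)[OF X'(3)] is_fanD(1)[OF X''(3)] finite_subset by blast
next
  fix \<sigma> assume "\<sigma> \<in> \<Sigma>"
  then obtain \<sigma>' \<sigma>'' where \<sigma>: "(\<sigma>', \<sigma>'') \<in> pairs" "\<sigma> = fcone \<sigma>' \<sigma>''" by (auto simp: \<Sigma>_def)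
  then show "sc_rational_cone N \<sigma>" by (simp add: sc_fcone)
  {
    fix \<tau> assume "face_of_cone N \<tau> \<sigma>"
    then obtain \<tau>' \<tau>'' where \<tau>: "face_of_cone (lat X') \<tau>' \<sigma>'" "face_of_cone (lat X'') \<tau>'' \<sigma>''" "\<tau> = fcone \<tau>' \<tau>''"
      using fcone_faces[OF is_fanD(2)[OF X'(3) pairsD(1)[OF \<sigma>(1)]] is_fanD(2)[OF X''(3) pairsD(2)[OF \<sigma>(1)]]]
      unfolding \<sigma>(2) by blast
    have "\<tau>' \<in> fan X'" "\<tau>'' \<in> fan X''"
      using is_fanD(3)[OF X'(3) pairsD(1)[OF \<sigma>(1)] \<tau>(1)] is_fanD(3)[OF X''(3) pairsD(2)[OF \<sigma>(1)] \<tau>(2)] .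
    moreover have "\<tau>' \<subseteq> \<sigma>'" "\<tau>'' \<subseteq> \<sigma>''" using \<tau>(1,2) by (auto simp: face_of_cone_def)
    moreover obtain \<kappa> where "\<kappa> \<in> fan Y" "ext_map (lat Y) \<phi>' ` \<sigma>' \<subseteq> \<kappa>" "ext_map (lat Y) \<phi>'' ` \<sigma>'' \<subseteq> \<kappa>"
      using \<sigma>(1) unfolding in_pairs by auto
    ultimately have "ext_map (lat Y) \<phi>' ` \<tau>' \<subseteq> \<kappa>" "ext_map (lat Y) \<phi>'' ` \<tau>'' \<subseteq> \<kappa>" by blast+
    then have "(\<tau>', \<tau>'') \<in> pairs" unfolding in_pairs
      using \<open>\<tau>' \<in> fan X'\<close> \<open>\<tau>'' \<in> fan X''\<close> \<open>\<kappa> \<in> fan Y\<close> by blast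
    then show "\<tau> \<in> \<Sigma>" using \<tau>(3) by (auto simp: \<Sigma>_def)
  }
  fix \<tau> assume "\<tau> \<in> \<Sigma>"
  then obtain \<tau>' \<tau>'' where \<tau>: "(\<tau>', \<tau>'') \<in> pairs" "\<tau> = fcone \<tau>' \<tau>''" by (auto simp: \<Sigma>_def)
  show "face_of_cone N (\<sigma> \<inter> \<tau>) \<sigma>" "face_of_cone N (\<sigma> \<inter> \<tau>) \<tau>"
    unfolding \<sigma>(2) \<tau>(2) fcone_Int
    using pairsD \<sigma>(1) \<tau>(1)
    by (auto intro!: fcone_face is_fanD(4,5)[OF X'(3)] is_fanD(4,5)[OF X''(3)])
qed

end

section \<open>Admissibility of a decoration and the two projections\<close>

locale dfan_cospan_decoration = dfan_cospan X' X'' Y \<phi>' \<phi>'' a' a''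
  for X' :: "'a::ab_group_add dfan" and X'' :: "'b::ab_group_add dfan"
    and Y :: "'q::ab_group_add dfan" and \<phi>' \<phi>'' a' a'' +
  fixes \<B> :: "('a \<times> 'b) rcone \<Rightarrow> ('a \<times> 'b \<Rightarrow> int) set"
  assumes decoration: "fp_decoration X' X'' Y (\<phi>', a') (\<phi>'', a'') \<B>"
begin

lemma \<B>_props:
  assumes p: "(\<sigma>', \<sigma>'') \<in> pairs"
  shows "\<B> (fcone \<sigma>' \<sigma>'') \<subseteq> dual_monoid N (fcone \<sigma>' \<sigma>'')"
    "up_closure (dual_monoid N (fcone \<sigma>' \<sigma>'')) (\<B> (fcone \<sigma>' \<sigma>'')) =
      up_closure (dual_monoid N (fcone \<sigma>' \<sigma>'')) (igens \<sigma>' \<sigma>'')"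
    "b1 \<in> \<B> (fcone \<sigma>' \<sigma>'') \<Longrightarrow> b2 \<in> \<B> (fcone \<sigma>' \<sigma>'') \<Longrightarrow> cone_le N (fcone \<sigma>' \<sigma>'') b1 b2 \<Longrightarrow> b1 = b2"
  using submonoid.minimal_monomial_generators_iff[OF submonoid_fcone igens_subset(2)[OF p], of "\<B> (fcone \<sigma>' \<sigma>'')"]
    decoration p unfolding fp_decoration_iff cone_le_def by auto

lemma \<B>_below:
  assumes p: "(\<sigma>', \<sigma>'') \<in> pairs" and "m \<in> igens \<sigma>' \<sigma>''"
  shows "\<exists>b\<in>\<B> (fcone \<sigma>' \<sigma>''). cone_le N (fcone \<sigma>' \<sigma>'') b m"
proof -
  have "m \<in> up_closure (dual_monoid N (fcone \<sigma>' \<sigma>'')) (\<B> (fcone \<sigma>' \<sigma>''))"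
    unfolding \<B>_props(2)[OF p] by (rule submonoid.up_closure_self[OF submonoid_fcone assms(2)])
  then show ?thesis by (auto simp: up_closure_def cone_le_def)
qed

lemma \<B>_above:
  assumes p: "(\<sigma>', \<sigma>'') \<in> pairs" and "b \<in> \<B> (fcone \<sigma>' \<sigma>'')"
  shows "\<exists>m\<in>igens \<sigma>' \<sigma>''. cone_le N (fcone \<sigma>' \<sigma>'') m b"
proof -
  have "b \<in> up_closure (dual_monoid N (fcone \<sigma>' \<sigma>'')) (igens \<sigma>' \<sigma>'')"
    unfolding \<B>_props(2)[OF p, symmetric] by (rule submonoid.up_closure_self[OF submonoid_fcone assms(2)])
  then show ?thesis by (auto simp: up_closure_def cone_le_def)
qed

lemma \<B>_compatible:
  assumes p: "(\<sigma>', \<sigma>'') \<in> pairs" "(\<tau>', \<tau>'') \<in> pairs" and b: "b \<in> \<B> (fcone \<sigma>' \<sigma>'')"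
  shows "\<exists>b'\<in>\<B> (fcone \<tau>' \<tau>''). cone_le N (fcone \<sigma>' \<sigma>'' \<inter> fcone \<tau>' \<tau>'') b' b"
proof -
  let ?\<sigma> = "fcone \<sigma>' \<sigma>''" and ?\<tau> = "fcone \<tau>' \<tau>''"
  have ext: "?\<sigma> \<inter> ?\<tau> \<subseteq> ext N" using fcone_ext by blast
  obtain m where m: "m \<in> igens \<sigma>' \<sigma>''" "cone_le N ?\<sigma> m b" using \<B>_above[OF p(1) b] by blast
  \<comment> \<open>It suffices to compare generators of the two ideals: \<open>b\<close> lies above
    \<open>m\<close>, and some element of the decoration of the second cone lies below
    \<open>m'\<close>.\<close>
  have "\<exists>m'\<in>igens \<tau>' \<tau>''. cone_le N (?\<sigma> \<inter> ?\<tau>) m' m"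
  proof (cases "m \<in> gens \<sigma>' \<sigma>''")
    case True
    then show ?thesis using gens_compatible[OF p True subset_refl] by (auto simp: igens_def)
  next
    case False
    then have mS: "m \<in> dual_monoid N ?\<sigma>" and cm: "c m \<noteq> 0" using m(1) by (auto simp: igens_def)
    have "face_of_cone N (?\<sigma> \<inter> ?\<tau>) ?\<tau>"
      using is_fanD(5)[OF is_fan_\<Sigma>] p by (auto simp: \<Sigma>_def)
    moreover have "m \<in> dual_monoid N (?\<sigma> \<inter> ?\<tau>)" using mS by (auto simp: dual_monoid_def)
    ultimately obtain m0 k0 where m0: "m0 \<in> dual N" "\<And>x. x \<in> ?\<sigma> \<inter> ?\<tau> \<Longrightarrow> x m0 = 0"
      and k0: "\<And>k. k \<ge> k0 \<Longrightarrow> (\<lambda>n. k * m0 n) + m \<in> dual_monoid N ?\<tau>"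
      using face_dual_monoid[OF lat_N sc_fcone[OF p(2)]] by blast
    have mN: "m \<in> dual N" using mS by (simp add: dual_monoid_def)
    have i: "(\<lambda>n. k * m0 n) \<in> dual N" for k by (rule subgrp_int_mult[OF subgrp_dual m0(1)])
    have ck: "c ((\<lambda>n. k * m0 n) + m) = of_int k * c m0 + c m" for k
      unfolding ext_add[OF c_props(1) i mN] ext_int_mult[OF c_props(1) m0(1)] ..
    \<comment> \<open>If the value at \<open>k0\<close> is 0, then \<open>c m0 \<noteq> 0\<close>
      because \<open>c m \<noteq> 0\<close>, and the value at \<open>k0 + 1\<close> is
      \<open>c m0\<close>.\<close>
    obtain k where k: "k \<ge> k0" "c ((\<lambda>n. k * m0 n) + m) \<noteq> 0"
    proof (cases "c ((\<lambda>n. k0 * m0 n) + m) = 0")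
      case True
      then have "of_int k0 * c m0 + c m = 0" unfolding ck .
      moreover from this have "c m0 \<noteq> 0" using cm by auto
      moreover have "of_int (k0 + 1) * c m0 + c m = (of_int k0 * c m0 + c m) + c m0"
        by (simp add: algebra_simps)
      ultimately have "of_int (k0 + 1) * c m0 + c m \<noteq> 0" by (simp only: add_0_left not_False_eq_True)
      then show thesis using that[of "k0 + 1"] unfolding ck by simp
    qed (use that in blast)
    have "(\<lambda>n. k * m0 n) + m \<in> igens \<tau>' \<tau>''" using k0[OF k(1)] k(2) by (simp add: igens_def)
    \<comment> \<open>On the common face \<open>m0\<close> vanishes, so there the two forms take the
      same values.\<close>
    moreover have "cone_le N (?\<sigma> \<inter> ?\<tau>) ((\<lambda>n. k * m0 n) + m) m"
    proof -
      have eq: "m - ((\<lambda>n. k * m0 n) + m) = (\<lambda>n. (- k) * m0 n)" by (auto simp: fun_eq_iff)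
      have "0 \<le> x (\<lambda>n. (- k) * m0 n)" if x: "x \<in> ?\<sigma> \<inter> ?\<tau>" for x
      proof -
        have "x \<in> ext N" using x ext by blast
        from ext_int_mult[OF this m0(1), of "- k"] show ?thesis using m0(2)[OF x] by simp
      qed
      then show ?thesis unfolding cone_le_def eq dual_monoid_def using i[of "- k"] by blast
    qed
    ultimately show ?thesis by blast
  qed
  then obtain m' where m': "m' \<in> igens \<tau>' \<tau>''" "cone_le N (?\<sigma> \<inter> ?\<tau>) m' m" by blast
  obtain b' where b': "b' \<in> \<B> ?\<tau>" "cone_le N ?\<tau> b' m'" using \<B>_below[OF p(2) m'(1)] by blast
  have "cone_le N (?\<sigma> \<inter> ?\<tau>) b' m'" "cone_le N (?\<sigma> \<inter> ?\<tau>) m b"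
    using cone_le_subset[OF _ b'(2)] cone_le_subset[OF _ m(2)] by auto
  then have "cone_le N (?\<sigma> \<inter> ?\<tau>) b' b" using cone_le_trans[OF ext] m'(2) by blast
  then show ?thesis using b'(1) by blast
qed

abbreviation "P \<equiv> fp_object X' X'' Y (\<phi>', a') (\<phi>'', a'') \<B>"

lemma decorated_fan_P: "decorated_fan P"
  unfolding decorated_fan_def fp_object_sel
proof (intro conjI lat_N c_props(1) is_fan_\<Sigma>)
  show "admissible N c \<Sigma> \<B>"
    unfolding admissible_def
  proof (intro conjI ballI impI)
    fix \<sigma> assume "\<sigma> \<in> \<Sigma>"
    then obtain \<sigma>' \<sigma>'' where p: "(\<sigma>', \<sigma>'') \<in> pairs" and \<sigma>: "\<sigma> = fcone \<sigma>' \<sigma>''" by (auto simp: \<Sigma>_def)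
    show "finite (\<B> \<sigma>)" unfolding \<sigma>
      by (rule dual_monoid_antichain_finite[OF sc_fcone[OF p] \<B>_props(1)[OF p]])
        (rule \<B>_props(3)[OF p, unfolded cone_le_def])
    show "\<B> \<sigma> \<noteq> {}" using gens_nonempty[OF p] \<B>_below[OF p] unfolding \<sigma> igens_def by blast
    show "\<B> \<sigma> \<subseteq> dual_monoid N \<sigma>" unfolding \<sigma> by (rule \<B>_props(1)[OF p])
    show "\<exists>b\<in>\<B> \<sigma>. cone_le N \<sigma> b m" if "m \<in> dual_monoid N \<sigma>" "c m \<noteq> 0" for m
      using \<B>_below[OF p, of m] that unfolding \<sigma> igens_def by blast
    show "a = b" if "a \<in> \<B> \<sigma>" "b \<in> \<B> \<sigma>" "cone_le N \<sigma> a b" for a b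
      using \<B>_props(3)[OF p] that unfolding \<sigma> by blast
    fix \<tau> b assume "\<tau> \<in> \<Sigma>" "b \<in> \<B> \<sigma>"
    then show "\<exists>b'\<in>\<B> \<tau>. cone_le N (\<sigma> \<inter> \<tau>) b' b"
      using \<B>_compatible[OF p] unfolding \<sigma> by (auto simp: \<Sigma>_def)
  qed
qed

text \<open>The decoration condition concerns every cone \<open>\<tau>'\<close> of \<open>X'\<close>
  that contains the image of \<open>\<sigma>\<close>, not only the component
  \<open>\<sigma>'\<close> of the pair. Condition (ii) for \<open>X'\<close> passes from
  \<open>\<tau>'\<close> to \<open>\<sigma>'\<close> over their intersection, which contains the
  image too.\<close>

lemma proj1_morphism: "dfan_morphism P X' (proj1 N, a'')"
proof (rule dfan_morphismI[OF decorated_fan_P dfan_morphismD(1)[OF mor']]; unfold fp_object_sel)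
  show "proj1 N \<in> Homs N (lat X')" by (rule proj1_hom)
  show "ext_map (lat X') (proj1 N) c = scale (a''\<^sup>2) (pt X')" by (rule c_props(2))
next
  fix \<sigma> assume "\<sigma> \<in> \<Sigma>"
  then obtain \<sigma>' \<sigma>'' where p: "(\<sigma>', \<sigma>'') \<in> pairs" and \<sigma>: "\<sigma> = fcone \<sigma>' \<sigma>''" by (auto simp: \<Sigma>_def)
  show "\<exists>\<sigma>'\<in>fan X'. ext_map (lat X') (proj1 N) ` \<sigma> \<subseteq> \<sigma>'"
    unfolding \<sigma> by (rule bexI[OF proj1_fcone pairsD(1)[OF p]])
next
  fix \<sigma> \<tau>' b assume a: "a'' \<noteq> 0" and "\<sigma> \<in> \<Sigma>" and \<tau>': "\<tau>' \<in> fan X'" "b \<in> dec X' \<tau>'"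
    and im: "ext_map (lat X') (proj1 N) ` \<sigma> \<subseteq> \<tau>'"
  then obtain \<sigma>' \<sigma>'' where p: "(\<sigma>', \<sigma>'') \<in> pairs" and \<sigma>: "\<sigma> = fcone \<sigma>' \<sigma>''" by (auto simp: \<Sigma>_def)
  obtain b1 where b1: "b1 \<in> dec X' \<sigma>'" "cone_le (lat X') (\<tau>' \<inter> \<sigma>') b1 b"
    using admissibleD(5)[OF X'(4) \<tau>'(1) pairsD(1)[OF p] \<tau>'(2)] by blast
  have "ext_map (lat X') (proj1 N) ` \<sigma> \<subseteq> \<tau>' \<inter> \<sigma>'" using im proj1_fcone unfolding \<sigma> by blast
  from cone_le_pullback[OF proj1_hom this b1(2)]
  have le: "cone_le N \<sigma> (pullback (proj1 N) b1) (pullback (proj1 N) b)" .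
  have "pullback (proj1 N) b1 \<in> igens \<sigma>' \<sigma>''" using a b1(1) by (simp add: igens_def gens_def)
  from \<B>_below[OF p this] obtain b2 where b2: "b2 \<in> \<B> \<sigma>" "cone_le N \<sigma> b2 (pullback (proj1 N) b1)"
    unfolding \<sigma> by blast
  have "\<sigma> \<subseteq> ext N" unfolding \<sigma> by (rule fcone_ext)
  from cone_le_trans[OF this b2(2) le] b2(1)
  show "\<exists>b2\<in>\<B> \<sigma>. cone_le N \<sigma> b2 (pullback (proj1 N) b)" by blast
qed

lemma proj2_morphism: "dfan_morphism P X'' (proj2 N, a')"
proof (rule dfan_morphismI[OF decorated_fan_P dfan_morphismD(1)[OF mor'']]; unfold fp_object_sel)
  show "proj2 N \<in> Homs N (lat X'')" by (rule proj2_hom)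
  show "ext_map (lat X'') (proj2 N) c = scale (a'\<^sup>2) (pt X'')" by (rule c_props(3))
next
  fix \<sigma> assume "\<sigma> \<in> \<Sigma>"
  then obtain \<sigma>' \<sigma>'' where p: "(\<sigma>', \<sigma>'') \<in> pairs" and \<sigma>: "\<sigma> = fcone \<sigma>' \<sigma>''" by (auto simp: \<Sigma>_def)
  show "\<exists>\<sigma>''\<in>fan X''. ext_map (lat X'') (proj2 N) ` \<sigma> \<subseteq> \<sigma>''"
    unfolding \<sigma> by (rule bexI[OF proj2_fcone pairsD(2)[OF p]])
next
  fix \<sigma> \<tau>'' b assume a: "a' \<noteq> 0" and "\<sigma> \<in> \<Sigma>" and \<tau>'': "\<tau>'' \<in> fan X''" "b \<in> dec X'' \<tau>''"
    and im: "ext_map (lat X'') (proj2 N) ` \<sigma> \<subseteq> \<tau>''"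
  then obtain \<sigma>' \<sigma>'' where p: "(\<sigma>', \<sigma>'') \<in> pairs" and \<sigma>: "\<sigma> = fcone \<sigma>' \<sigma>''" by (auto simp: \<Sigma>_def)
  obtain b1 where b1: "b1 \<in> dec X'' \<sigma>''" "cone_le (lat X'') (\<tau>'' \<inter> \<sigma>'') b1 b"
    using admissibleD(5)[OF X''(4) \<tau>''(1) pairsD(2)[OF p] \<tau>''(2)] by blast
  have "ext_map (lat X'') (proj2 N) ` \<sigma> \<subseteq> \<tau>'' \<inter> \<sigma>''" using im proj2_fcone unfolding \<sigma> by blast
  from cone_le_pullback[OF proj2_hom this b1(2)]
  have le: "cone_le N \<sigma> (pullback (proj2 N) b1) (pullback (proj2 N) b)" .
  have "pullback (proj2 N) b1 \<in> igens \<sigma>' \<sigma>''" using a b1(1) by (simp add: igens_def gens_def)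
  from \<B>_below[OF p this] obtain b2 where b2: "b2 \<in> \<B> \<sigma>" "cone_le N \<sigma> b2 (pullback (proj2 N) b1)"
    unfolding \<sigma> by blast
  have "\<sigma> \<subseteq> ext N" unfolding \<sigma> by (rule fcone_ext)
  from cone_le_trans[OF this b2(2) le] b2(1)
  show "\<exists>b2\<in>\<B> \<sigma>. cone_le N \<sigma> b2 (pullback (proj2 N) b)" by blast
qed

end

section \<open>The universal property\<close>

context dfan_cospan
begin

text \<open>
  The cones \<open>\<sigma>'\<close>, \<open>\<sigma>''\<close> containing the images of \<open>\<rho>\<close> need not form a pair: they are first cut down to
  the faces mapping into a common cone of the fan of \<open>Y\<close>.
\<close>

lemma pair_containing:
  assumes \<rho>: "\<rho> \<subseteq> ext L" and \<psi>: "\<psi> \<in> Homs L N"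
    and \<sigma>': "\<sigma>' \<in> fan X'" "ext_map (lat X') (proj1 N \<circ> \<psi>) ` \<rho> \<subseteq> \<sigma>'"
    and \<sigma>'': "\<sigma>'' \<in> fan X''" "ext_map (lat X'') (proj2 N \<circ> \<psi>) ` \<rho> \<subseteq> \<sigma>''"
  shows "\<exists>(\<tau>', \<tau>'')\<in>pairs. ext_map N \<psi> ` \<rho> \<subseteq> fcone \<tau>' \<tau>''"
proof -
  obtain \<kappa>' where \<kappa>': "\<kappa>' \<in> fan Y" "ext_map (lat Y) \<phi>' ` \<sigma>' \<subseteq> \<kappa>'"
    using dfan_morphismD(5)[OF mor' \<sigma>'(1)] by blast
  obtain \<kappa>'' where \<kappa>'': "\<kappa>'' \<in> fan Y" "ext_map (lat Y) \<phi>'' ` \<sigma>'' \<subseteq> \<kappa>''"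
    using dfan_morphismD(5)[OF mor'' \<sigma>''(1)] by blast
  define \<kappa> where "\<kappa> = \<kappa>' \<inter> \<kappa>''"
  have face: "face_of_cone (lat Y) \<kappa> \<kappa>'" "face_of_cone (lat Y) \<kappa> \<kappa>''"
    unfolding \<kappa>_def by (rule is_fanD(4)[OF Y(3) \<kappa>'(1) \<kappa>''(1)], rule is_fanD(5)[OF Y(3) \<kappa>'(1) \<kappa>''(1)])
  have \<kappa>: "\<kappa> \<in> fan Y" by (rule is_fanD(3)[OF Y(3) \<kappa>'(1) face(1)])
  define \<tau>' where "\<tau>' = {x \<in> \<sigma>'. ext_map (lat Y) \<phi>' x \<in> \<kappa>}"
  define \<tau>'' where "\<tau>'' = {x \<in> \<sigma>''. ext_map (lat Y) \<phi>'' x \<in> \<kappa>}"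
  have "\<tau>' \<in> fan X'" unfolding \<tau>'_def
    by (rule is_fanD(3)[OF X'(3) \<sigma>'(1)], rule face_preimage[OF hom' face(1) _ \<kappa>'(2)],
        rule sc_rational_cone_ext[OF is_fanD(2)[OF X'(3) \<sigma>'(1)]])
  moreover have "\<tau>'' \<in> fan X''" unfolding \<tau>''_def
    by (rule is_fanD(3)[OF X''(3) \<sigma>''(1)], rule face_preimage[OF hom'' face(2) _ \<kappa>''(2)],
        rule sc_rational_cone_ext[OF is_fanD(2)[OF X''(3) \<sigma>''(1)]])
  ultimately have "(\<tau>', \<tau>'') \<in> pairs"
    unfolding in_pairs using \<kappa> by (auto simp: \<tau>'_def \<tau>''_def intro!: bexI[of _ \<kappa>])
  moreover have "ext_map N \<psi> x \<in> fcone \<tau>' \<tau>''" if x: "x \<in> \<rho>" for x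
  proof -
    have 1: "ext_map (lat X') (proj1 N) (ext_map N \<psi> x) \<in> \<sigma>'"
      using \<sigma>'(2) x unfolding ext_map_comp[OF proj1_hom] by blast
    have 2: "ext_map (lat X'') (proj2 N) (ext_map N \<psi> x) \<in> \<sigma>''"
      using \<sigma>''(2) x unfolding ext_map_comp[OF proj2_hom] by blast
    \<comment> \<open>The two ways to \<open>Y\<close> agree, so the image lies in
      \<open>\<kappa>'\<close> and in \<open>\<kappa>''\<close>, hence in
      \<open>\<kappa>\<close>.\<close>
    have eq: "ext_map (lat Y) \<phi>' (ext_map (lat X') (proj1 N) (ext_map N \<psi> x)) =
        ext_map (lat Y) \<phi>'' (ext_map (lat X'') (proj2 N) (ext_map N \<psi> x))"
      unfolding ext_map_comp[OF hom'] ext_map_comp[OF hom''] proj_commute ..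
    have "ext_map (lat Y) \<phi>' (ext_map (lat X') (proj1 N) (ext_map N \<psi> x)) \<in> \<kappa>"
      using \<kappa>'(2) \<kappa>''(2) 1 2 eq unfolding \<kappa>_def by auto
    then have "ext_map (lat X') (proj1 N) (ext_map N \<psi> x) \<in> \<tau>'"
        "ext_map (lat X'') (proj2 N) (ext_map N \<psi> x) \<in> \<tau>''"
      using 1 2 eq by (simp_all add: \<tau>'_def \<tau>''_def)
    moreover have "ext_map N \<psi> x \<in> ext N" using \<rho> x by (intro ext_map_ext[OF \<psi>]) auto
    ultimately show ?thesis by (simp add: in_fcone)
  qed
  ultimately show ?thesis by blast
qed

end

context dfan_cospan_decoration
begin

text \<open>The equation of points is checked on the two projections. For the decorations it
  suffices to treat a generator \<open>m\<close> below \<open>\<beta>\<close>: pulled back forms are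
  handled by the morphisms to \<open>X'\<close> and \<open>X''\<close>, and a form with
  \<open>c m \<noteq> 0\<close> by condition (i) for \<open>T\<close>, since the point of
  \<open>T\<close> takes the value \<open>b\<^sup>2 * c m\<close> on its pullback.\<close>

lemma mediating_morphism:
  assumes g': "dfan_morphism T X' (proj1 N \<circ> \<psi>, b * a'')"
    and g'': "dfan_morphism T X'' (proj2 N \<circ> \<psi>, b * a')"
    and \<psi>: "\<psi> \<in> Homs (lat T) N"
  shows "dfan_morphism T P (\<psi>, b)"
proof -
  note T = decorated_fanD[OF dfan_morphismD(1)[OF g']]
  have Text: "\<rho> \<subseteq> ext (lat T)" if "\<rho> \<in> fan T" for \<rho>
    by (rule sc_rational_cone_ext[OF is_fanD(2)[OF T(3) that]])
  have ptT: "ext_map N \<psi> (pt T) = scale (b\<^sup>2) c"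
  proof (rule ext_proj_eqI)
    show "ext_map N \<psi> (pt T) \<in> ext N" by (rule ext_map_ext[OF \<psi> T(2)])
    show "scale (b\<^sup>2) c \<in> ext N" by (rule scale_ext[OF c_props(1)])
    show "ext_map (lat X') (proj1 N) (ext_map N \<psi> (pt T)) = ext_map (lat X') (proj1 N) (scale (b\<^sup>2) c)"
      unfolding ext_map_comp[OF proj1_hom] dfan_morphismD(4)[OF g'] ext_map_scale c_props(2) scale_scale
      by (simp add: power_mult_distrib)
    show "ext_map (lat X'') (proj2 N) (ext_map N \<psi> (pt T)) = ext_map (lat X'') (proj2 N) (scale (b\<^sup>2) c)"
      unfolding ext_map_comp[OF proj2_hom] dfan_morphismD(4)[OF g''] ext_map_scale c_props(3) scale_scale
      by (simp add: power_mult_distrib)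
  qed
  show ?thesis
  proof (rule dfan_morphismI[OF dfan_morphismD(1)[OF g'] decorated_fan_P]; unfold fp_object_sel)
    show "\<psi> \<in> Homs (lat T) N" by (rule \<psi>)
    show "ext_map N \<psi> (pt T) = scale (b\<^sup>2) c" by (rule ptT)
  next
    fix \<rho> assume \<rho>: "\<rho> \<in> fan T"
    obtain \<sigma>' where \<sigma>': "\<sigma>' \<in> fan X'" "ext_map (lat X') (proj1 N \<circ> \<psi>) ` \<rho> \<subseteq> \<sigma>'"
      using dfan_morphismD(5)[OF g' \<rho>] by blast
    obtain \<sigma>'' where \<sigma>'': "\<sigma>'' \<in> fan X''" "ext_map (lat X'') (proj2 N \<circ> \<psi>) ` \<rho> \<subseteq> \<sigma>''"
      using dfan_morphismD(5)[OF g'' \<rho>] by blast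
    show "\<exists>\<sigma>\<in>\<Sigma>. ext_map N \<psi> ` \<rho> \<subseteq> \<sigma>"
      using pair_containing[OF Text[OF \<rho>] \<psi> \<sigma>' \<sigma>''] unfolding \<Sigma>_def by auto
  next
    fix \<rho> \<sigma> \<beta> assume b: "b \<noteq> 0" and \<rho>: "\<rho> \<in> fan T" and "\<sigma> \<in> \<Sigma>"
      and im: "ext_map N \<psi> ` \<rho> \<subseteq> \<sigma>" and \<beta>: "\<beta> \<in> \<B> \<sigma>"
    then obtain \<sigma>' \<sigma>'' where p: "(\<sigma>', \<sigma>'') \<in> pairs" and \<sigma>: "\<sigma> = fcone \<sigma>' \<sigma>''" by (auto simp: \<Sigma>_def)
    obtain m where m: "m \<in> igens \<sigma>' \<sigma>''" "cone_le N \<sigma> m \<beta>"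
      using \<B>_above[OF p \<beta>[unfolded \<sigma>]] unfolding \<sigma> by blast
    have le: "cone_le (lat T) \<rho> (pullback \<psi> m) (pullback \<psi> \<beta>)"
      by (rule cone_le_pullback[OF \<psi> im m(2)])
    consider "m \<in> dual_monoid N \<sigma>" "c m \<noteq> 0"
      | m' where "a'' \<noteq> 0" "m' \<in> dec X' \<sigma>'" "m = pullback (proj1 N) m'"
      | m'' where "a' \<noteq> 0" "m'' \<in> dec X'' \<sigma>''" "m = pullback (proj2 N) m''"
      using m(1) unfolding igens_def gens_def \<sigma> by (auto split: if_splits)
    then have "\<exists>t\<in>dec T \<rho>. cone_le (lat T) \<rho> t (pullback \<psi> m)"
    proof cases
      case 1
      have "m \<in> dual N" using 1(1) by (simp add: dual_monoid_def)
      then have "pt T (pullback \<psi> m) = b\<^sup>2 * c m"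
        using fun_cong[OF ptT, of m] by (simp add: ext_map_apply scale_def)
      then have "pt T (pullback \<psi> m) \<noteq> 0" using b 1(2) by simp
      then show ?thesis by (rule admissibleD(4)[OF T(4) \<rho> dual_monoid_pullback[OF \<psi> im 1(1)]])
    next
      case 2
      \<comment> \<open>Here \<open>b * a'' \<noteq> 0\<close>, so the decoration condition of the
        morphism to \<open>X'\<close> is in force.\<close>
      have "ext_map (lat X') (proj1 N \<circ> \<psi>) ` \<rho> \<subseteq> \<sigma>'"
        using im unfolding \<sigma> ext_map_comp[OF proj1_hom, symmetric] by (auto simp: in_fcone)
      then show ?thesis
        using dfan_morphismD(6)[OF g' _ \<rho> pairsD(1)[OF p] _ 2(2)] b 2(1,3) by (simp add: pullback_comp)
    next
      case 3
      have "ext_map (lat X'') (proj2 N \<circ> \<psi>) ` \<rho> \<subseteq> \<sigma>''"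
        using im unfolding \<sigma> ext_map_comp[OF proj2_hom, symmetric] by (auto simp: in_fcone)
      then show ?thesis
        using dfan_morphismD(6)[OF g'' _ \<rho> pairsD(2)[OF p] _ 3(2)] b 3(1,3) by (simp add: pullback_comp)
    qed
    then show "\<exists>t\<in>dec T \<rho>. cone_le (lat T) \<rho> t (pullback \<psi> \<beta>)"
      using cone_le_trans[OF Text[OF \<rho>] _ le] by blast
  qed
qed

lemma universal_property:
  assumes g': "dfan_morphism T X' (\<psi>', b')" and g'': "dfan_morphism T X'' (\<psi>'', b'')"
    and comm: "\<phi>' \<circ> \<psi>' = \<phi>'' \<circ> \<psi>''" "b' * a' = b'' * a''"
  shows "\<exists>!h. dfan_morphism T P h \<and> dfan_comp (proj1 N, a'') h = (\<psi>', b') \<and>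
    dfan_comp (proj2 N, a') h = (\<psi>'', b'')"
proof (rule ex_ex1I)
  note h' = dfan_morphismD(3)[OF g'] and h'' = dfan_morphismD(3)[OF g'']
  define \<psi> where "\<psi> = (\<lambda>t. if t \<in> lat T then (\<psi>' t, \<psi>'' t) else 0)"
  \<comment> \<open>By \<open>comm\<close> either quotient serves when both make sense. If
    \<open>a'' = 0\<close>, then \<open>a' \<noteq> 0\<close> and \<open>comm\<close> forces
    \<open>b' = 0\<close>, so \<open>b * a'' = b'\<close> holds as well.\<close>
  define b where "b = (if a'' \<noteq> 0 then b' / a'' else b'' / a')"
  have b: "b * a'' = b'" "b * a' = b''"
    using nz comm(2) by (auto simp: b_def field_simps)
  have inN: "(\<psi>' t, \<psi>'' t) \<in> N" if "t \<in> lat T" for t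
    using Homs_in[OF h' that] Homs_in[OF h'' that] fun_cong[OF comm(1), of t] by (simp add: in_N)
  have subT: "subgrp (lat T)"
    by (rule is_lattice_subgrp[OF decorated_fanD(1)[OF dfan_morphismD(1)[OF g']]])
  have \<psi>: "\<psi> \<in> Homs (lat T) N"
    unfolding Homs_def using inN subgrp_add[OF subT] Homs_add[OF h'] Homs_add[OF h'']
    by (auto simp: \<psi>_def plus_prod_def)
  have comp: "proj1 N \<circ> \<psi> = \<psi>'" "proj2 N \<circ> \<psi> = \<psi>''"
    using inN Homs_outside[OF h'] Homs_outside[OF h'']
    by (auto simp: fun_eq_iff \<psi>_def proj1_def proj2_def)
  have "dfan_morphism T P (\<psi>, b)"
    by (rule mediating_morphism) (use g' g'' \<psi> in \<open>simp_all add: comp b\<close>)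
  then show "\<exists>h. dfan_morphism T P h \<and> dfan_comp (proj1 N, a'') h = (\<psi>', b') \<and> dfan_comp (proj2 N, a') h = (\<psi>'', b'')"
    by (intro exI[of _ "(\<psi>, b)"]) (simp add: dfan_comp_def comp b)
next
  fix h1 h2
  assume h: "dfan_morphism T P h1 \<and> dfan_comp (proj1 N, a'') h1 = (\<psi>', b') \<and> dfan_comp (proj2 N, a') h1 = (\<psi>'', b'')"
    "dfan_morphism T P h2 \<and> dfan_comp (proj1 N, a'') h2 = (\<psi>', b') \<and> dfan_comp (proj2 N, a') h2 = (\<psi>'', b'')"
  obtain \<psi>1 b1 \<psi>2 b2 where h12: "h1 = (\<psi>1, b1)" "h2 = (\<psi>2, b2)" by (metis surj_pair)
  have hom: "\<psi>1 \<in> Homs (lat T) N" "\<psi>2 \<in> Homs (lat T) N"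
    using dfan_morphismD(3)[of T P \<psi>1 b1] dfan_morphismD(3)[of T P \<psi>2 b2] h
    unfolding h12 fp_object_sel by blast+
  have eq: "proj1 N \<circ> \<psi>1 = proj1 N \<circ> \<psi>2" "proj2 N \<circ> \<psi>1 = proj2 N \<circ> \<psi>2"
    "b1 * a'' = b2 * a''" "b1 * a' = b2 * a'"
    using h unfolding h12 by (auto simp: dfan_comp_def)
  have "\<psi>1 t = \<psi>2 t" for t
  proof (cases "t \<in> lat T")
    case True
    then show ?thesis
      using Homs_in[OF hom(1) True] Homs_in[OF hom(2) True] fun_cong[OF eq(1), of t] fun_cong[OF eq(2), of t]
      by (simp add: proj1_def proj2_def prod_eq_iff)
  qed (simp add: Homs_outside[OF hom(1)] Homs_outside[OF hom(2)])
  \<comment> \<open>Whichever of \<open>a'\<close> and \<open>a''\<close> is nonzero can be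
    cancelled.\<close>
  moreover have "b1 = b2" using nz eq(3,4) by auto
  ultimately show "h1 = h2" unfolding h12 by blast
qed

lemma fiber_product:
  "is_fiber_product TYPE('t::ab_group_add) X' X'' Y (\<phi>', a') (\<phi>'', a'') P (proj1 N, a'') (proj2 N, a')"
  unfolding is_fiber_product_def
proof (intro conjI allI impI)
  show "dfan_comp (\<phi>', a') (proj1 N, a'') = dfan_comp (\<phi>'', a'') (proj2 N, a')"
    by (simp add: dfan_comp_def proj_commute mult.commute)
  fix T :: "'t dfan" and g' g''
  assume g: "dfan_morphism T X' g' \<and> dfan_morphism T X'' g'' \<and>
    dfan_comp (\<phi>', a') g' = dfan_comp (\<phi>'', a'') g''"
  obtain \<psi>' b' \<psi>'' b'' where "g' = (\<psi>', b')" "g'' = (\<psi>'', b'')" by (metis surj_pair)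
  then show "\<exists>!h. dfan_morphism T P h \<and> dfan_comp (proj1 N, a'') h = g' \<and> dfan_comp (proj2 N, a') h = g''"
    using g universal_property[of T \<psi>' b' \<psi>'' b''] by (simp add: dfan_comp_def)
qed (use mor' mor'' proj1_morphism proj2_morphism in auto)

end

theorem proposition7p21:
  fixes X' :: "'a::ab_group_add dfan" and X'' :: "'b::ab_group_add dfan"
    and Y :: "'q::ab_group_add dfan"
    and \<phi>' :: "'a \<Rightarrow> 'q" and \<phi>'' :: "'b \<Rightarrow> 'q" and a' a'' :: complex
  assumes "dfan_morphism X' Y (\<phi>', a')"
    and "dfan_morphism X'' Y (\<phi>'', a'')"
    and "\<not> (a' = 0 \<and> a'' = 0)"
  shows "(\<exists>\<B>. fp_decoration X' X'' Y (\<phi>', a') (\<phi>'', a'') \<B>) \<and>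
         (\<forall>\<B>. fp_decoration X' X'' Y (\<phi>', a') (\<phi>'', a'') \<B> \<longrightarrow>
            is_fiber_product TYPE('t::ab_group_add) X' X'' Y (\<phi>', a') (\<phi>'', a'')
              (fp_object X' X'' Y (\<phi>', a') (\<phi>'', a'') \<B>)
              (proj1 (fp_lat (lat X') (lat X'') \<phi>' \<phi>''), a'')
              (proj2 (fp_lat (lat X') (lat X'') \<phi>' \<phi>''), a'))"
proof (intro conjI allI impI)
  interpret dfan_cospan X' X'' Y \<phi>' \<phi>'' a' a'' using assms by unfold_locales
  show "\<exists>\<B>. fp_decoration X' X'' Y (\<phi>', a') (\<phi>'', a'') \<B>" by (rule fp_decoration_exists)
  fix \<B> assume "fp_decoration X' X'' Y (\<phi>', a') (\<phi>'', a'') \<B>"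
  then interpret dfan_cospan_decoration X' X'' Y \<phi>' \<phi>'' a' a'' \<B> by unfold_locales
  show "is_fiber_product TYPE('t) X' X'' Y (\<phi>', a') (\<phi>'', a'')
      (fp_object X' X'' Y (\<phi>', a') (\<phi>'', a'') \<B>)
      (proj1 (fp_lat (lat X') (lat X'') \<phi>' \<phi>''), a'')
      (proj2 (fp_lat (lat X') (lat X'') \<phi>' \<phi>''), a')"
    using fiber_product unfolding N_def .
qed

end
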